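(* Let $\mathcal{C}$ be the set of achievable rate-payoff tuples for the cascade network with source distribution $P_X$, side-information channels $P_{W_{(1)}|X}$, $P_{W_{(2)}|Y_{(2)}}$, $P_{W_{(3)}|Y_{(3)}}$ and payoff function $\pi$ (as defined in the context). Then $\mathcal{C}$ contains the set of tuples $(R_0,R_1,R_2,\Pi)$ satisfying $$R_0> I(W;V_{(1)}|U_{(1)}),\qquad R_1\ge I(X;V_{(1)}),\qquad R_2\ge I(X;V_{(2)}),$$ $$\Pi< \min_{z(\cdot)}\mathbb{E}\,\pi\big(X,Y_{(2)},Y_{(3)},z(U_{(1)})\big),$$ for some distribution $P_{X,Y_{(2)},Y_{(3)},U_{(1)},U_{(2)},V_{(1)},V_{(2)},W}$ satisfying 1. $X\sim P_X$; 2. $P_{W|X,Y_{(2)},Y_{(3)},U_{(1)},U_{(2)},V_{(1)},V_{(2)}}=P_{W|X,Y_{(2)},Y_{(3)}}$, where $P_{W|X,Y_{(2)},Y_{(3)}}=P_{W_{(1)}|X}P_{W_{(2)}|Y_{(2)}}P_{W_{(3)}|Y_{(3)}}$ is the given side-information channel; 3. the Markov chain $X - V_{(1)} - Y_{(2)}$; 4. the Markov chain $(X,V_{(1)},Y_{(2)}) - V_{(2)} - Y_{(3)}$; 5. $H(V_{(2)},U_{(1)}|V_{(1)})=0$; 6. $H(U_{(2)}|U_{(1)})=0$ and $H(U_{(2)}|V_{(2)})=0$; 7. the Markov chain $U_{(1)} - U_{(2)} - V_{(2)}$. Here the minimum is over all functions $z$ from the alphabet of $U_{(1)}$ to $\m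athcal{Z}$.
   Context: Conventions: $[2^{nR}]$ denotes a message set of size $2^{nR}$, i.e. $\{1,\dots,2^{nR}\}$. A superscript $n$ denotes a sequence of length $n$, and $W^{t-1}=(W_1,\dots,W_{t-1})$. $A-B-C$ means that $A$ and $C$ are conditionally independent given $B$. $H$ and $I$ denote Shannon entropy and mutual information (base 2). $\mathcal{X},\mathcal{Y}_{(2)},\mathcal{Y}_{(3)},\mathcal{Z}$ are the alphabets of the source, of the actions of nodes 2 and 3, and of the adversary's action. Communication system: Fix rates $R_0,R_1,R_2$ and a block-length $n$. The source $X^n=(X_1,\dots,X_n)$ is i.i.d. with distribution $P_X$ on $\mathcal{X}$, and is observed by node 1. A secret key $K$, uniform on $[2^{nR_0}]$ and independent of $X^n$, is available to all three nodes. Node 1 sends $M_1$ to node 2, node 2 sends $M_2$ to node 3; node 2 produces $Y_{(2)}^n\in\mathcal{Y}_{(2)}^n$ and node 3 produces $Y_{(3)}^n\in\mathcal{Y}_{(3)}^n$. A valid $(R_0,R_1,R_2)$ communication system of block-length $n$ is a joint distribution of $(X^n,K,M_1,M_2,Y_{(2)}^n,Y_{(3)}^n)$ such that: $X^n$ and $K$ are distributed as just described; $M_1\in[2^{nR_1}]$ and $M_2\in[2^{nR_2}]$; and the Markov chains $X^n-(M_1,K)-(M_2,Y_{(2)}^n)$ and $(X^n,M_1,Y_{(2)}^n)-(M_2,K)-Y_{(3)}^n$ hold. Side information: $W=(W_{(1)},W_{(2)},W_{(3)})$, and $W^n$ is the output of the memoryless channel $P_{W|X,Y_{(2)},Y_{(3)}}=P_{W_{(1)}|X}P_{W_{(2)}|Y_{(2)}}P_{W_{(3)}|Y_{(3)}}$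 with input $(X^n,Y_{(2)}^n,Y_{(3)}^n)$; given this input, $W^n$ is conditionally independent of $(K,M_1,M_2)$. At time $t$ the adversary knows $\mathcal{E}_t=\{M_1,M_2,W^{t-1}\}$ and produces $Z_t\in\mathcal{Z}$ according to a conditional distribution $P_{Z_t|\mathcal{E}_t}$, so that $Z_t$ depends on everything else only through $\mathcal{E}_t$. Performance: For a payoff function $\pi:\mathcal{X}\times\mathcal{Y}_{(2)}\times\mathcal{Y}_{(3)}\times\mathcal{Z}\to\mathbb{R}$, the performance of the system is $$\bar\pi=\min_{\{P_{Z_t|\mathcal{E}_t}\}_{t=1}^n}\mathbb{E}\,\frac1n\sum_{t=1}^n\pi(X_t,Y_{(2),t},Y_{(3),t},Z_t).$$ Achievability: $(R_0,R_1,R_2,\Pi)$ is achievable if there exist a block-length $n$ and a valid $(R_0,R_1,R_2)$ communication system of that block-length with $\bar\pi\ge\Pi$. $\mathcal{C}$ is the set of achievable tuples. *)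

theory Defs
  imports "HOL-Probability.Probability"
begin

section \<open>Information measures and Markov chains\<close>

text \<open>All alphabets are finite.  Logarithms are to base 2.  The counting measures make these the usual
  discrete quantities; finiteness matters because the library's integrals silently return 0 when
  they do not converge.\<close>

definition mutual_info :: "'o pmf \<Rightarrow> ('o \<Rightarrow> 'a::finite) \<Rightarrow> ('o \<Rightarrow> 'b::finite) \<Rightarrow> real" where
  "mutual_info P A B =
     prob_space.mutual_information (measure_pmf P) 2 (count_space UNIV) (count_space UNIV) A B"

text \<open>\<open>cond_mutual_info P A B C\<close> is \<open>I(A;B|C)\<close>.\<close>

definition cond_mutual_info ::
  "'o pmf \<Rightarrow> ('o \<Rightarrow> 'a::finite) \<Rightarrow> ('o \<Rightarrow> 'b::finite) \<Rightarrow> ('o \<Rightarrow> 'c::finite) \<Rightarrow> real" where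
  "cond_mutual_info P A B C =
     prob_space.conditional_mutual_information (measure_pmf P) 2
       (count_space UNIV) (count_space UNIV) (count_space UNIV) A B C"

text \<open>\<open>cond_entropy P A B\<close> is \<open>H(A|B)\<close>.\<close>

definition cond_entropy :: "'o pmf \<Rightarrow> ('o \<Rightarrow> 'a::finite) \<Rightarrow> ('o \<Rightarrow> 'b::finite) \<Rightarrow> real" where
  "cond_entropy P A B =
     prob_space.conditional_entropy (measure_pmf P) 2 (count_space UNIV) (count_space UNIV) A B"

text \<open>\<open>markov_chain P A B C\<close> is the Markov chain \<open>A - B - C\<close>.\<close>

definition markov_chain :: "'o pmf \<Rightarrow> ('o \<Rightarrow> 'a) \<Rightarrow> ('o \<Rightarrow> 'b) \<Rightarrow> ('o \<Rightarrow> 'c) \<Rightarrow> bool" where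
  "markov_chain P A B C \<longleftrightarrow>
     (\<forall>a b c. \<P>(s in P. B s = b) > 0 \<longrightarrow>
        \<P>(s in P. A s = a \<and> C s = c \<bar> B s = b) =
        \<P>(s in P. A s = a \<bar> B s = b) * \<P>(s in P. C s = c \<bar> B s = b))"


section \<open>Communication systems\<close>

text \<open>The set \<open>[2\<^sup>n\<^sup>R]\<close>, with the size rounded down to an integer.  It is empty if \<open>R\<close> is negative
  and \<open>n\<close> positive.\<close>

definition message_set :: "nat \<Rightarrow> real \<Rightarrow> nat set" where
  "message_set n R = {1..nat \<lfloor>2 powr (real n * R)\<rfloor>}"

text \<open>Sequences of length \<open>n\<close> are lists; the letter at time \<open>t = 1, \<dots>, n\<close> has list index \<open>t - 1\<close>.\<close>

record ('x, 'y2, 'y3) comm_outcome =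
  source :: "'x list"
  key :: nat
  msg1 :: nat
  msg2 :: nat
  act2 :: "'y2 list"
  act3 :: "'y3 list"

definition valid_system ::
  "nat \<Rightarrow> real \<Rightarrow> real \<Rightarrow> real \<Rightarrow> 'x::finite pmf
     \<Rightarrow> ('x, 'y2::finite, 'y3::finite) comm_outcome pmf \<Rightarrow> bool" where
  "valid_system n R0 R1 R2 PX S \<longleftrightarrow>
     message_set n R0 \<noteq> {} \<and>
     map_pmf (\<lambda>s. (source s, key s)) S =
       pair_pmf (replicate_pmf n PX) (pmf_of_set (message_set n R0)) \<and>
     (\<forall>s\<in>set_pmf S. msg1 s \<in> message_set n R1 \<and> msg2 s \<in> message_set n R2 \<and>
        length (act2 s) = n \<and> length (act3 s) = n) \<and>
     markov_chain S source (\<lambda>s. (msg1 s, key s)) (\<lambda>s. (msg2 s, act2 s)) \<and>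
     markov_chain S (\<lambda>s. (source s, msg1 s, act2 s)) (\<lambda>s. (msg2 s, key s)) act3"


section \<open>Side information, adversary and performance\<close>

definition side_info_channel ::
  "('x \<Rightarrow> 'w1 pmf) \<Rightarrow> ('y2 \<Rightarrow> 'w2 pmf) \<Rightarrow> ('y3 \<Rightarrow> 'w3 pmf)
     \<Rightarrow> 'x \<Rightarrow> 'y2 \<Rightarrow> 'y3 \<Rightarrow> ('w1 \<times> 'w2 \<times> 'w3) pmf" where
  "side_info_channel PW1 PW2 PW3 x y2 y3 = pair_pmf (PW1 x) (pair_pmf (PW2 y2) (PW3 y3))"

text \<open>Independent, not necessarily identically distributed, components.\<close>

primrec indep_list_pmf :: "'a pmf list \<Rightarrow> 'a list pmf" where
  "indep_list_pmf [] = return_pmf []"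
| "indep_list_pmf (p # ps) = do {x \<leftarrow> p; xs \<leftarrow> indep_list_pmf ps; return_pmf (x # xs)}"

text \<open>The conditional distributions of \<open>Z\<^sub>t\<close> given \<open>M\<^sub>1, M\<^sub>2, W\<^sup>t\<^sup>-\<^sup>1\<close>, as a function of the 0-based
  time index, the two messages and the list of past side information.\<close>

type_synonym ('w, 'z) adversary = "nat \<Rightarrow> nat \<Rightarrow> nat \<Rightarrow> 'w list \<Rightarrow> 'z pmf"

text \<open>The joint distribution of the system, \<open>W\<^sup>n\<close> and \<open>Z\<^sup>n\<close>.\<close>

definition attacked_system ::
  "nat \<Rightarrow> ('x \<Rightarrow> 'y2 \<Rightarrow> 'y3 \<Rightarrow> 'w pmf) \<Rightarrow> ('x, 'y2, 'y3) comm_outcome pmf \<Rightarrow> ('w, 'z) adversary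
     \<Rightarrow> (('x, 'y2, 'y3) comm_outcome \<times> 'w list \<times> 'z list) pmf" where
  "attacked_system n PW S adv = do {
     s \<leftarrow> S;
     w \<leftarrow> indep_list_pmf (map (\<lambda>t. PW (source s ! t) (act2 s ! t) (act3 s ! t)) [0..<n]);
     z \<leftarrow> indep_list_pmf (map (\<lambda>t. adv t (msg1 s) (msg2 s) (take t w)) [0..<n]);
     return_pmf (s, w, z)}"

definition expected_payoff ::
  "nat \<Rightarrow> ('x \<Rightarrow> 'y2 \<Rightarrow> 'y3 \<Rightarrow> 'w pmf) \<Rightarrow> ('x \<Rightarrow> 'y2 \<Rightarrow> 'y3 \<Rightarrow> 'z \<Rightarrow> real)
     \<Rightarrow> ('x, 'y2, 'y3) comm_outcome pmf \<Rightarrow> ('w, 'z) adversary \<Rightarrow> real" where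
  "expected_payoff n PW \<pi> S adv =
     measure_pmf.expectation (attacked_system n PW S adv)
       (\<lambda>(s, w, z). (1 / real n) * (\<Sum>t<n. \<pi> (source s ! t) (act2 s ! t) (act3 s ! t) (z ! t)))"

text \<open>The infimum is a minimum: the alphabets are finite, and the expected payoff is affine in each of
  the finitely many distributions on the alphabet of \<open>Z\<close> on which it depends.\<close>

definition performance ::
  "nat \<Rightarrow> ('x::finite \<Rightarrow> 'y2::finite \<Rightarrow> 'y3::finite \<Rightarrow> 'w::finite pmf)
     \<Rightarrow> ('x \<Rightarrow> 'y2 \<Rightarrow> 'y3 \<Rightarrow> 'z::finite \<Rightarrow> real)
     \<Rightarrow> ('x, 'y2, 'y3) comm_outcome pmf \<Rightarrow> real" where
  "performance n PW \<pi> S = (INF adv. expected_payoff n PW \<pi> S adv)"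

definition achievable_region ::
  "'x::finite pmf \<Rightarrow> ('x \<Rightarrow> 'y2::finite \<Rightarrow> 'y3::finite \<Rightarrow> 'w::finite pmf)
     \<Rightarrow> ('x \<Rightarrow> 'y2 \<Rightarrow> 'y3 \<Rightarrow> 'z::finite \<Rightarrow> real) \<Rightarrow> (real \<times> real \<times> real \<times> real) set" where
  "achievable_region PX PW \<pi> =
     {(R0, R1, R2, payoff). \<exists>n\<ge>1. \<exists>S. valid_system n R0 R1 R2 PX S \<and> performance n PW \<pi> S \<ge> payoff}"


section \<open>Single-letter distributions\<close>

text \<open>Outcomes of a joint distribution; the selectors serve as the random variables.\<close>

record ('x, 'y2, 'y3, 'u1, 'u2, 'v1, 'v2, 'w) single_letter =
  rvX :: 'x
  rvY2 :: 'y2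
  rvY3 :: 'y3
  rvU1 :: 'u1
  rvU2 :: 'u2
  rvV1 :: 'v1
  rvV2 :: 'v2
  rvW :: 'w

end

theory Submission
  imports Defs
begin

text \<open>Superposition coding with a likelihood encoder.  Node 2 receives \<open>(i, j)\<close> and passes on \<open>i\<close>; the words
  \<open>u\<^sub>2(i)\<close> and \<open>u\<^sub>1(i, j)\<close> do not depend on the key \<open>k\<close>, whereas \<open>v\<^sub>2(i, k)\<close> and \<open>v\<^sub>1(i, j, k)\<close> do.  By soft
  covering over \<open>(i, j)\<close>, the channel output from a random \<open>v\<^sub>1(i, j, k)\<close> is nearly the i.i.d. source for
  each key, so the encoder may draw \<open>(i, j)\<close> from the posterior distribution given the source and the
  key.  By soft covering over \<open>k\<close>, with rate above \<open>I(W;V\<^sub>1|U\<^sub>1)\<close>, the past side information tells the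
  adversary almost nothing beyond \<open>u\<^sub>1(i, j)\<close>.  Soft covering is proved by truncating likelihood
  ratios and a second moment bound; the tail is bounded by an exponential moment, which is
  multiplicative over the letters.\<close>

section \<open>Finitely supported distributions\<close>

text \<open>The index pattern is dictated by who knows what. Node 3 knows \<open>i\<close> and the
  key but not \<open>j\<close>; the adversary knows \<open>i\<close> and \<open>j\<close> but not
  the key. So, on top of the common \<open>U\<^sub>2\<close>, the letter \<open>V\<^sub>2\<close>
  may vary with \<open>k\<close> only and \<open>U\<^sub>1\<close> with \<open>j\<close> only, and
  they have to be conditionally independent: this is the chain
  \<open>U\<^sub>1 - U\<^sub>2 - V\<^sub>2\<close>. The vanishing entropies make all auxiliary
  letters functions of \<open>V\<^sub>1\<close>, which converts the covering rates into the stated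
  ones: \<open>i\<close> needs \<open>I(X;V\<^sub>2)\<close> and \<open>j\<close> needs
  \<open>I(X;V\<^sub>1|V\<^sub>2)\<close>, with sum \<open>I(X;V\<^sub>1)\<close>. The minimum over
  adversaries stands inside the average over codebooks. Hence the performance of each codebook is
  bounded below by a quantity without the adversary, an ideal payoff less two covering distances,
  and it is this quantity that is averaged. Soft covering needs rates strictly above the
  informations, while \<open>R1\<close> and \<open>R2\<close> may equal theirs. The slack is created
  by perturbing the single-letter law at a small loss of payoff. This fails only at information 0,
  where covering is exact at any rate.\<close>

abbreviation (input) pexp :: "'a pmf \<Rightarrow> ('a \<Rightarrow> real) \<Rightarrow> real" where
  "pexp \<equiv> \<lambda>p. measure_pmf.expectation p"

lemma pexp_bind:
  assumes "finite (set_pmf p)" "\<And>x. x \<in> set_pmf p \<Longrightarrow> finite (set_pmf (f x))"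
  shows "pexp (bind_pmf p f) h = pexp p (\<lambda>x. pexp (f x) h)"
  using assms by (subst pmf_expectation_bind[of "set_pmf p"])
    (auto simp: integral_measure_pmf_real[of "set_pmf p"] mult.commute)

lemma pexp_eq_sum:
  assumes "finite B" "set_pmf p \<subseteq> B"
  shows "pexp p f = (\<Sum>x\<in>B. pmf p x * f x)"
  using assms by (subst integral_measure_pmf_real[of B]) (auto simp: mult.commute)

lemma pexp_mono:
  assumes "finite (set_pmf p)" "\<And>x. x \<in> set_pmf p \<Longrightarrow> f x \<le> g x"
  shows "pexp p f \<le> pexp p g"
  using assms by (intro integral_mono_AE) (auto simp: integrable_measure_pmf_finite AE_measure_pmf_iff)

lemma pexp_cong:
  assumes "\<And>x. x \<in> set_pmf p \<Longrightarrow> f x = g x"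
  shows "pexp p f = pexp p g"
  using assms by (intro integral_cong_AE) (auto simp: AE_measure_pmf_iff)

lemma pexp_nonneg: "(\<And>x. x \<in> set_pmf p \<Longrightarrow> 0 \<le> f x) \<Longrightarrow> 0 \<le> pexp p f"
  by (intro integral_nonneg_AE) (auto simp: AE_measure_pmf_iff)

lemma pexp_add:
  assumes "finite (set_pmf p)"
  shows "pexp p (\<lambda>x. f x + g x) = pexp p f + pexp p g"
  using assms by (intro Bochner_Integration.integral_add) (auto simp: integrable_measure_pmf_finite)

lemma pexp_diff:
  assumes "finite (set_pmf p)"
  shows "pexp p (\<lambda>x. f x - g x) = pexp p f - pexp p g"
  using assms by (intro Bochner_Integration.integral_diff) (auto simp: integrable_measure_pmf_finite)

lemma pexp_sum:
  assumes "finite (set_pmf p)"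
  shows "pexp p (\<lambda>x. \<Sum>i\<in>I. f i x) = (\<Sum>i\<in>I. pexp p (f i))"
  using assms by (intro Bochner_Integration.integral_sum) (auto simp: integrable_measure_pmf_finite)

lemma pexp_const [simp]: "pexp p (\<lambda>_. c) = c"
  by simp

lemma pexp_le_const:
  assumes "finite (set_pmf p)" "\<And>x. x \<in> set_pmf p \<Longrightarrow> f x \<le> c"
  shows "pexp p f \<le> c"
  using pexp_mono[of p f "\<lambda>_. c"] assms by simp

lemma pexp_ge_const:
  assumes "finite (set_pmf p)" "\<And>x. x \<in> set_pmf p \<Longrightarrow> c \<le> f x"
  shows "c \<le> pexp p f"
  using pexp_mono[of p "\<lambda>_. c" f] assms by simp

text \<open>The probabilistic method: it will select a codebook that is at least as good as the
  average one.\<close>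

lemma ex_ge_pexp:
  assumes "finite (set_pmf p)" "c \<le> pexp p f"
  shows "\<exists>x\<in>set_pmf p. c \<le> f x"
proof (rule ccontr)
  assume "\<not> ?thesis"
  then have *: "\<And>x. x \<in> set_pmf p \<Longrightarrow> f x < c" by force
  define m where "m = Max (f ` set_pmf p)"
  have "m \<in> f ` set_pmf p" unfolding m_def
    using assms(1) set_pmf_not_empty[of p] by (intro Max_in) auto
  then have "m < c" using * by auto
  moreover have "pexp p f \<le> m"
    using assms(1) unfolding m_def by (intro pexp_le_const) auto
  ultimately show False using assms by simp
qed

lemma abs_pexp_le:
  assumes "finite (set_pmf p)" "\<And>x. x \<in> set_pmf p \<Longrightarrow> \<bar>f x\<bar> \<le> c"
  shows "\<bar>pexp p f\<bar> \<le> c"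
proof -
  have "pexp p f \<le> c" "- c \<le> pexp p f"
    using assms by (force intro: pexp_le_const pexp_ge_const)+
  then show ?thesis by simp
qed

lemma pexp_commute:
  assumes "finite (set_pmf p)" "finite (set_pmf q)"
  shows "pexp p (\<lambda>x. pexp q (f x)) = pexp q (\<lambda>y. pexp p (\<lambda>x. f x y))"
  using assms
  by (simp add: pexp_eq_sum[OF assms(1) order.refl] pexp_eq_sum[OF assms(2) order.refl]
      sum_distrib_left mult.left_commute) (rule sum.swap)

lemma pexp_pos_imp:
  assumes "x \<in> set_pmf p" "finite (set_pmf p)" "\<And>x. x \<in> set_pmf p \<Longrightarrow> 0 \<le> f x" "pexp p f = 0"
  shows "f x = 0"
proof -
  have "(\<Sum>x\<in>set_pmf p. pmf p x * f x) = 0"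
    using assms by (simp add: pexp_eq_sum[OF assms(2) order.refl])
  then have "\<forall>x\<in>set_pmf p. pmf p x * f x = 0"
    using assms by (subst (asm) sum_nonneg_eq_0_iff) auto
  then show ?thesis using assms by (auto simp: set_pmf_eq)
qed

text \<open>Change of law for a bounded payoff. It is applied twice to each codebook: the true
  source is exchanged for the output of a random codeword, and the observations averaged over the
  key for a memoryless target.\<close>

lemma pexp_diff_le_L1:
  assumes "finite B" "set_pmf p \<subseteq> B" "set_pmf q \<subseteq> B" "\<And>x. x \<in> B \<Longrightarrow> \<bar>f x\<bar> \<le> \<beta>"
  shows "pexp p f \<ge> pexp q f - \<beta> * (\<Sum>x\<in>B. \<bar>pmf p x - pmf q x\<bar>)"
proof -
  have "pexp q f - pexp p f = (\<Sum>x\<in>B. (pmf q x - pmf p x) * f x)"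
    by (simp add: pexp_eq_sum[OF assms(1,2)] pexp_eq_sum[OF assms(1,3)] left_diff_distrib sum_subtractf)
  also have "\<dots> \<le> (\<Sum>x\<in>B. \<bar>pmf p x - pmf q x\<bar> * \<beta>)"
  proof (intro sum_mono)
    fix x assume "x \<in> B"
    have "(pmf q x - pmf p x) * f x \<le> \<bar>(pmf q x - pmf p x) * f x\<bar>" by simp
    also have "\<dots> = \<bar>pmf p x - pmf q x\<bar> * \<bar>f x\<bar>" by (simp add: abs_mult abs_minus_commute)
    also have "\<dots> \<le> \<bar>pmf p x - pmf q x\<bar> * \<beta>" using assms(4)[OF \<open>x \<in> B\<close>] by (intro mult_left_mono) auto
    finally show "(pmf q x - pmf p x) * f x \<le> \<bar>pmf p x - pmf q x\<bar> * \<beta>" .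
  qed
  also have "\<dots> = \<beta> * (\<Sum>x\<in>B. \<bar>pmf p x - pmf q x\<bar>)"
    by (simp add: sum_distrib_left mult.commute)
  finally show ?thesis by simp
qed

lemma pmf_bind_Pair:
  "pmf (bind_pmf p (\<lambda>b. map_pmf (\<lambda>a. (b, a)) (k b))) (b, a) = pmf p b * pmf (k b) a"
proof -
  have eq: "pmf (map_pmf (\<lambda>a'. (b', a')) (k b')) (b, a) = indicator {b} b' * pmf (k b) a" for b'
  proof (cases "b' = b")
    case True
    have "pmf (map_pmf (Pair b) (k b)) (b, a) = pmf (k b) a"
      by (intro pmf_map_inj' injI) simp
    then show ?thesis using True by simp
  next
    case False
    then show ?thesis by (auto simp: pmf_eq_0_set_pmf)
  qed
  show ?thesis unfolding pmf_bind eq by (simp add: measure_pmf_single)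
qed

text \<open>A version of the conditional law of \<open>A\<close> given \<open>B\<close>, total in
  \<open>b\<close>. At a value of probability 0 the choice is arbitrary, but it has to stay within
  the range of \<open>A\<close>: the encoder must output a legal message pair even for a source word
  that no codeword can produce.\<close>

definition reg_cond :: "'o pmf \<Rightarrow> ('o \<Rightarrow> 'a) \<Rightarrow> ('o \<Rightarrow> 'b) \<Rightarrow> 'b \<Rightarrow> 'a pmf" where
  "reg_cond P A B b =
     (if set_pmf P \<inter> {s. B s = b} \<noteq> {} then map_pmf A (cond_pmf P {s. B s = b}) else map_pmf A P)"

lemma set_reg_cond: "set_pmf (reg_cond P A B b) \<subseteq> A ` set_pmf P"
  by (auto simp: reg_cond_def)

text \<open>Bayes' rule as a factorization: drawing \<open>b\<close> from its marginal and
  \<open>a\<close> from the posterior restores the joint law. Values \<open>b\<close> of probability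
  0 contribute nothing to either side.\<close>

lemma bind_reg_cond:
  fixes P :: "'o pmf" and A :: "'o \<Rightarrow> 'a" and B :: "'o \<Rightarrow> 'b"
  shows "bind_pmf (map_pmf B P) (\<lambda>b. map_pmf (\<lambda>a. (b, a)) (reg_cond P A B b)) = map_pmf (\<lambda>s. (B s, A s)) P"
proof (rule pmf_eqI)
  fix ba :: "'b \<times> 'a"
  obtain b a where ba: "ba = (b, a)" by force
  have "pmf (bind_pmf (map_pmf B P) (\<lambda>b. map_pmf (\<lambda>a. (b, a)) (reg_cond P A B b))) (b, a)
     = pmf (map_pmf B P) b * pmf (reg_cond P A B b) a"
    by (rule pmf_bind_Pair)
  also have "\<dots> = measure_pmf.prob P {s. B s = b} * pmf (reg_cond P A B b) a"
    by (simp add: pmf_map vimage_def)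
  also have "\<dots> = measure_pmf.prob P {s. B s = b \<and> A s = a}"
  proof (cases "set_pmf P \<inter> {s. B s = b} \<noteq> {}")
    case True
    then have pos: "measure_pmf.prob P {s. B s = b} \<noteq> 0"
      by (simp add: measure_pmf_zero_iff)
    have "pmf (reg_cond P A B b) a = measure_pmf.prob (cond_pmf P {s. B s = b}) {s. A s = a}"
      using True by (simp add: reg_cond_def pmf_map vimage_def)
    also have "\<dots> = measure_pmf.prob P {s. B s = b \<and> A s = a} / measure_pmf.prob P {s. B s = b}"
      unfolding cond_pmf.rep_eq[OF True]
      using emeasure_measure_pmf_not_zero[OF True]
      by (subst measure_uniform_measure) (auto simp: Int_def)
    finally show ?thesis using pos by simp
  next
    case False
    then have "measure_pmf.prob P {s. B s = b} = 0" "measure_pmf.prob P {s. B s = b \<and> A s = a} = 0"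
      by (auto simp: measure_pmf_zero_iff)
    then show ?thesis by simp
  qed
  also have "\<dots> = pmf (map_pmf (\<lambda>s. (B s, A s)) P) (b, a)"
    by (simp add: pmf_map vimage_def)
  finally show "pmf (bind_pmf (map_pmf B P) (\<lambda>b. map_pmf (\<lambda>a. (b, a)) (reg_cond P A B b))) ba
    = pmf (map_pmf (\<lambda>s. (B s, A s)) P) ba" unfolding ba .
qed

section \<open>Soft covering\<close>

text \<open>Likelihoods exceeding \<open>\<tau>\<close> times the target are cut off; what remains has second moment at
  most \<open>\<tau>\<close> times the target, so pairwise independence of the codewords suffices.\<close>

lemma soft_covering:
  fixes M :: "'m pmf" and S :: "'m \<Rightarrow> 's" and C :: "'i \<Rightarrow> 'm \<Rightarrow> 'c"
    and ch :: "'c \<Rightarrow> 'b pmf"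
  assumes finM: "finite (set_pmf M)" and finS: "finite (set_pmf pS)"
    and fink: "\<And>s. finite (set_pmf (k s))"
    and I: "finite I" "I \<noteq> {}" and B: "finite B" "\<And>c. set_pmf (ch c) \<subseteq> B"
    and law1: "\<And>i. i \<in> I \<Longrightarrow> map_pmf (\<lambda>\<omega>. (S \<omega>, C i \<omega>)) M =
        do {s \<leftarrow> pS; c \<leftarrow> k s; return_pmf (s, c)}"
    and law2: "\<And>i j. i \<in> I \<Longrightarrow> j \<in> I \<Longrightarrow> i \<noteq> j \<Longrightarrow> map_pmf (\<lambda>\<omega>. (S \<omega>, C i \<omega>, C j \<omega>)) M =
        do {s \<leftarrow> pS; c \<leftarrow> k s; c' \<leftarrow> k s; return_pmf (s, c, c')}"
    and \<tau>: "\<tau> > 0"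
  defines "q \<equiv> \<lambda>s. bind_pmf (k s) ch"
  shows "pexp M (\<lambda>\<omega>. \<Sum>b\<in>B. \<bar>(\<Sum>i\<in>I. pmf (ch (C i \<omega>)) b) / card I - pmf (q (S \<omega>)) b\<bar>)
    \<le> 2 * pexp pS (\<lambda>s. pexp (k s) (\<lambda>c. pexp (ch c) (\<lambda>b. if pmf (ch c) b > \<tau> * pmf (q s) b then 1 else 0)))
      + sqrt (\<tau> / card I)"
proof -
  define N where "N = real (card I)"
  have N: "N > 0" using I by (simp add: N_def card_gt_0_iff)
  define F where "F s c b = (if pmf (ch c) b > \<tau> * pmf (q s) b then 0 else pmf (ch c) b)" for s c b
  define G where "G s c b = (if pmf (ch c) b > \<tau> * pmf (q s) b then pmf (ch c) b else 0)" for s c b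
  define \<mu> where "\<mu> s b = pexp (k s) (\<lambda>c. F s c b)" for s b
  define P where "P = pexp pS (\<lambda>s. pexp (k s) (\<lambda>c. pexp (ch c) (\<lambda>b. if pmf (ch c) b > \<tau> * pmf (q s) b then 1 else 0)))"
  have FG: "pmf (ch c) b = F s c b + G s c b" for s c b by (simp add: F_def G_def)
  have F0: "0 \<le> F s c b" and G0: "0 \<le> G s c b" for s c b by (auto simp: F_def G_def)
  have q: "pmf (q s) b = pexp (k s) (\<lambda>c. pmf (ch c) b)" for s b
    unfolding q_def by (rule pmf_bind)
  have q\<mu>: "pmf (q s) b = \<mu> s b + pexp (k s) (\<lambda>c. G s c b)" for s b
    unfolding q \<mu>_def by (subst pexp_add[symmetric, OF fink]) (simp add: FG[symmetric])
  \<comment> \<open>The mass cut off at codeword \<open>c\<close>, summed over the outputs, is the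
    probability under \<open>ch c\<close> that the likelihood ratio exceeds
    \<open>\<tau>\<close>.\<close>
  have G_sum: "(\<Sum>b\<in>B. G s c b) = pexp (ch c) (\<lambda>b. if pmf (ch c) b > \<tau> * pmf (q s) b then 1 else 0)" for s c
    by (subst pexp_eq_sum[OF B]) (auto simp: G_def intro!: sum.cong)
  have E1: "pexp M (\<lambda>\<omega>. f (S \<omega>) (C i \<omega>)) = pexp pS (\<lambda>s. pexp (k s) (f s))" if "i \<in> I" for i f
  proof -
    have "pexp M (\<lambda>\<omega>. f (S \<omega>) (C i \<omega>)) = pexp (map_pmf (\<lambda>\<omega>. (S \<omega>, C i \<omega>)) M) (\<lambda>(s, c). f s c)" by simp
    also have "\<dots> = pexp pS (\<lambda>s. pexp (k s) (f s))"
      unfolding law1[OF that] by (simp add: pexp_bind finS fink)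
    finally show ?thesis .
  qed
  have E2: "pexp M (\<lambda>\<omega>. f (S \<omega>) (C i \<omega>) (C j \<omega>)) = pexp pS (\<lambda>s. pexp (k s) (\<lambda>c. pexp (k s) (f s c)))"
    if "i \<in> I" "j \<in> I" "i \<noteq> j" for i j f
  proof -
    have "pexp M (\<lambda>\<omega>. f (S \<omega>) (C i \<omega>) (C j \<omega>))
      = pexp (map_pmf (\<lambda>\<omega>. (S \<omega>, C i \<omega>, C j \<omega>)) M) (\<lambda>(s, c, c'). f s c c')" by simp
    also have "\<dots> = pexp pS (\<lambda>s. pexp (k s) (\<lambda>c. pexp (k s) (f s c)))"
      unfolding law2[OF that] by (simp add: pexp_bind finS fink)
    finally show ?thesis .
  qed
  have E0: "pexp M (\<lambda>\<omega>. f (S \<omega>)) = pexp pS f" for f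
  proof -
    obtain i where "i \<in> I" using I by blast
    from E1[OF this, of "\<lambda>s c. f s"] show ?thesis by simp
  qed
  have C_supp: "C i \<omega> \<in> set_pmf (k (S \<omega>))" if "i \<in> I" "\<omega> \<in> set_pmf M" for i \<omega>
  proof -
    have "(S \<omega>, C i \<omega>) \<in> set_pmf (map_pmf (\<lambda>\<omega>. (S \<omega>, C i \<omega>)) M)" using that by auto
    then show ?thesis unfolding law1[OF that(1)] by auto
  qed
  define X where "X \<omega> b = (\<Sum>i\<in>I. F (S \<omega>) (C i \<omega>) b) / N - \<mu> (S \<omega>) b" for \<omega> b
  have X_alt: "X \<omega> b = (\<Sum>i\<in>I. F (S \<omega>) (C i \<omega>) b - \<mu> (S \<omega>) b) / N" for \<omega> b
    using N by (simp add: X_def sum_subtractf diff_divide_distrib N_def)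
  \<comment> \<open>The weight in the inequality of arithmetic and geometric means below. This value
    balances the two contributions, whose sum is then exactly \<open>\<alpha>\<close>.\<close>
  define \<alpha> where "\<alpha> = sqrt (\<tau> / N)"
  have \<alpha>: "\<alpha> > 0" "\<alpha>\<^sup>2 = \<tau> / N" using \<tau> N by (auto simp: \<alpha>_def)

  \<comment> \<open>A pointwise substitute for Cauchy-Schwarz over \<open>b\<close> with weight
    \<open>q\<close>. Where \<open>q\<close> is 0 the division gives 0, so the deviation itself must
    vanish; it does, because every codeword in the support of \<open>k\<close> gives such a
    \<open>b\<close> probability 0.\<close>
  have X_bound: "\<bar>X \<omega> b\<bar> \<le> \<alpha> * pmf (q (S \<omega>)) b / 2 + (X \<omega> b)\<^sup>2 / pmf (q (S \<omega>)) b / (2 * \<alpha>)"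
    if "\<omega> \<in> set_pmf M" for \<omega> b
  proof (cases "pmf (q (S \<omega>)) b = 0")
    case True
    then have z: "\<And>c. c \<in> set_pmf (k (S \<omega>)) \<Longrightarrow> pmf (ch c) b = 0"
      unfolding q_def by (auto simp: pmf_eq_0_set_pmf)
    have "F (S \<omega>) (C i \<omega>) b = 0" if "i \<in> I" for i
      using z C_supp[OF that \<open>\<omega> \<in> set_pmf M\<close>] by (auto simp: F_def)
    moreover have "\<mu> (S \<omega>) b = 0"
      unfolding \<mu>_def using z by (subst pexp_cong[of _ _ "\<lambda>_. 0"]) (auto simp: F_def)
    ultimately show ?thesis using True by (simp add: X_def)
  next
    case False
    then have q0: "pmf (q (S \<omega>)) b > 0" by (simp add: less_le)
    have "0 \<le> (\<alpha> * pmf (q (S \<omega>)) b - \<bar>X \<omega> b\<bar>)\<^sup>2" by simp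
    also have "\<dots> = (\<alpha> * pmf (q (S \<omega>)) b)\<^sup>2 + (X \<omega> b)\<^sup>2 - 2 * (\<alpha> * pmf (q (S \<omega>)) b) * \<bar>X \<omega> b\<bar>"
      by (simp add: power2_diff)
    finally show ?thesis using q0 \<alpha>(1) by (simp add: field_simps power2_eq_square)
  qed

  have var: "pexp M (\<lambda>\<omega>. (X \<omega> b)\<^sup>2 / pmf (q (S \<omega>)) b)
     \<le> (\<tau> / N) * pexp pS (\<lambda>s. pexp (k s) (\<lambda>c. F s c b))" for b
  proof -
    let ?D = "\<lambda>s c. F s c b - \<mu> s b"
    \<comment> \<open>Given \<open>S\<close>, distinct codewords are independent and
      \<open>?D\<close> has conditional mean 0.\<close>
    have off: "pexp M (\<lambda>\<omega>. ?D (S \<omega>) (C i \<omega>) * ?D (S \<omega>) (C j \<omega>) / pmf (q (S \<omega>)) b) = 0"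
      if "i \<in> I" "j \<in> I" "i \<noteq> j" for i j
    proof -
      have "pexp (k s) (\<lambda>c. pexp (k s) (\<lambda>c'. ?D s c * ?D s c' / pmf (q s) b)) = 0" for s
      proof -
        have "pexp (k s) (?D s) = 0" by (simp add: pexp_diff[OF fink] \<mu>_def)
        then show ?thesis by simp
      qed
      then show ?thesis unfolding E2[OF that, of "\<lambda>s c c'. ?D s c * ?D s c' / pmf (q s) b"]
        by (simp only: pexp_const)
    qed
    \<comment> \<open>Truncation gives \<open>F \<le> \<tau> * q\<close>, hence
      \<open>F\<^sup>2 / q \<le> \<tau> * F\<close>. Dividing by \<open>q\<close> before summing
      keeps the sum over all outputs bounded.\<close>
    have diag: "pexp M (\<lambda>\<omega>. ?D (S \<omega>) (C i \<omega>) * ?D (S \<omega>) (C i \<omega>) / pmf (q (S \<omega>)) b)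
       \<le> \<tau> * pexp pS (\<lambda>s. pexp (k s) (\<lambda>c. F s c b))" if "i \<in> I" for i
    proof -
      have "pexp (k s) (\<lambda>c. ?D s c * ?D s c / pmf (q s) b) \<le> \<tau> * pexp (k s) (\<lambda>c. F s c b)" for s
      proof -
        have "pexp (k s) (\<lambda>c. ?D s c * ?D s c) = pexp (k s) (\<lambda>c. (F s c b)\<^sup>2 - 2 * \<mu> s b * F s c b + (\<mu> s b)\<^sup>2)"
          by (simp add: power2_eq_square algebra_simps)
        also have "\<dots> = pexp (k s) (\<lambda>c. (F s c b)\<^sup>2) - (\<mu> s b)\<^sup>2"
          by (simp add: pexp_add[OF fink] pexp_diff[OF fink] \<mu>_def power2_eq_square)
        also have "\<dots> \<le> pexp (k s) (\<lambda>c. (F s c b)\<^sup>2)" by simp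
        finally have "pexp (k s) (\<lambda>c. ?D s c * ?D s c / pmf (q s) b) \<le> pexp (k s) (\<lambda>c. (F s c b)\<^sup>2 / pmf (q s) b)"
          by (simp add: divide_right_mono)
        also have "\<dots> \<le> pexp (k s) (\<lambda>c. \<tau> * F s c b)"
        proof (intro pexp_mono fink)
          fix c
          have "(F s c b)\<^sup>2 / pmf (q s) b \<le> \<tau> * pmf (q s) b * F s c b / pmf (q s) b"
            unfolding power2_eq_square
            by (intro divide_right_mono mult_right_mono F0) (use \<tau> in \<open>auto simp: F_def\<close>)
          also have "\<dots> \<le> \<tau> * F s c b" using F0[of s c b] \<tau> by auto
          finally show "(F s c b)\<^sup>2 / pmf (q s) b \<le> \<tau> * F s c b" .
        qed
        finally show ?thesis by simp
      qed
      then have "pexp pS (\<lambda>s. pexp (k s) (\<lambda>c. ?D s c * ?D s c / pmf (q s) b))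
        \<le> pexp pS (\<lambda>s. \<tau> * pexp (k s) (\<lambda>c. F s c b))" by (intro pexp_mono finS)
      then show ?thesis using E1[OF that, of "\<lambda>s c. ?D s c * ?D s c / pmf (q s) b"] by simp
    qed
    have "pexp M (\<lambda>\<omega>. (X \<omega> b)\<^sup>2 / pmf (q (S \<omega>)) b)
      = pexp M (\<lambda>\<omega>. (\<Sum>i\<in>I. \<Sum>j\<in>I. ?D (S \<omega>) (C i \<omega>) * ?D (S \<omega>) (C j \<omega>) / pmf (q (S \<omega>)) b)) / N\<^sup>2"
    proof -
      have "(X \<omega> b)\<^sup>2 / pmf (q (S \<omega>)) b
        = (\<Sum>i\<in>I. \<Sum>j\<in>I. ?D (S \<omega>) (C i \<omega>) * ?D (S \<omega>) (C j \<omega>) / pmf (q (S \<omega>)) b) / N\<^sup>2" for \<omega>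
        by (simp add: X_alt power_divide power2_eq_square sum_product sum_divide_distrib mult.commute)
      then show ?thesis by (simp only: integral_divide_zero)
    qed
    also have "\<dots> = (\<Sum>i\<in>I. \<Sum>j\<in>I. pexp M (\<lambda>\<omega>. ?D (S \<omega>) (C i \<omega>) * ?D (S \<omega>) (C j \<omega>) / pmf (q (S \<omega>)) b)) / N\<^sup>2"
      by (simp add: pexp_sum[OF finM])
    also have "\<dots> = (\<Sum>i\<in>I. \<Sum>j\<in>I. if j = i then pexp M (\<lambda>\<omega>. ?D (S \<omega>) (C i \<omega>) * ?D (S \<omega>) (C i \<omega>) / pmf (q (S \<omega>)) b) else 0) / N\<^sup>2"
      by (intro arg_cong[where f = "\<lambda>x. x / N\<^sup>2"] sum.cong refl) (auto simp only: if_True if_False not_sym split: if_split intro: off)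
    also have "\<dots> = (\<Sum>i\<in>I. pexp M (\<lambda>\<omega>. ?D (S \<omega>) (C i \<omega>) * ?D (S \<omega>) (C i \<omega>) / pmf (q (S \<omega>)) b)) / N\<^sup>2"
      using I by simp
    also have "\<dots> \<le> (\<Sum>i\<in>I. \<tau> * pexp pS (\<lambda>s. pexp (k s) (\<lambda>c. F s c b))) / N\<^sup>2"
      by (intro divide_right_mono sum_mono diag) auto
    also have "\<dots> = (\<tau> / N) * pexp pS (\<lambda>s. pexp (k s) (\<lambda>c. F s c b))"
      using N by (simp add: N_def power2_eq_square)
    finally show ?thesis .
  qed

  have F_sum: "(\<Sum>b\<in>B. pexp pS (\<lambda>s. pexp (k s) (\<lambda>c. F s c b))) \<le> 1"
  proof -
    have "(\<Sum>b\<in>B. pexp pS (\<lambda>s. pexp (k s) (\<lambda>c. F s c b))) = pexp pS (\<lambda>s. pexp (k s) (\<lambda>c. \<Sum>b\<in>B. F s c b))"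
      by (simp add: pexp_sum[OF finS] pexp_sum[OF fink])
    also have "\<dots> \<le> 1"
    proof (intro pexp_le_const finS fink)
      fix s c
      have "(\<Sum>b\<in>B. F s c b) \<le> (\<Sum>b\<in>B. pmf (ch c) b)" by (intro sum_mono) (auto simp: F_def)
      also have "\<dots> = 1" using B by (rule sum_pmf_eq_1)
      finally show "(\<Sum>b\<in>B. F s c b) \<le> 1" .
    qed
    finally show ?thesis .
  qed

  have X_sum: "pexp M (\<lambda>\<omega>. \<Sum>b\<in>B. \<bar>X \<omega> b\<bar>) \<le> \<alpha>"
  proof -
    have "pexp M (\<lambda>\<omega>. \<Sum>b\<in>B. \<bar>X \<omega> b\<bar>)
      \<le> pexp M (\<lambda>\<omega>. \<Sum>b\<in>B. \<alpha> * pmf (q (S \<omega>)) b / 2 + (X \<omega> b)\<^sup>2 / pmf (q (S \<omega>)) b / (2 * \<alpha>))"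
      by (intro pexp_mono finM sum_mono X_bound)
    also have "\<dots> = pexp M (\<lambda>\<omega>. \<alpha> / 2 * (\<Sum>b\<in>B. pmf (q (S \<omega>)) b))
        + (\<Sum>b\<in>B. pexp M (\<lambda>\<omega>. (X \<omega> b)\<^sup>2 / pmf (q (S \<omega>)) b)) / (2 * \<alpha>)"
      by (simp add: sum.distrib pexp_add[OF finM] pexp_sum[OF finM] sum_distrib_left sum_divide_distrib
          del: divide_divide_eq_left)
    also have "pexp M (\<lambda>\<omega>. \<alpha> / 2 * (\<Sum>b\<in>B. pmf (q (S \<omega>)) b)) = \<alpha> / 2"
    proof -
      have "(\<Sum>b\<in>B. pmf (q s) b) = 1" for s
        using B by (intro sum_pmf_eq_1) (auto simp: q_def)
      then show ?thesis by simp
    qed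
    also have "(\<Sum>b\<in>B. pexp M (\<lambda>\<omega>. (X \<omega> b)\<^sup>2 / pmf (q (S \<omega>)) b)) / (2 * \<alpha>)
       \<le> (\<Sum>b\<in>B. (\<tau> / N) * pexp pS (\<lambda>s. pexp (k s) (\<lambda>c. F s c b))) / (2 * \<alpha>)"
      using \<alpha> by (intro divide_right_mono sum_mono var) auto
    also have "\<dots> \<le> (\<tau> / N) * 1 / (2 * \<alpha>)"
      unfolding sum_distrib_left[symmetric] using \<alpha> \<tau> N
      by (intro divide_right_mono mult_left_mono F_sum) auto
    also have "\<alpha> / 2 + (\<tau> / N) * 1 / (2 * \<alpha>) = \<alpha>"
      using \<alpha>(1) unfolding \<alpha>(2)[symmetric] by (simp add: power2_eq_square)
    finally show ?thesis by simp
  qed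

  \<comment> \<open>The mass cut off enters twice, in the empirical average and in the target. Both
    have expectation \<open>P\<close>, whence the factor 2.\<close>
  have "pexp M (\<lambda>\<omega>. \<Sum>b\<in>B. \<bar>(\<Sum>i\<in>I. pmf (ch (C i \<omega>)) b) / N - pmf (q (S \<omega>)) b\<bar>)
    \<le> pexp M (\<lambda>\<omega>. (\<Sum>b\<in>B. \<bar>X \<omega> b\<bar>) + (\<Sum>i\<in>I. \<Sum>b\<in>B. G (S \<omega>) (C i \<omega>) b) / N + pexp (k (S \<omega>)) (\<lambda>c. \<Sum>b\<in>B. G (S \<omega>) c b))"
  proof (intro pexp_mono finM)
    fix \<omega>
    have "\<bar>(\<Sum>i\<in>I. pmf (ch (C i \<omega>)) b) / N - pmf (q (S \<omega>)) b\<bar>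
      \<le> \<bar>X \<omega> b\<bar> + (\<Sum>i\<in>I. G (S \<omega>) (C i \<omega>) b) / N + pexp (k (S \<omega>)) (\<lambda>c. G (S \<omega>) c b)" for b
    proof -
      have "(\<Sum>i\<in>I. pmf (ch (C i \<omega>)) b) / N - pmf (q (S \<omega>)) b
        = X \<omega> b + (\<Sum>i\<in>I. G (S \<omega>) (C i \<omega>) b) / N - pexp (k (S \<omega>)) (\<lambda>c. G (S \<omega>) c b)"
        unfolding q\<mu> X_def by (simp add: FG[of _ _ "S \<omega>"] sum.distrib add_divide_distrib)
      moreover have "0 \<le> (\<Sum>i\<in>I. G (S \<omega>) (C i \<omega>) b) / N" "0 \<le> pexp (k (S \<omega>)) (\<lambda>c. G (S \<omega>) c b)"
        using N G0 by (auto intro!: divide_nonneg_nonneg sum_nonneg pexp_nonneg)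
      ultimately show ?thesis by linarith
    qed
    then have "(\<Sum>b\<in>B. \<bar>(\<Sum>i\<in>I. pmf (ch (C i \<omega>)) b) / N - pmf (q (S \<omega>)) b\<bar>)
      \<le> (\<Sum>b\<in>B. \<bar>X \<omega> b\<bar> + (\<Sum>i\<in>I. G (S \<omega>) (C i \<omega>) b) / N + pexp (k (S \<omega>)) (\<lambda>c. G (S \<omega>) c b))"
      by (intro sum_mono)
    also have "\<dots> = (\<Sum>b\<in>B. \<bar>X \<omega> b\<bar>) + (\<Sum>i\<in>I. \<Sum>b\<in>B. G (S \<omega>) (C i \<omega>) b) / N + pexp (k (S \<omega>)) (\<lambda>c. \<Sum>b\<in>B. G (S \<omega>) c b)"
      by (simp add: sum.distrib pexp_sum[OF fink] sum_divide_distrib[symmetric] sum.swap[of _ I])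
    finally show "(\<Sum>b\<in>B. \<bar>(\<Sum>i\<in>I. pmf (ch (C i \<omega>)) b) / N - pmf (q (S \<omega>)) b\<bar>) \<le> \<dots>" .
  qed
  also have "\<dots> = pexp M (\<lambda>\<omega>. \<Sum>b\<in>B. \<bar>X \<omega> b\<bar>) + (\<Sum>i\<in>I. pexp M (\<lambda>\<omega>. \<Sum>b\<in>B. G (S \<omega>) (C i \<omega>) b)) / N
      + pexp M (\<lambda>\<omega>. pexp (k (S \<omega>)) (\<lambda>c. \<Sum>b\<in>B. G (S \<omega>) c b))"
    by (simp add: pexp_add[OF finM] pexp_sum[OF finM])
  also have "(\<Sum>i\<in>I. pexp M (\<lambda>\<omega>. \<Sum>b\<in>B. G (S \<omega>) (C i \<omega>) b)) / N = P"
    using N E1[of _ "\<lambda>s c. \<Sum>b\<in>B. G s c b"] by (simp add: G_sum P_def N_def)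
  also have "pexp M (\<lambda>\<omega>. pexp (k (S \<omega>)) (\<lambda>c. \<Sum>b\<in>B. G (S \<omega>) c b)) = P"
    using E0[of "\<lambda>s. pexp (k s) (\<lambda>c. \<Sum>b\<in>B. G s c b)"] by (simp add: G_sum P_def)
  finally show ?thesis using X_sum by (simp add: P_def N_def \<alpha>_def)
qed

subsection \<open>Likelihood ratios\<close>

text \<open>\<open>ratio_law pS k ch\<close> is the distribution of \<open>P(o|c) / P(o|s)\<close> when \<open>s\<close> has law \<open>pS\<close>, \<open>c\<close> is drawn
  from \<open>k s\<close>, and \<open>o\<close> is the output of the channel \<open>ch\<close> on input \<open>c\<close>; hence \<open>ratio_info pS k ch\<close> is
  \<open>I(O;C|S)\<close>.\<close>

definition ratio_law :: "'s pmf \<Rightarrow> ('s \<Rightarrow> 'c pmf) \<Rightarrow> ('c \<Rightarrow> 'o pmf) \<Rightarrow> real pmf" where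
  "ratio_law pS k ch = do {s \<leftarrow> pS; c \<leftarrow> k s; x \<leftarrow> ch c;
     return_pmf (pmf (ch c) x / pmf (bind_pmf (k s) ch) x)}"

definition ratio_info :: "'s pmf \<Rightarrow> ('s \<Rightarrow> 'c pmf) \<Rightarrow> ('c \<Rightarrow> 'o pmf) \<Rightarrow> real" where
  "ratio_info pS k ch = pexp (ratio_law pS k ch) (log 2)"

lemma finite_ratio_law [simp]:
  fixes pS :: "'s::finite pmf" and k :: "'s \<Rightarrow> 'c::finite pmf" and ch :: "'c \<Rightarrow> 'o::finite pmf"
  shows "finite (set_pmf (ratio_law pS k ch))"
  unfolding ratio_law_def by simp

lemma pexp_ratio_law:
  fixes pS :: "'s::finite pmf" and k :: "'s \<Rightarrow> 'c::finite pmf" and ch :: "'c \<Rightarrow> 'o::finite pmf"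
  shows "pexp (ratio_law pS k ch) g =
    pexp pS (\<lambda>s. pexp (k s) (\<lambda>c. pexp (ch c) (\<lambda>x. g (pmf (ch c) x / pmf (bind_pmf (k s) ch) x))))"
  unfolding ratio_law_def by (simp add: pexp_bind)

lemma ratio_law_pos:
  assumes "r \<in> set_pmf (ratio_law pS k ch)" shows "r > 0"
  using assms unfolding ratio_law_def
  by (auto intro!: divide_pos_pos pmf_positive)

text \<open>A summand \<open>p * (q / p)\<close> is \<open>q\<close> where \<open>p\<close> is
  positive and 0 elsewhere, so only the mass of \<open>q\<close> on the support of
  \<open>ch c\<close> is counted.\<close>

lemma pexp_inverse_ratio_le_1:
  fixes pS :: "'s::finite pmf" and k :: "'s \<Rightarrow> 'c::finite pmf" and ch :: "'c \<Rightarrow> 'o::finite pmf"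
  shows "pexp (ratio_law pS k ch) (\<lambda>r. 1 / r) \<le> 1"
proof -
  have *: "pexp (ch c) (\<lambda>x. 1 / (pmf (ch c) x / pmf (bind_pmf (k s) ch) x)) \<le> 1" for s c
  proof -
    let ?q = "bind_pmf (k s) ch"
    have "pexp (ch c) (\<lambda>x. 1 / (pmf (ch c) x / pmf ?q x)) = (\<Sum>x\<in>UNIV. pmf (ch c) x * (1 / (pmf (ch c) x / pmf ?q x)))"
      by (intro pexp_eq_sum) auto
    also have "\<dots> \<le> (\<Sum>x\<in>UNIV. pmf ?q x)"
      by (intro sum_mono) auto
    also have "\<dots> = 1" by (intro sum_pmf_eq_1) auto
    finally show ?thesis .
  qed
  show ?thesis unfolding pexp_ratio_law
    by (rule pexp_le_const[OF finite], rule pexp_le_const[OF finite], rule *)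
qed

text \<open>Gibbs' inequality through \<open>ln r \<ge> 1 - 1 / r\<close>, which is strict unless
  \<open>r = 1\<close>. If the information is 0, all ratios are 1, so each channel law lies
  pointwise below the mixture; two distributions so ordered coincide.\<close>

lemma
  fixes pS :: "'s::finite pmf" and k :: "'s \<Rightarrow> 'c::finite pmf" and ch :: "'c \<Rightarrow> 'o::finite pmf"
  shows ratio_info_nonneg: "0 \<le> ratio_info pS k ch"
    and ratio_info_zeroD: "ratio_info pS k ch = 0 \<Longrightarrow> s \<in> set_pmf pS \<Longrightarrow> c \<in> set_pmf (k s) \<Longrightarrow>
      ch c = bind_pmf (k s) ch"
proof -
  let ?R = "ratio_law pS k ch"
  let ?h = "\<lambda>r::real. 1 / r - 1 + ln r"
  have h0: "0 \<le> ?h r" if "r \<in> set_pmf ?R" for r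
    using ln_le_minus_one[of "1 / r"] ratio_law_pos[OF that] by (simp add: ln_div)
  have info: "pexp ?R ln = ratio_info pS k ch * ln 2"
    unfolding ratio_info_def log_def[abs_def] by simp
  have "pexp ?R ?h = pexp ?R (\<lambda>r. 1 / r) - 1 + ratio_info pS k ch * ln 2"
    by (simp add: pexp_add pexp_diff info)
  with pexp_inverse_ratio_le_1[of pS k ch]
  have le: "pexp ?R ?h \<le> ratio_info pS k ch * ln 2" by simp
  have "0 \<le> pexp ?R ?h" by (intro pexp_nonneg h0)
  with le have "0 \<le> ratio_info pS k ch * ln 2" by linarith
  then show "0 \<le> ratio_info pS k ch" by (simp add: zero_le_mult_iff)
  assume 0: "ratio_info pS k ch = 0" and s: "s \<in> set_pmf pS" and c: "c \<in> set_pmf (k s)"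
  have one: "r = 1" if "r \<in> set_pmf ?R" for r
  proof -
    have "?h r = 0"
    proof (rule pexp_pos_imp[where f = ?h, OF that])
      show "pexp ?R ?h = 0" using le 0 \<open>0 \<le> pexp ?R ?h\<close> by simp
    qed (use h0 in simp_all)
    then have "ln (1 / r) = 1 / r - 1" using ratio_law_pos[OF that] by (simp add: ln_div)
    then show ?thesis using ratio_law_pos[OF that] ln_eq_minus_one[of "1 / r"] by simp
  qed
  have le_q: "pmf (ch c) x \<le> pmf (bind_pmf (k s) ch) x" for x
  proof (cases "x \<in> set_pmf (ch c)")
    case True
    then have "pmf (ch c) x / pmf (bind_pmf (k s) ch) x \<in> set_pmf ?R"
      unfolding ratio_law_def using s c by force
    from one[OF this] show ?thesis by (auto simp: divide_eq_1_iff)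
  next
    case False
    then show ?thesis by (simp add: pmf_eq_0_set_pmf[THEN iffD2])
  qed
  show "ch c = bind_pmf (k s) ch"
    using pmf_neq_exists_less[of "bind_pmf (k s) ch" "ch c"] le_q by (metis not_less)
qed

text \<open>The normalized exponential moment \<open>g\<close> is 1 at 0 and has there the negative
  derivative \<open>ln 2 * (pexp p f - c)\<close>, so it drops below 1 at some small positive
  \<open>l\<close>.\<close>

lemma chernoff_exponent:
  fixes f :: "'a \<Rightarrow> real"
  assumes fin: "finite (set_pmf p)" and less: "pexp p f < c"
  shows "\<exists>l>0. pexp p (\<lambda>x. 2 powr (l * f x)) < 2 powr (l * c)"
proof -
  define g where "g l = (\<Sum>x\<in>set_pmf p. pmf p x * exp (l * (ln 2 * (f x - c))))" for l :: real
  have g: "g l = pexp p (\<lambda>x. exp (l * (ln 2 * (f x - c))))" for l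
    unfolding g_def using fin by (subst pexp_eq_sum[OF _ order.refl]) auto
  have "(g has_real_derivative (\<Sum>x\<in>set_pmf p. pmf p x * (ln 2 * (f x - c)))) (at 0)"
    unfolding g_def by (auto intro!: derivative_eq_intros sum.cong)
  moreover have "(\<Sum>x\<in>set_pmf p. pmf p x * (ln 2 * (f x - c))) = ln 2 * (pexp p f - c)"
    unfolding pexp_eq_sum[OF fin order.refl, of "\<lambda>x. ln 2 * (f x - c)", symmetric]
    using fin by (simp add: pexp_diff)
  moreover have "ln 2 * (pexp p f - c) < 0" using less by (simp add: mult_less_0_iff)
  ultimately obtain d where d: "d > 0" "\<And>h. 0 < h \<Longrightarrow> h < d \<Longrightarrow> g (0 + h) < g 0"
    using DERIV_neg_dec_right[of g _ 0] by metis
  define l where "l = d / 2"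
  have l: "l > 0" "g l < g 0" using d d(2)[of l] by (auto simp: l_def)
  have "g 0 = 1" by (simp add: g)
  have "pexp p (\<lambda>x. 2 powr (l * f x)) = pexp p (\<lambda>x. 2 powr (l * c) * exp (l * (ln 2 * (f x - c))))"
    by (simp add: powr_def exp_add[symmetric] algebra_simps)
  also have "\<dots> = 2 powr (l * c) * g l" by (simp add: g)
  also have "\<dots> < 2 powr (l * c)" using l \<open>g 0 = 1\<close> by simp
  finally show ?thesis using l(1) by blast
qed

lemma ratio_law_exponent:
  fixes pS :: "'s::finite pmf" and k :: "'s \<Rightarrow> 'c::finite pmf" and ch :: "'c \<Rightarrow> 'o::finite pmf"
  assumes "ratio_info pS k ch < c"
  shows "\<exists>l>0. pexp (ratio_law pS k ch) (\<lambda>r. r powr l) < 2 powr (l * c)"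
proof -
  obtain l where l: "l > 0" "pexp (ratio_law pS k ch) (\<lambda>r. 2 powr (l * log 2 r)) < 2 powr (l * c)"
    using chernoff_exponent[of "ratio_law pS k ch" "log 2" c] assms by (auto simp: ratio_info_def)
  have "pexp (ratio_law pS k ch) (\<lambda>r. 2 powr (l * log 2 r)) = pexp (ratio_law pS k ch) (\<lambda>r. r powr l)"
    by (intro pexp_cong) (auto dest: ratio_law_pos simp: powr_def log_def)
  then show ?thesis using l by auto
qed

lemma ratio_moment_pos:
  fixes pS :: "'s::finite pmf" and k :: "'s \<Rightarrow> 'c::finite pmf" and ch :: "'c \<Rightarrow> 'o::finite pmf"
  shows "0 < pexp (ratio_law pS k ch) (\<lambda>r. r powr l)"
proof -
  obtain r where r: "r \<in> set_pmf (ratio_law pS k ch)" using set_pmf_not_empty by fast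
  have "0 \<le> pexp (ratio_law pS k ch) (\<lambda>r. r powr l)" by (intro pexp_nonneg) auto
  moreover have "pexp (ratio_law pS k ch) (\<lambda>r. r powr l) \<noteq> 0"
    using pexp_pos_imp[OF r, of "\<lambda>r. r powr l"] ratio_law_pos[OF r] by auto
  ultimately show ?thesis by linarith
qed

subsection \<open>Products\<close>

lemma finite_set_Pi_pmf:
  assumes "finite A" "\<And>x. x \<in> A \<Longrightarrow> finite (set_pmf (p x))"
  shows "finite (set_pmf (Pi_pmf A d p))"
  using assms by (simp add: set_Pi_pmf finite_PiE_dflt)

lemma set_Pi_pmf_subset_UNIV: "finite A \<Longrightarrow> set_pmf (Pi_pmf A d p) \<subseteq> PiE_dflt A d (\<lambda>_. UNIV)"
  by (auto simp: set_Pi_pmf PiE_dflt_def)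

lemma Pi_pmf_default: "finite A \<Longrightarrow> f \<in> set_pmf (Pi_pmf A d p) \<Longrightarrow> t \<notin> A \<Longrightarrow> f t = d"
  using set_Pi_pmf_subset[of A d p] by blast

text \<open>Drawing pairs letter by letter is drawing one word and then a second one given the
  first. Words are functions with a default outside \<open>A\<close>, and the defaults have to match
  for the functions to be equal.\<close>

lemma Pi_pmf_pair_kernel:
  fixes p :: "'t \<Rightarrow> 'a pmf"
  assumes "finite A"
  shows "map_pmf (\<lambda>h. (\<lambda>t. fst (h t), \<lambda>t. snd (h t))) (Pi_pmf A (da, db) (\<lambda>t. do {a \<leftarrow> p t; b \<leftarrow> q t a; return_pmf (a, b)}))
    = do {f \<leftarrow> Pi_pmf A da p; g \<leftarrow> Pi_pmf A db (\<lambda>t. q t (f t)); return_pmf (f, g)}"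
proof -
  have *: "Pi_pmf A (da, db) (\<lambda>t. do {a \<leftarrow> p t; b \<leftarrow> q t a; return_pmf (a, b)})
    = do {f \<leftarrow> Pi_pmf A da p; g \<leftarrow> Pi_pmf A db (\<lambda>t. q t (f t));
          return_pmf (\<lambda>t. if t \<in> A then (f t, g t) else (da, db))}"
    using assms by (subst Pi_pmf_bind[where d' = da], simp) (subst Pi_pmf_bind[where d' = db], simp_all)
  show ?thesis unfolding * map_bind_pmf map_return_pmf
  proof (intro bind_pmf_cong refl arg_cong[where f = return_pmf])
    fix f g assume f: "f \<in> set_pmf (Pi_pmf A da p)" and g: "g \<in> set_pmf (Pi_pmf A db (\<lambda>t. q t (f t)))"
    show "(\<lambda>t. fst (if t \<in> A then (f t, g t) else (da, db)), \<lambda>t. snd (if t \<in> A then (f t, g t) else (da, db))) = (f, g)"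
      using Pi_pmf_default[OF assms f] Pi_pmf_default[OF assms g] by (auto simp: fun_eq_iff)
  qed
qed

text \<open>A cloud centre \<open>S\<close> with satellite codewords \<open>C i\<close>: each has
  conditional law \<open>k\<close> given the centre, and any two are conditionally independent.
  Pairwise laws are what a second moment argument calls for.\<close>

definition cond_codewords ::
  "'l pmf \<Rightarrow> ('l \<Rightarrow> 's) \<Rightarrow> ('i \<Rightarrow> 'l \<Rightarrow> 'c) \<Rightarrow> 'i set \<Rightarrow> 's pmf \<Rightarrow> ('s \<Rightarrow> 'c pmf) \<Rightarrow> bool" where
  "cond_codewords Q S C I pS k \<longleftrightarrow> finite (set_pmf Q) \<and> finite I \<and> I \<noteq> {} \<and>
     (\<forall>i\<in>I. map_pmf (\<lambda>l. (S l, C i l)) Q = do {s \<leftarrow> pS; c \<leftarrow> k s; return_pmf (s, c)}) \<and>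
     (\<forall>i\<in>I. \<forall>j\<in>I. i \<noteq> j \<longrightarrow> map_pmf (\<lambda>l. (S l, C i l, C j l)) Q =
        do {s \<leftarrow> pS; c \<leftarrow> k s; c' \<leftarrow> k s; return_pmf (s, c, c')})"

text \<open>The L1 distance, on words of length \<open>n\<close>, between the output law of a
  uniformly chosen codeword and the memoryless target \<open>q\<close>. The words equal
  \<open>d\<close> outside \<open>{..<n}\<close>, which makes the range of summation finite.\<close>

definition cover_err :: "nat \<Rightarrow> 'o \<Rightarrow> 'i set \<Rightarrow> ('i \<Rightarrow> nat \<Rightarrow> 'o pmf) \<Rightarrow> (nat \<Rightarrow> 'o pmf) \<Rightarrow> real" where
  "cover_err n d I p q = (\<Sum>x\<in>PiE_dflt {..<n} d (\<lambda>_. UNIV).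
     \<bar>(\<Sum>i\<in>I. pmf (Pi_pmf {..<n} d (p i)) x) / card I - pmf (Pi_pmf {..<n} d q) x\<bar>)"

text \<open>The letters of the codebook are drawn independently, \<open>\<omega> t\<close> holding
  letter \<open>t\<close> of all codewords, so the single-letter laws lift to words. The tail is
  bounded by Markov's inequality for the power \<open>l\<close> of the likelihood ratio. The channel
  depends on \<open>t\<close> so that one time can be treated differently.\<close>

lemma soft_covering_words:
  fixes pS :: "'s::finite pmf" and k :: "'s \<Rightarrow> 'c::finite pmf" and ch :: "nat \<Rightarrow> 'c \<Rightarrow> 'o::finite pmf"
  assumes cw: "cond_codewords Q S C I pS k" and dC: "\<And>i. i \<in> I \<Longrightarrow> C i dL = dC"
    and \<tau>: "\<tau> > 0" and l: "l > 0"
  shows "pexp (Pi_pmf {..<n} dL (\<lambda>_. Q)) (\<lambda>\<omega>. cover_err n dO I (\<lambda>i t. ch t (C i (\<omega> t))) (\<lambda>t. bind_pmf (k (S (\<omega> t))) (ch t)))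
    \<le> 2 * ((\<Prod>t<n. pexp (ratio_law pS k (ch t)) (\<lambda>r. r powr l)) / \<tau> powr l) + sqrt (\<tau> / card I)"
proof -
  note cw = cw[unfolded cond_codewords_def]
  define T where "T = {..<n}"
  have finT [simp]: "finite T" by (simp add: T_def)
  define M where "M = Pi_pmf T dL (\<lambda>_. Q)"
  define pSn where "pSn = Pi_pmf T (S dL) (\<lambda>_. pS)"
  define kn where "kn f = Pi_pmf T dC (\<lambda>t. k (f t))" for f
  define chn where "chn f = Pi_pmf T dO (\<lambda>t. ch t (f t))" for f
  define B :: "(nat \<Rightarrow> 'o) set" where "B = PiE_dflt T dO (\<lambda>_. UNIV)"
  have qn: "bind_pmf (kn f) chn = Pi_pmf T dO (\<lambda>t. bind_pmf (k (f t)) (ch t))" for f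
    unfolding kn_def chn_def[abs_def] by (rule Pi_pmf_bind[symmetric]) simp
  have I: "finite I" "I \<noteq> {}" and finQ: "finite (set_pmf Q)" using cw by blast+
  have finM: "finite (set_pmf M)" unfolding M_def by (intro finite_set_Pi_pmf finT finQ)
  have fin: "finite (set_pmf pSn)" "finite (set_pmf (kn f))" "finite (set_pmf (chn g))" "finite B" for f g
    unfolding pSn_def kn_def chn_def B_def by (auto intro!: finite_set_Pi_pmf)
  have chB: "set_pmf (chn f) \<subseteq> B" for f
    unfolding chn_def B_def by (rule set_Pi_pmf_subset_UNIV) simp
  have law1: "map_pmf (\<lambda>\<omega>. (\<lambda>t. S (\<omega> t), \<lambda>t. C i (\<omega> t))) M = do {f \<leftarrow> pSn; g \<leftarrow> kn f; return_pmf (f, g)}"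
    if "i \<in> I" for i
  proof -
    have Q: "map_pmf (\<lambda>l. (S l, C i l)) Q = do {a \<leftarrow> pS; b \<leftarrow> k a; return_pmf (a, b)}"
      using cw that by blast
    have "map_pmf (\<lambda>\<omega>. (\<lambda>t. S (\<omega> t), \<lambda>t. C i (\<omega> t))) M =
      map_pmf (\<lambda>h. (\<lambda>t. fst (h t), \<lambda>t. snd (h t))) (map_pmf (\<lambda>\<omega>. (\<lambda>l. (S l, C i l)) \<circ> \<omega>) M)"
      by (simp add: pmf.map_comp o_def)
    also have "map_pmf (\<lambda>\<omega>. (\<lambda>l. (S l, C i l)) \<circ> \<omega>) M
      = Pi_pmf T (S dL, dC) (\<lambda>t. do {a \<leftarrow> pS; b \<leftarrow> k a; return_pmf (a, b)})"
      unfolding M_def Q[symmetric] by (rule Pi_pmf_map[symmetric]) (simp_all add: dC[OF that])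
    also have "map_pmf (\<lambda>h. (\<lambda>t. fst (h t), \<lambda>t. snd (h t))) \<dots> = do {f \<leftarrow> pSn; g \<leftarrow> kn f; return_pmf (f, g)}"
      unfolding pSn_def kn_def by (rule Pi_pmf_pair_kernel) simp
    finally show ?thesis .
  qed
  have law2: "map_pmf (\<lambda>\<omega>. (\<lambda>t. S (\<omega> t), \<lambda>t. C i (\<omega> t), \<lambda>t. C j (\<omega> t))) M
      = do {f \<leftarrow> pSn; g \<leftarrow> kn f; g' \<leftarrow> kn f; return_pmf (f, g, g')}"
    if "i \<in> I" "j \<in> I" "i \<noteq> j" for i j
  proof -
    have *: "do {s \<leftarrow> pS; c \<leftarrow> k s; c' \<leftarrow> k s; return_pmf (s, c, c')}
       = do {a \<leftarrow> pS; b \<leftarrow> do {c \<leftarrow> k a; c' \<leftarrow> k a; return_pmf (c, c')}; return_pmf (a, b)}"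
      by (simp add: bind_assoc_pmf bind_return_pmf)
    have Q: "map_pmf (\<lambda>l. (S l, C i l, C j l)) Q = do {s \<leftarrow> pS; c \<leftarrow> k s; c' \<leftarrow> k s; return_pmf (s, c, c')}"
      using cw that by blast
    have "map_pmf (\<lambda>\<omega>. (\<lambda>t. S (\<omega> t), \<lambda>t. C i (\<omega> t), \<lambda>t. C j (\<omega> t))) M =
      map_pmf (\<lambda>(f, h). (f, \<lambda>t. fst (h t), \<lambda>t. snd (h t))) (map_pmf (\<lambda>h. (\<lambda>t. fst (h t), \<lambda>t. snd (h t)))
         (map_pmf (\<lambda>\<omega>. (\<lambda>l. (S l, C i l, C j l)) \<circ> \<omega>) M))"
      by (simp add: pmf.map_comp o_def)
    also have "map_pmf (\<lambda>\<omega>. (\<lambda>l. (S l, C i l, C j l)) \<circ> \<omega>) M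
      = Pi_pmf T (S dL, dC, dC) (\<lambda>t. do {a \<leftarrow> pS; b \<leftarrow> do {c \<leftarrow> k a; c' \<leftarrow> k a; return_pmf (c, c')}; return_pmf (a, b)})"
      unfolding M_def *[symmetric] Q[symmetric]
      by (rule Pi_pmf_map[symmetric]) (simp_all add: dC[OF that(1)] dC[OF that(2)])
    also have "map_pmf (\<lambda>h. (\<lambda>t. fst (h t), \<lambda>t. snd (h t))) \<dots> =
       do {f \<leftarrow> pSn; h \<leftarrow> Pi_pmf T (dC, dC) (\<lambda>t. do {c \<leftarrow> k (f t); c' \<leftarrow> k (f t); return_pmf (c, c')}); return_pmf (f, h)}"
      unfolding pSn_def by (rule Pi_pmf_pair_kernel) simp
    also have "map_pmf (\<lambda>(f, h). (f, \<lambda>t. fst (h t), \<lambda>t. snd (h t))) \<dots> =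
       do {f \<leftarrow> pSn; h \<leftarrow> map_pmf (\<lambda>h. (\<lambda>t. fst (h t), \<lambda>t. snd (h t)))
          (Pi_pmf T (dC, dC) (\<lambda>t. do {c \<leftarrow> k (f t); c' \<leftarrow> k (f t); return_pmf (c, c')})); return_pmf (f, h)}"
      by (simp add: map_bind_pmf bind_map_pmf)
    also have "\<dots> = do {f \<leftarrow> pSn; g \<leftarrow> kn f; g' \<leftarrow> kn f; return_pmf (f, g, g')}"
      by (subst Pi_pmf_pair_kernel, simp) (simp add: kn_def bind_assoc_pmf bind_return_pmf)
    finally show ?thesis .
  qed
  have tail: "pexp pSn (\<lambda>f. pexp (kn f) (\<lambda>g. pexp (chn g)
        (\<lambda>x. if pmf (chn g) x > \<tau> * pmf (bind_pmf (kn f) chn) x then 1 else 0)))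
     \<le> (\<Prod>t<n. pexp (ratio_law pS k (ch t)) (\<lambda>r. r powr l)) / \<tau> powr l"
  proof -
    \<comment> \<open>On the event, the ratio for the words divided by \<open>\<tau>\<close> exceeds
      1, so its power \<open>l\<close> dominates the indicator. That power is a product of the
      letterwise factors \<open>h\<close>.\<close>
    define h where "h t s c x = (pmf (ch t c) x / pmf (bind_pmf (k s) (ch t)) x) powr l" for t s c x
    have h0: "0 \<le> h t s c x" for t s c x by (simp add: h_def)
    have "pexp pSn (\<lambda>f. pexp (kn f) (\<lambda>g. pexp (chn g)
        (\<lambda>x. if pmf (chn g) x > \<tau> * pmf (bind_pmf (kn f) chn) x then 1 else 0)))
      \<le> pexp pSn (\<lambda>f. pexp (kn f) (\<lambda>g. pexp (chn g) (\<lambda>x. (\<Prod>t\<in>T. h t (f t) (g t) (x t)) / \<tau> powr l)))"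
    proof (intro pexp_mono fin)
      fix f g x assume g: "g \<in> set_pmf (kn f)" and x: "x \<in> set_pmf (chn g)"
      have out: "x t = dO" if "t \<notin> T" for t
        using x that unfolding chn_def by (intro Pi_pmf_default[OF finT])
      have pc: "pmf (chn g) x = (\<Prod>t\<in>T. pmf (ch t (g t)) (x t))"
        unfolding chn_def using out by (subst pmf_Pi') auto
      have pq: "pmf (bind_pmf (kn f) chn) x = (\<Prod>t\<in>T. pmf (bind_pmf (k (f t)) (ch t)) (x t))"
        unfolding qn using out by (subst pmf_Pi') auto
      have pos: "pmf (chn g) x > 0" "pmf (bind_pmf (kn f) chn) x > 0"
        using g x by (auto intro!: pmf_positive)
      have prod: "(\<Prod>t\<in>T. h t (f t) (g t) (x t)) = (pmf (chn g) x / pmf (bind_pmf (kn f) chn) x) powr l"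
        unfolding h_def pc pq prod_dividef[symmetric]
        by (rule prod_powr_distrib[symmetric])
      show "(if pmf (chn g) x > \<tau> * pmf (bind_pmf (kn f) chn) x then 1 else 0)
        \<le> (\<Prod>t\<in>T. h t (f t) (g t) (x t)) / \<tau> powr l"
      proof (cases "pmf (chn g) x > \<tau> * pmf (bind_pmf (kn f) chn) x")
        case True
        then have "\<tau> \<le> pmf (chn g) x / pmf (bind_pmf (kn f) chn) x" using pos by (simp add: field_simps)
        then have "\<tau> powr l \<le> (pmf (chn g) x / pmf (bind_pmf (kn f) chn) x) powr l"
          using \<tau> l by (intro powr_mono2) auto
        then show ?thesis using True \<tau> by (simp add: prod)
      next
        case False
        then show ?thesis by (simp add: prod)
      qed
    qed
    also have "\<dots> = pexp pSn (\<lambda>f. pexp (kn f) (\<lambda>g. pexp (chn g) (\<lambda>x. \<Prod>t\<in>T. h t (f t) (g t) (x t)))) / \<tau> powr l"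
      by simp
    \<comment> \<open>The product is integrated from the inside: outputs given codewords, then
      codewords given centres, then centres.\<close>
    also have "(\<lambda>f g. pexp (chn g) (\<lambda>x. \<Prod>t\<in>T. h t (f t) (g t) (x t)))
       = (\<lambda>f g. \<Prod>t\<in>T. pexp (ch t (g t)) (h t (f t) (g t)))"
      unfolding chn_def by (intro ext expectation_prod_Pi_pmf) (auto simp: h0 integrable_measure_pmf_finite)
    also have "(\<lambda>f. pexp (kn f) (\<lambda>g. \<Prod>t\<in>T. pexp (ch t (g t)) (h t (f t) (g t))))
       = (\<lambda>f. \<Prod>t\<in>T. pexp (k (f t)) (\<lambda>c. pexp (ch t c) (h t (f t) c)))"
      unfolding kn_def by (intro ext expectation_prod_Pi_pmf) (auto simp: h0 integrable_measure_pmf_finite intro!: pexp_nonneg)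
    also have "pexp pSn (\<lambda>f. \<Prod>t\<in>T. pexp (k (f t)) (\<lambda>c. pexp (ch t c) (h t (f t) c)))
       = (\<Prod>t\<in>T. pexp pS (\<lambda>s. pexp (k s) (\<lambda>c. pexp (ch t c) (h t s c))))"
      unfolding pSn_def by (intro expectation_prod_Pi_pmf) (auto simp: h0 integrable_measure_pmf_finite intro!: pexp_nonneg)
    also have "\<dots> = (\<Prod>t<n. pexp (ratio_law pS k (ch t)) (\<lambda>r. r powr l))"
      unfolding pexp_ratio_law h_def[abs_def] T_def ..
    finally show ?thesis .
  qed
  have "pexp M (\<lambda>\<omega>. \<Sum>x\<in>B. \<bar>(\<Sum>i\<in>I. pmf (chn (\<lambda>t. C i (\<omega> t))) x) / card I
        - pmf (bind_pmf (kn (\<lambda>t. S (\<omega> t))) chn) x\<bar>)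
    \<le> 2 * pexp pSn (\<lambda>f. pexp (kn f) (\<lambda>g. pexp (chn g)
        (\<lambda>x. if pmf (chn g) x > \<tau> * pmf (bind_pmf (kn f) chn) x then 1 else 0))) + sqrt (\<tau> / card I)"
    by (rule soft_covering[OF finM fin(1) fin(2) I fin(4) chB law1 law2 \<tau>])
  also have "\<dots> \<le> 2 * ((\<Prod>t<n. pexp (ratio_law pS k (ch t)) (\<lambda>r. r powr l)) / \<tau> powr l) + sqrt (\<tau> / card I)"
    using tail by simp
  finally show ?thesis unfolding qn unfolding chn_def B_def M_def T_def cover_err_def .
qed

text \<open>At information 0 every codeword already induces the target law, so the error is 0
  whatever the number of codewords. This serves rate 0, where there is no room for an
  exponent.\<close>

lemma soft_covering_words_zero:
  fixes pS :: "'s::finite pmf" and k :: "'s \<Rightarrow> 'c::finite pmf" and ch :: "'c \<Rightarrow> 'o::finite pmf"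
    and n :: nat
  assumes cw: "cond_codewords Q S C I pS k" and zero: "ratio_info pS k ch = 0"
  shows "pexp (Pi_pmf {..<n} dL (\<lambda>_. Q)) (\<lambda>\<omega>. cover_err n dO I (\<lambda>i t. ch (C i (\<omega> t))) (\<lambda>t. bind_pmf (k (S (\<omega> t))) ch)) = 0"
proof -
  note cw = cw[unfolded cond_codewords_def]
  have I: "finite I" "I \<noteq> {}" using cw by blast+
  have "cover_err n dO I (\<lambda>i t. ch (C i (\<omega> t))) (\<lambda>t. bind_pmf (k (S (\<omega> t))) ch) = 0"
    if \<omega>: "\<omega> \<in> set_pmf (Pi_pmf {..<n} dL (\<lambda>_. Q))" for \<omega>
    unfolding cover_err_def
  proof (intro sum.neutral ballI)
    fix x
    have "Pi_pmf {..<n} dO (\<lambda>t. ch (C i (\<omega> t))) = Pi_pmf {..<n} dO (\<lambda>t. bind_pmf (k (S (\<omega> t))) ch)"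
      if i: "i \<in> I" for i
    proof (intro Pi_pmf_cong refl)
      fix t assume "t \<in> {..<n}"
      then have "\<omega> t \<in> set_pmf Q" using \<omega> by (auto simp: set_Pi_pmf PiE_dflt_def)
      then have "(S (\<omega> t), C i (\<omega> t)) \<in> set_pmf (map_pmf (\<lambda>l. (S l, C i l)) Q)" by auto
      also have "map_pmf (\<lambda>l. (S l, C i l)) Q = do {s \<leftarrow> pS; c \<leftarrow> k s; return_pmf (s, c)}"
        using cw i by blast
      finally show "ch (C i (\<omega> t)) = bind_pmf (k (S (\<omega> t))) ch"
        by (intro ratio_info_zeroD[OF zero]) auto
    qed
    then show "\<bar>(\<Sum>i\<in>I. pmf (Pi_pmf {..<n} dO (\<lambda>t. ch (C i (\<omega> t)))) x) / card I
        - pmf (Pi_pmf {..<n} dO (\<lambda>t. bind_pmf (k (S (\<omega> t))) ch)) x\<bar> = 0"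
      using I by (simp add: card_eq_0_iff)
  qed
  then show ?thesis by (subst pexp_cong[where g = "\<lambda>_. 0"]) auto
qed

text \<open>The adversary's guess at time \<open>t0\<close> is rated against the source letter and the actions of that
  time, so the channel \<open>ch'\<close> there reveals more than the side information.\<close>

lemma soft_covering_vanishing:
  fixes pS :: "'s::finite pmf" and k :: "'s \<Rightarrow> 'c::finite pmf" and ch ch' :: "'c \<Rightarrow> 'o::finite pmf"
  assumes R: "ratio_info pS k ch < R"
  obtains e where "e \<longlonglongrightarrow> 0"
    "\<forall>n t0 (Q :: 'l pmf) S (C :: 'i \<Rightarrow> 'l \<Rightarrow> 'c) I dL dC dO.
      t0 < n \<longrightarrow> cond_codewords Q S C I pS k \<longrightarrow> (\<forall>i\<in>I. C i dL = dC) \<longrightarrow> 2 powr (real n * R) / 2 \<le> card I \<longrightarrow>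
      pexp (Pi_pmf {..<n} dL (\<lambda>_. Q)) (\<lambda>\<omega>. cover_err n dO I
        (\<lambda>i t. (if t = t0 then ch' else ch) (C i (\<omega> t)))
        (\<lambda>t. bind_pmf (k (S (\<omega> t))) (if t = t0 then ch' else ch))) \<le> e n"
proof -
  \<comment> \<open>With cut-off \<open>\<tau> = 2 powr (n * c)\<close> and \<open>c\<close>
    strictly between information and rate, the tail decays like \<open>x ^ n\<close> and the
    fluctuation like \<open>y ^ n\<close>.\<close>
  obtain c where c: "ratio_info pS k ch < c" "c < R" using R dense by blast
  obtain l where l: "l > 0" "pexp (ratio_law pS k ch) (\<lambda>r. r powr l) < 2 powr (l * c)"
    using ratio_law_exponent[OF c(1)] by blast
  define \<rho> where "\<rho> = pexp (ratio_law pS k ch) (\<lambda>r. r powr l)"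
  define \<rho>' where "\<rho>' = pexp (ratio_law pS k ch') (\<lambda>r. r powr l)"
  have \<rho>: "\<rho> > 0" "\<rho>' > 0" unfolding \<rho>_def \<rho>'_def by (rule ratio_moment_pos)+
  define x where "x = \<rho> / 2 powr (l * c)"
  define y where "y = 2 powr ((c - R) / 2)"
  \<comment> \<open>The one letter with channel \<open>ch'\<close> costs the factor
    \<open>\<rho>' / \<rho>\<close>, the same for every \<open>t0\<close>; \<open>sqrt 2\<close>
    pays for the rounded number of codewords.\<close>
  define e where "e n = 2 * (x ^ n * (\<rho>' / \<rho>)) + sqrt 2 * y ^ n" for n
  have x: "0 < x" "x < 1" using l(2) \<rho> by (auto simp: x_def \<rho>_def)
  have y: "0 < y" "y < 1" using c(2) by (auto simp: y_def intro: powr_less_one)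
  have "e \<longlonglongrightarrow> 2 * (0 * (\<rho>' / \<rho>)) + sqrt 2 * 0"
    unfolding e_def using x y by (intro tendsto_intros LIMSEQ_power_zero) auto
  then have e: "e \<longlonglongrightarrow> 0" by simp
  have "pexp (Pi_pmf {..<n} dL (\<lambda>_. Q)) (\<lambda>\<omega>. cover_err n dO I
        (\<lambda>i t. (if t = t0 then ch' else ch) (C i (\<omega> t)))
        (\<lambda>t. bind_pmf (k (S (\<omega> t))) (if t = t0 then ch' else ch))) \<le> e n"
    if t0: "t0 < n" and cw: "cond_codewords Q S C I pS k" and dC: "\<And>i. i \<in> I \<Longrightarrow> C i dL = dC"
      and card: "2 powr (real n * R) / 2 \<le> card I"
    for n t0 and Q :: "'l pmf" and S and C :: "'i \<Rightarrow> 'l \<Rightarrow> 'c" and I dL dC dO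
  proof -
    define \<tau> where "\<tau> = 2 powr (real n * c)"
    have \<tau>: "\<tau> > 0" by (simp add: \<tau>_def)
    have "(\<Prod>t<n. pexp (ratio_law pS k (if t = t0 then ch' else ch)) (\<lambda>r. r powr l))
       = \<rho>' * (\<Prod>t\<in>{..<n} - {t0}. pexp (ratio_law pS k (if t = t0 then ch' else ch)) (\<lambda>r. r powr l))"
      using t0 by (subst prod.remove[of _ t0]) (auto simp: \<rho>'_def)
    also have "(\<Prod>t\<in>{..<n} - {t0}. pexp (ratio_law pS k (if t = t0 then ch' else ch)) (\<lambda>r. r powr l))
       = (\<Prod>t\<in>{..<n} - {t0}. \<rho>)" by (intro prod.cong) (auto simp: \<rho>_def)
    also have "\<dots> = \<rho> ^ n / \<rho>" using t0 \<rho> by (simp add: power_diff)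
    finally have 1: "(\<Prod>t<n. pexp (ratio_law pS k (if t = t0 then ch' else ch)) (\<lambda>r. r powr l)) / \<tau> powr l
       = x ^ n * (\<rho>' / \<rho>)"
      by (simp add: x_def \<tau>_def powr_powr power_divide powr_power mult_ac)
    have "0 < real (card I)" using card by (rule less_le_trans[rotated]) simp
    then have "sqrt (\<tau> / card I) \<le> sqrt (\<tau> / (2 powr (real n * R) / 2))"
      using card \<tau> by (intro real_sqrt_le_mono divide_left_mono mult_pos_pos) auto
    also have "\<tau> / (2 powr (real n * R) / 2) = 2 * (2 powr (c - R)) ^ n"
      by (simp add: \<tau>_def powr_power powr_diff left_diff_distrib power_divide mult.commute)
    also have "2 powr (c - R) = y\<^sup>2" by (simp add: y_def power2_eq_square powr_add[symmetric])
    also have "sqrt (2 * (y\<^sup>2) ^ n) = sqrt 2 * y ^ n"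
      using y by (simp add: real_sqrt_mult real_sqrt_power)
    finally have 2: "sqrt (\<tau> / card I) \<le> sqrt 2 * y ^ n" .
    have "pexp (Pi_pmf {..<n} dL (\<lambda>_. Q)) (\<lambda>\<omega>. cover_err n dO I
        (\<lambda>i t. (if t = t0 then ch' else ch) (C i (\<omega> t)))
        (\<lambda>t. bind_pmf (k (S (\<omega> t))) (if t = t0 then ch' else ch)))
      \<le> 2 * ((\<Prod>t<n. pexp (ratio_law pS k (if t = t0 then ch' else ch)) (\<lambda>r. r powr l)) / \<tau> powr l) + sqrt (\<tau> / card I)"
      by (rule soft_covering_words[OF cw dC \<tau> l(1)])
    also have "\<dots> \<le> e n" unfolding 1 e_def using 2 by simp
    finally show ?thesis .
  qed
  then show ?thesis using e by (intro that) blast+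
qed

section \<open>Random superposition codebooks\<close>

lemma bind_Pi_pmf1:
  assumes "finite A" "x \<in> A"
  shows "bind_pmf (Pi_pmf A d p) (\<lambda>f. H (f x)) = bind_pmf (p x) H"
proof -
  have "bind_pmf (Pi_pmf A d p) (\<lambda>f. H (f x)) = bind_pmf (map_pmf (\<lambda>f. f x) (Pi_pmf A d p)) H"
    by (simp add: bind_map_pmf)
  then show ?thesis using assms by (simp add: Pi_pmf_component)
qed

lemma bind_Pi_pmf2:
  assumes "finite A" "x \<in> A" "y \<in> A" "x \<noteq> y"
  shows "bind_pmf (Pi_pmf A d p) (\<lambda>f. H (f x) (f y)) = do {u \<leftarrow> p x; v \<leftarrow> p y; H u v}"
proof -
  have A: "A = insert x (A - {x})" using assms by auto
  have "bind_pmf (Pi_pmf A d p) (\<lambda>f. H (f x) (f y))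
    = do {u \<leftarrow> p x; f \<leftarrow> Pi_pmf (A - {x}) d p; H u (f y)}"
    using assms by (subst A, subst Pi_pmf_insert') (simp_all add: bind_assoc_pmf bind_return_pmf)
  also have "\<dots> = do {u \<leftarrow> p x; v \<leftarrow> p y; H u v}"
    using assms by (intro bind_pmf_cong refl bind_Pi_pmf1) auto
  finally show ?thesis .
qed

type_synonym ('a, 'b, 'c, 'd) letter_code =
  "(nat \<Rightarrow> 'a) \<times> (nat \<times> nat \<Rightarrow> 'b) \<times> (nat \<times> nat \<Rightarrow> 'c) \<times> (nat \<times> nat \<times> nat \<Rightarrow> 'd)"

text \<open>One letter of every codeword.  The message of node 2 is \<open>i\<close>, that of node 1 is \<open>(i, j)\<close>, the key is
  \<open>k\<close>, and \<open>a, b, c, d\<close> stand for \<open>U\<^sub>2, V\<^sub>2, U\<^sub>1, V\<^sub>1\<close>.\<close>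

definition letter_code_pmf ::
  "nat set \<Rightarrow> nat set \<Rightarrow> nat set \<Rightarrow> 'a pmf \<Rightarrow> ('a \<Rightarrow> 'b pmf) \<Rightarrow> ('a \<Rightarrow> 'c pmf) \<Rightarrow> ('a \<Rightarrow> 'b \<Rightarrow> 'c \<Rightarrow> 'd pmf)
    \<Rightarrow> ('a, 'b, 'c, 'd) letter_code pmf" where
  "letter_code_pmf I J K pA kB kC kD = do {
     a \<leftarrow> Pi_pmf I undefined (\<lambda>_. pA);
     b \<leftarrow> Pi_pmf (I \<times> K) undefined (\<lambda>(i, k). kB (a i));
     c \<leftarrow> Pi_pmf (I \<times> J) undefined (\<lambda>(i, j). kC (a i));
     d \<leftarrow> Pi_pmf (I \<times> J \<times> K) undefined (\<lambda>(i, j, k). kD (a i) (b (i, k)) (c (i, j)));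
     return_pmf (a, b, c, d)}"

definition let_a :: "nat \<Rightarrow> ('a, 'b, 'c, 'd) letter_code \<Rightarrow> 'a" where
  "let_a i = (\<lambda>(a, b, c, d). a i)"
definition let_b :: "nat \<Rightarrow> nat \<Rightarrow> ('a, 'b, 'c, 'd) letter_code \<Rightarrow> 'b" where
  "let_b i k = (\<lambda>(a, b, c, d). b (i, k))"
definition let_c :: "nat \<Rightarrow> nat \<Rightarrow> ('a, 'b, 'c, 'd) letter_code \<Rightarrow> 'c" where
  "let_c i j = (\<lambda>(a, b, c, d). c (i, j))"
definition let_d :: "nat \<Rightarrow> nat \<Rightarrow> nat \<Rightarrow> ('a, 'b, 'c, 'd) letter_code \<Rightarrow> 'd" where
  "let_d i j k = (\<lambda>(a, b, c, d). d (i, j, k))"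

lemmas let_defs = let_a_def let_b_def let_c_def let_d_def

definition pAB :: "'a pmf \<Rightarrow> ('a \<Rightarrow> 'b pmf) \<Rightarrow> ('a \<times> 'b) pmf" where
  "pAB pA kB = do {a \<leftarrow> pA; b \<leftarrow> kB a; return_pmf (a, b)}"

text \<open>The law of \<open>V\<^sub>1\<close> given \<open>(U\<^sub>2, V\<^sub>2)\<close>: at
  fixed \<open>i\<close> and \<open>k\<close> a new \<open>j\<close> brings a new
  \<open>U\<^sub>1\<close>, which is therefore integrated out.\<close>

definition kAB_D :: "('a \<Rightarrow> 'c pmf) \<Rightarrow> ('a \<Rightarrow> 'b \<Rightarrow> 'c \<Rightarrow> 'd pmf) \<Rightarrow> 'a \<times> 'b \<Rightarrow> 'd pmf" where
  "kAB_D kC kD = (\<lambda>(a, b). bind_pmf (kC a) (kD a b))"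

text \<open>The law of \<open>(V\<^sub>2, V\<^sub>1)\<close> given
  \<open>(U\<^sub>2, U\<^sub>1)\<close>: for an adversary who knows \<open>i\<close> and
  \<open>j\<close>, both vary with the key.\<close>

definition kAC_BD :: "('a \<Rightarrow> 'b pmf) \<Rightarrow> ('a \<Rightarrow> 'b \<Rightarrow> 'c \<Rightarrow> 'd pmf) \<Rightarrow> 'a \<times> 'c \<Rightarrow> ('b \<times> 'd) pmf" where
  "kAC_BD kB kD = (\<lambda>(a, c). do {b \<leftarrow> kB a; d \<leftarrow> kD a b c; return_pmf (b, d)})"

context
  fixes I J K :: "nat set"
    and pA :: "'a::finite pmf" and kB :: "'a \<Rightarrow> 'b::finite pmf" and kC :: "'a \<Rightarrow> 'c::finite pmf"
    and kD :: "'a \<Rightarrow> 'b \<Rightarrow> 'c \<Rightarrow> 'd::finite pmf"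
  assumes fin: "finite I" "finite J" "finite K" and ne: "I \<noteq> {}" "J \<noteq> {}" "K \<noteq> {}"
begin

lemma finite_letter_code_pmf: "finite (set_pmf (letter_code_pmf I J K pA kB kC kD))"
  unfolding letter_code_pmf_def using fin by (auto intro!: finite_UN_I finite_set_Pi_pmf)

text \<open>With \<open>i\<close> and \<open>k\<close> fixed, the centre is
  \<open>(u\<^sub>2, v\<^sub>2)\<close>, and distinct \<open>j\<close> read distinct entries of the
  tables \<open>c\<close> and \<open>d\<close>. The tables are reduced to the entries read in
  reverse order of drawing, because the law of each depends on the earlier ones.\<close>

lemma cond_codewords_node1:
  assumes i: "i \<in> I" and k: "k \<in> K"
  shows "cond_codewords (letter_code_pmf I J K pA kB kC kD) (\<lambda>l. (let_a i l, let_b i k l)) (\<lambda>j. let_d i j k) J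
    (pAB pA kB) (kAB_D kC kD)"
  unfolding cond_codewords_def
proof (intro conjI ballI impI)
  fix j assume j: "j \<in> J"
  have "map_pmf (\<lambda>l. ((let_a i l, let_b i k l), let_d i j k l)) (letter_code_pmf I J K pA kB kC kD)
    = do {
     a \<leftarrow> Pi_pmf I undefined (\<lambda>_. pA);
     b \<leftarrow> Pi_pmf (I \<times> K) undefined (\<lambda>(i, k). kB (a i));
     c \<leftarrow> Pi_pmf (I \<times> J) undefined (\<lambda>(i, j). kC (a i));
     d \<leftarrow> Pi_pmf (I \<times> J \<times> K) undefined (\<lambda>(i, j, k). kD (a i) (b (i, k)) (c (i, j)));
     return_pmf ((a i, b (i, k)), d (i, j, k))}"
    by (simp add: letter_code_pmf_def map_bind_pmf let_defs)
  also have "\<dots> = do {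
     a \<leftarrow> Pi_pmf I undefined (\<lambda>_. pA);
     b \<leftarrow> Pi_pmf (I \<times> K) undefined (\<lambda>(i, k). kB (a i));
     c \<leftarrow> Pi_pmf (I \<times> J) undefined (\<lambda>(i, j). kC (a i));
     d \<leftarrow> kD (a i) (b (i, k)) (c (i, j));
     return_pmf ((a i, b (i, k)), d)}"
    using fin i j k by (intro bind_pmf_cong refl trans[OF bind_Pi_pmf1[where x = "(i, j, k)" and
      H = "\<lambda>d. return_pmf ((_, _), d)"]]) auto
  also have "\<dots> = do {
     a \<leftarrow> Pi_pmf I undefined (\<lambda>_. pA);
     b \<leftarrow> Pi_pmf (I \<times> K) undefined (\<lambda>(i, k). kB (a i));
     c \<leftarrow> kC (a i);
     d \<leftarrow> kD (a i) (b (i, k)) c;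
     return_pmf ((a i, b (i, k)), d)}"
    using fin i j k by (intro bind_pmf_cong refl trans[OF bind_Pi_pmf1[where x = "(i, j)" and
      H = "\<lambda>c. do {d \<leftarrow> kD _ _ c; return_pmf ((_, _), d)}"]]) auto
  also have "\<dots> = do {
     a \<leftarrow> Pi_pmf I undefined (\<lambda>_. pA);
     b \<leftarrow> kB (a i);
     c \<leftarrow> kC (a i);
     d \<leftarrow> kD (a i) b c;
     return_pmf ((a i, b), d)}"
    using fin i j k by (intro bind_pmf_cong refl trans[OF bind_Pi_pmf1[where x = "(i, k)" and
      H = "\<lambda>b. do {c \<leftarrow> kC _; d \<leftarrow> kD _ b c; return_pmf ((_, b), d)}"]]) auto
  also have "\<dots> = do {
     a \<leftarrow> pA;
     b \<leftarrow> kB a;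
     c \<leftarrow> kC a;
     d \<leftarrow> kD a b c;
     return_pmf ((a, b), d)}"
    using fin i j k by (intro trans[OF bind_Pi_pmf1[where x = "i" and
      H = "\<lambda>a. do {b \<leftarrow> kB a; c \<leftarrow> kC a; d \<leftarrow> kD a b c; return_pmf ((a, b), d)}"]]) auto
  also have "\<dots> = do {s \<leftarrow> pAB pA kB; c \<leftarrow> kAB_D kC kD s; return_pmf (s, c)}"
    by (simp add: pAB_def kAB_D_def bind_assoc_pmf bind_return_pmf)
  finally show "map_pmf (\<lambda>l. ((let_a i l, let_b i k l), let_d i j k l)) (letter_code_pmf I J K pA kB kC kD) = \<dots>" .
next
  fix j j' assume j: "j \<in> J" "j' \<in> J" "j \<noteq> j'"
  have "map_pmf (\<lambda>l. ((let_a i l, let_b i k l), let_d i j k l, let_d i j' k l)) (letter_code_pmf I J K pA kB kC kD)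
    = do {
     a \<leftarrow> Pi_pmf I undefined (\<lambda>_. pA);
     b \<leftarrow> Pi_pmf (I \<times> K) undefined (\<lambda>(i, k). kB (a i));
     c \<leftarrow> Pi_pmf (I \<times> J) undefined (\<lambda>(i, j). kC (a i));
     d \<leftarrow> Pi_pmf (I \<times> J \<times> K) undefined (\<lambda>(i, j, k). kD (a i) (b (i, k)) (c (i, j)));
     return_pmf ((a i, b (i, k)), d (i, j, k), d (i, j', k))}"
    by (simp add: letter_code_pmf_def map_bind_pmf let_defs)
  also have "\<dots> = do {
     a \<leftarrow> Pi_pmf I undefined (\<lambda>_. pA);
     b \<leftarrow> Pi_pmf (I \<times> K) undefined (\<lambda>(i, k). kB (a i));
     c \<leftarrow> Pi_pmf (I \<times> J) undefined (\<lambda>(i, j). kC (a i));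
     d \<leftarrow> kD (a i) (b (i, k)) (c (i, j));
     d' \<leftarrow> kD (a i) (b (i, k)) (c (i, j'));
     return_pmf ((a i, b (i, k)), d, d')}"
    using fin i j k by (intro bind_pmf_cong refl trans[OF bind_Pi_pmf2[where x = "(i, j, k)" and y = "(i, j', k)" and
      H = "\<lambda>d d'. return_pmf ((_, _), d, d')"]]) auto
  also have "\<dots> = do {
     a \<leftarrow> Pi_pmf I undefined (\<lambda>_. pA);
     b \<leftarrow> Pi_pmf (I \<times> K) undefined (\<lambda>(i, k). kB (a i));
     c \<leftarrow> kC (a i);
     c' \<leftarrow> kC (a i);
     d \<leftarrow> kD (a i) (b (i, k)) c;
     d' \<leftarrow> kD (a i) (b (i, k)) c';
     return_pmf ((a i, b (i, k)), d, d')}"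
    using fin i j k by (intro bind_pmf_cong refl trans[OF bind_Pi_pmf2[where x = "(i, j)" and y = "(i, j')" and
      H = "\<lambda>c c'. do {d \<leftarrow> kD _ _ c; d' \<leftarrow> kD _ _ c'; return_pmf ((_, _), d, d')}"]]) auto
  also have "\<dots> = do {
     a \<leftarrow> Pi_pmf I undefined (\<lambda>_. pA);
     b \<leftarrow> kB (a i);
     c \<leftarrow> kC (a i);
     c' \<leftarrow> kC (a i);
     d \<leftarrow> kD (a i) b c;
     d' \<leftarrow> kD (a i) b c';
     return_pmf ((a i, b), d, d')}"
    using fin i j k by (intro bind_pmf_cong refl trans[OF bind_Pi_pmf1[where x = "(i, k)" and
      H = "\<lambda>b. do {c \<leftarrow> kC _; c' \<leftarrow> kC _; d \<leftarrow> kD _ b c; d' \<leftarrow> kD _ b c'; return_pmf ((_, b), d, d')}"]]) auto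
  also have "\<dots> = do {
     a \<leftarrow> pA;
     b \<leftarrow> kB a;
     c \<leftarrow> kC a;
     c' \<leftarrow> kC a;
     d \<leftarrow> kD a b c;
     d' \<leftarrow> kD a b c';
     return_pmf ((a, b), d, d')}"
    using fin i j k by (intro trans[OF bind_Pi_pmf1[where x = "i" and
      H = "\<lambda>a. do {b \<leftarrow> kB a; c \<leftarrow> kC a; c' \<leftarrow> kC a; d \<leftarrow> kD a b c; d' \<leftarrow> kD a b c'; return_pmf ((a, b), d, d')}"]]) auto
  also have "\<dots> = do {s \<leftarrow> pAB pA kB; c \<leftarrow> kAB_D kC kD s; c' \<leftarrow> kAB_D kC kD s; return_pmf (s, c, c')}"
    by (simp add: pAB_def kAB_D_def bind_assoc_pmf bind_return_pmf, subst bind_commute_pmf, rule refl)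
  finally show "map_pmf (\<lambda>l. ((let_a i l, let_b i k l), let_d i j k l, let_d i j' k l)) (letter_code_pmf I J K pA kB kC kD) = \<dots>" .
qed (use fin ne finite_letter_code_pmf in auto)

text \<open>With \<open>k\<close> fixed, the pairs \<open>(u\<^sub>2(i), v\<^sub>2(i, k))\<close>
  are independent in \<open>i\<close>, so the centre is trivial. Covering over \<open>i\<close> is
  the outer layer of covering the source, covering over \<open>j\<close> the inner one.\<close>

lemma cond_codewords_node2:
  assumes k: "k \<in> K"
  shows "cond_codewords (letter_code_pmf I J K pA kB kC kD) (\<lambda>_. ()) (\<lambda>i l. (let_a i l, let_b i k l)) I
    (return_pmf ()) (\<lambda>_. pAB pA kB)"
  unfolding cond_codewords_def
proof (intro conjI ballI impI)
  fix i assume i: "i \<in> I"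
  have "map_pmf (\<lambda>l. ((), let_a i l, let_b i k l)) (letter_code_pmf I J K pA kB kC kD)
    = do {
     a \<leftarrow> Pi_pmf I undefined (\<lambda>_. pA);
     b \<leftarrow> Pi_pmf (I \<times> K) undefined (\<lambda>(i, k). kB (a i));
     return_pmf ((), a i, b (i, k))}"
    by (simp add: letter_code_pmf_def map_bind_pmf let_defs)
  also have "\<dots> = do {
     a \<leftarrow> Pi_pmf I undefined (\<lambda>_. pA);
     b \<leftarrow> kB (a i);
     return_pmf ((), a i, b)}"
    using fin i k by (intro bind_pmf_cong refl trans[OF bind_Pi_pmf1[where x = "(i, k)" and
      H = "\<lambda>b. return_pmf ((), _, b)"]]) auto
  also have "\<dots> = do {a \<leftarrow> pA; b \<leftarrow> kB a; return_pmf ((), a, b)}"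
    using fin i k by (intro trans[OF bind_Pi_pmf1[where x = "i" and
      H = "\<lambda>a. do {b \<leftarrow> kB a; return_pmf ((), a, b)}"]]) auto
  also have "\<dots> = do {s \<leftarrow> return_pmf (); c \<leftarrow> pAB pA kB; return_pmf (s, c)}"
    by (simp add: pAB_def bind_assoc_pmf bind_return_pmf)
  finally show "map_pmf (\<lambda>l. ((), let_a i l, let_b i k l)) (letter_code_pmf I J K pA kB kC kD) = \<dots>" .
next
  fix i i' assume i: "i \<in> I" "i' \<in> I" "i \<noteq> i'"
  have "map_pmf (\<lambda>l. ((), (let_a i l, let_b i k l), (let_a i' l, let_b i' k l))) (letter_code_pmf I J K pA kB kC kD)
    = do {
     a \<leftarrow> Pi_pmf I undefined (\<lambda>_. pA);
     b \<leftarrow> Pi_pmf (I \<times> K) undefined (\<lambda>(i, k). kB (a i));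
     return_pmf ((), (a i, b (i, k)), (a i', b (i', k)))}"
    by (simp add: letter_code_pmf_def map_bind_pmf let_defs)
  also have "\<dots> = do {
     a \<leftarrow> Pi_pmf I undefined (\<lambda>_. pA);
     b \<leftarrow> kB (a i);
     b' \<leftarrow> kB (a i');
     return_pmf ((), (a i, b), (a i', b'))}"
    using fin i k by (intro bind_pmf_cong refl trans[OF bind_Pi_pmf2[where x = "(i, k)" and y = "(i', k)" and
      H = "\<lambda>b b'. return_pmf ((), (_, b), (_, b'))"]]) auto
  also have "\<dots> = do {a \<leftarrow> pA; a' \<leftarrow> pA; b \<leftarrow> kB a; b' \<leftarrow> kB a'; return_pmf ((), (a, b), (a', b'))}"
    using fin i k by (intro trans[OF bind_Pi_pmf2[where x = "i" and y = "i'" and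
      H = "\<lambda>a a'. do {b \<leftarrow> kB a; b' \<leftarrow> kB a'; return_pmf ((), (a, b), (a', b'))}"]]) auto
  also have "\<dots> = do {s \<leftarrow> return_pmf (); c \<leftarrow> pAB pA kB; c' \<leftarrow> pAB pA kB; return_pmf (s, c, c')}"
    by (simp add: pAB_def bind_assoc_pmf bind_return_pmf, subst bind_commute_pmf, rule refl)
  finally show "map_pmf (\<lambda>l. ((), (let_a i l, let_b i k l), (let_a i' l, let_b i' k l))) (letter_code_pmf I J K pA kB kC kD) = \<dots>" .
qed (use fin ne finite_letter_code_pmf in auto)

text \<open>The messages fix the centre \<open>(u\<^sub>2, u\<^sub>1)\<close> and the key ranges
  over the satellites \<open>(v\<^sub>2, v\<^sub>1)\<close>. The codebook draws
  \<open>v\<^sub>2\<close> before \<open>u\<^sub>1\<close>; the order can be exchanged because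
  either kernel reads \<open>u\<^sub>2\<close> only.\<close>

lemma cond_codewords_adversary:
  assumes i: "i \<in> I" and j: "j \<in> J"
  shows "cond_codewords (letter_code_pmf I J K pA kB kC kD) (\<lambda>l. (let_a i l, let_c i j l))
    (\<lambda>k l. (let_b i k l, let_d i j k l)) K (pAB pA kC) (kAC_BD kB kD)"
  unfolding cond_codewords_def
proof (intro conjI ballI impI)
  fix k assume k: "k \<in> K"
  have "map_pmf (\<lambda>l. ((let_a i l, let_c i j l), let_b i k l, let_d i j k l)) (letter_code_pmf I J K pA kB kC kD)
    = do {
     a \<leftarrow> Pi_pmf I undefined (\<lambda>_. pA);
     b \<leftarrow> Pi_pmf (I \<times> K) undefined (\<lambda>(i, k). kB (a i));
     c \<leftarrow> Pi_pmf (I \<times> J) undefined (\<lambda>(i, j). kC (a i));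
     d \<leftarrow> Pi_pmf (I \<times> J \<times> K) undefined (\<lambda>(i, j, k). kD (a i) (b (i, k)) (c (i, j)));
     return_pmf ((a i, c (i, j)), b (i, k), d (i, j, k))}"
    by (simp add: letter_code_pmf_def map_bind_pmf let_defs)
  also have "\<dots> = do {
     a \<leftarrow> Pi_pmf I undefined (\<lambda>_. pA);
     b \<leftarrow> Pi_pmf (I \<times> K) undefined (\<lambda>(i, k). kB (a i));
     c \<leftarrow> Pi_pmf (I \<times> J) undefined (\<lambda>(i, j). kC (a i));
     d \<leftarrow> kD (a i) (b (i, k)) (c (i, j));
     return_pmf ((a i, c (i, j)), b (i, k), d)}"
    using fin i j k by (intro bind_pmf_cong refl trans[OF bind_Pi_pmf1[where x = "(i, j, k)" and
      H = "\<lambda>d. return_pmf ((_, _), _, d)"]]) auto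
  also have "\<dots> = do {
     a \<leftarrow> Pi_pmf I undefined (\<lambda>_. pA);
     b \<leftarrow> Pi_pmf (I \<times> K) undefined (\<lambda>(i, k). kB (a i));
     c \<leftarrow> kC (a i);
     d \<leftarrow> kD (a i) (b (i, k)) c;
     return_pmf ((a i, c), b (i, k), d)}"
    using fin i j k by (intro bind_pmf_cong refl trans[OF bind_Pi_pmf1[where x = "(i, j)" and
      H = "\<lambda>c. do {d \<leftarrow> kD _ _ c; return_pmf ((_, c), _, d)}"]]) auto
  also have "\<dots> = do {
     a \<leftarrow> Pi_pmf I undefined (\<lambda>_. pA);
     b \<leftarrow> kB (a i);
     c \<leftarrow> kC (a i);
     d \<leftarrow> kD (a i) b c;
     return_pmf ((a i, c), b, d)}"
    using fin i j k by (intro bind_pmf_cong refl trans[OF bind_Pi_pmf1[where x = "(i, k)" and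
      H = "\<lambda>b. do {c \<leftarrow> kC _; d \<leftarrow> kD _ b c; return_pmf ((_, c), b, d)}"]]) auto
  also have "\<dots> = do {
     a \<leftarrow> pA;
     b \<leftarrow> kB a;
     c \<leftarrow> kC a;
     d \<leftarrow> kD a b c;
     return_pmf ((a, c), b, d)}"
    using fin i j k by (intro trans[OF bind_Pi_pmf1[where x = "i" and
      H = "\<lambda>a. do {b \<leftarrow> kB a; c \<leftarrow> kC a; d \<leftarrow> kD a b c; return_pmf ((a, c), b, d)}"]]) auto
  also have "\<dots> = do {
     a \<leftarrow> pA;
     c \<leftarrow> kC a;
     b \<leftarrow> kB a;
     d \<leftarrow> kD a b c;
     return_pmf ((a, c), b, d)}"
    by (intro bind_pmf_cong refl bind_commute_pmf)
  also have "\<dots> = do {s \<leftarrow> pAB pA kC; c \<leftarrow> kAC_BD kB kD s; return_pmf (s, c)}"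
    by (simp add: pAB_def kAC_BD_def bind_assoc_pmf bind_return_pmf)
  finally show "map_pmf (\<lambda>l. ((let_a i l, let_c i j l), let_b i k l, let_d i j k l)) (letter_code_pmf I J K pA kB kC kD) = \<dots>" .
next
  fix k k' assume k: "k \<in> K" "k' \<in> K" "k \<noteq> k'"
  have "map_pmf (\<lambda>l. ((let_a i l, let_c i j l), (let_b i k l, let_d i j k l), (let_b i k' l, let_d i j k' l))) (letter_code_pmf I J K pA kB kC kD)
    = do {
     a \<leftarrow> Pi_pmf I undefined (\<lambda>_. pA);
     b \<leftarrow> Pi_pmf (I \<times> K) undefined (\<lambda>(i, k). kB (a i));
     c \<leftarrow> Pi_pmf (I \<times> J) undefined (\<lambda>(i, j). kC (a i));
     d \<leftarrow> Pi_pmf (I \<times> J \<times> K) undefined (\<lambda>(i, j, k). kD (a i) (b (i, k)) (c (i, j)));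
     return_pmf ((a i, c (i, j)), (b (i, k), d (i, j, k)), (b (i, k'), d (i, j, k')))}"
    by (simp add: letter_code_pmf_def map_bind_pmf let_defs)
  also have "\<dots> = do {
     a \<leftarrow> Pi_pmf I undefined (\<lambda>_. pA);
     b \<leftarrow> Pi_pmf (I \<times> K) undefined (\<lambda>(i, k). kB (a i));
     c \<leftarrow> Pi_pmf (I \<times> J) undefined (\<lambda>(i, j). kC (a i));
     d \<leftarrow> kD (a i) (b (i, k)) (c (i, j));
     d' \<leftarrow> kD (a i) (b (i, k')) (c (i, j));
     return_pmf ((a i, c (i, j)), (b (i, k), d), (b (i, k'), d'))}"
    using fin i j k by (intro bind_pmf_cong refl trans[OF bind_Pi_pmf2[where x = "(i, j, k)" and y = "(i, j, k')" and
      H = "\<lambda>d d'. return_pmf ((_, _), (_, d), (_, d'))"]]) auto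
  also have "\<dots> = do {
     a \<leftarrow> Pi_pmf I undefined (\<lambda>_. pA);
     b \<leftarrow> Pi_pmf (I \<times> K) undefined (\<lambda>(i, k). kB (a i));
     c \<leftarrow> kC (a i);
     d \<leftarrow> kD (a i) (b (i, k)) c;
     d' \<leftarrow> kD (a i) (b (i, k')) c;
     return_pmf ((a i, c), (b (i, k), d), (b (i, k'), d'))}"
    using fin i j k by (intro bind_pmf_cong refl trans[OF bind_Pi_pmf1[where x = "(i, j)" and
      H = "\<lambda>c. do {d \<leftarrow> kD _ _ c; d' \<leftarrow> kD _ _ c; return_pmf ((_, c), (_, d), (_, d'))}"]]) auto
  also have "\<dots> = do {
     a \<leftarrow> Pi_pmf I undefined (\<lambda>_. pA);
     b \<leftarrow> kB (a i);
     b' \<leftarrow> kB (a i);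
     c \<leftarrow> kC (a i);
     d \<leftarrow> kD (a i) b c;
     d' \<leftarrow> kD (a i) b' c;
     return_pmf ((a i, c), (b, d), (b', d'))}"
    using fin i j k by (intro bind_pmf_cong refl trans[OF bind_Pi_pmf2[where x = "(i, k)" and y = "(i, k')" and
      H = "\<lambda>b b'. do {c \<leftarrow> kC _; d \<leftarrow> kD _ b c; d' \<leftarrow> kD _ b' c; return_pmf ((_, c), (b, d), (b', d'))}"]]) auto
  also have "\<dots> = do {
     a \<leftarrow> pA;
     b \<leftarrow> kB a;
     b' \<leftarrow> kB a;
     c \<leftarrow> kC a;
     d \<leftarrow> kD a b c;
     d' \<leftarrow> kD a b' c;
     return_pmf ((a, c), (b, d), (b', d'))}"
    using fin i j k by (intro trans[OF bind_Pi_pmf1[where x = "i" and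
      H = "\<lambda>a. do {b \<leftarrow> kB a; b' \<leftarrow> kB a; c \<leftarrow> kC a; d \<leftarrow> kD a b c; d' \<leftarrow> kD a b' c; return_pmf ((a, c), (b, d), (b', d'))}"]]) auto
  also have "\<dots> = do {
     a \<leftarrow> pA;
     b \<leftarrow> kB a;
     c \<leftarrow> kC a;
     b' \<leftarrow> kB a;
     d \<leftarrow> kD a b c;
     d' \<leftarrow> kD a b' c;
     return_pmf ((a, c), (b, d), (b', d'))}"
    by (intro bind_pmf_cong refl bind_commute_pmf)
  also have "\<dots> = do {
     a \<leftarrow> pA;
     c \<leftarrow> kC a;
     b \<leftarrow> kB a;
     b' \<leftarrow> kB a;
     d \<leftarrow> kD a b c;
     d' \<leftarrow> kD a b' c;
     return_pmf ((a, c), (b, d), (b', d'))}"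
    by (intro bind_pmf_cong refl bind_commute_pmf)
  also have "\<dots> = do {
     a \<leftarrow> pA;
     c \<leftarrow> kC a;
     b \<leftarrow> kB a;
     d \<leftarrow> kD a b c;
     b' \<leftarrow> kB a;
     d' \<leftarrow> kD a b' c;
     return_pmf ((a, c), (b, d), (b', d'))}"
    by (intro bind_pmf_cong refl bind_commute_pmf)
  also have "\<dots> = do {s \<leftarrow> pAB pA kC; c \<leftarrow> kAC_BD kB kD s; c' \<leftarrow> kAC_BD kB kD s; return_pmf (s, c, c')}"
    by (simp add: pAB_def kAC_BD_def bind_assoc_pmf bind_return_pmf)
  finally show "map_pmf (\<lambda>l. ((let_a i l, let_c i j l), (let_b i k l, let_d i j k l), (let_b i k' l, let_d i j k' l))) (letter_code_pmf I J K pA kB kC kD) = \<dots>" .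
qed (use fin ne finite_letter_code_pmf in auto)

end

section \<open>Sequences as lists and as functions\<close>

lemma indep_list_pmf_map:
  assumes "distinct ts"
  shows "indep_list_pmf (map p ts) = map_pmf (\<lambda>f. map f ts) (Pi_pmf (set ts) d p)"
  using assms
proof (induction ts)
  case (Cons t ts)
  have "map_pmf (\<lambda>f. map f (t # ts)) (Pi_pmf (set (t # ts)) d p)
    = do {x \<leftarrow> p t; f \<leftarrow> Pi_pmf (set ts) d p; return_pmf (x # map (f(t := x)) ts)}"
    using Cons.prems by (simp add: Pi_pmf_insert' map_bind_pmf)
  also have "\<dots> = do {x \<leftarrow> p t; f \<leftarrow> Pi_pmf (set ts) d p; return_pmf (x # map f ts)}"
    using Cons.prems by (intro bind_pmf_cong refl) (auto intro!: arg_cong[where f = return_pmf])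
  also have "\<dots> = indep_list_pmf (map p (t # ts))"
    using Cons by (simp add: map_pmf_def bind_assoc_pmf bind_return_pmf)
  finally show ?case ..
qed simp

lemma indep_list_pmf_upt:
  "indep_list_pmf (map p [0..<n]) = map_pmf (\<lambda>f. map f [0..<n]) (Pi_pmf {..<n} d p)"
  using indep_list_pmf_map[of "[0..<n]" p d] by (simp add: lessThan_atLeast0)

lemma replicate_pmf_eq_Pi_pmf:
  "replicate_pmf n p = map_pmf (\<lambda>f. map f [0..<n]) (Pi_pmf {..<n} d (\<lambda>_. p))"
proof -
  have "replicate_pmf n p = indep_list_pmf (replicate n p)"
    by (induction n) simp_all
  also have "replicate n p = map (\<lambda>_. p) [0..<n]"
    by (simp add: map_replicate_const)
  finally show ?thesis by (simp add: indep_list_pmf_upt[where d = d])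
qed

lemma map_nth_indep_list_pmf:
  assumes "t < n"
  shows "map_pmf (\<lambda>xs. xs ! t) (indep_list_pmf (map p [0..<n])) = p t"
  using assms by (simp add: indep_list_pmf_upt[where d = undefined] pmf.map_comp o_def Pi_pmf_component)

lemma finite_indep_list_pmf:
  assumes "\<And>p. p \<in> set ps \<Longrightarrow> finite (set_pmf p)"
  shows "finite (set_pmf (indep_list_pmf ps))"
  using assms by (induction ps) auto

section \<open>The cascade code of a fixed codebook\<close>

text \<open>A kernel for \<open>C\<close> that reads only the second component of
  \<open>(A, B)\<close> is also the conditional law of \<open>C\<close> given \<open>B\<close>;
  dividing the joint law by the mass of \<open>B\<close> gives the product form.\<close>

lemma markov_chainI:
  assumes law: "map_pmf (\<lambda>s. ((A s, B s), C s)) S = bind_pmf J (\<lambda>ab. map_pmf (\<lambda>c. (ab, c)) (k (snd ab)))"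
  shows "markov_chain S A B C"
proof -
  have J: "map_pmf (\<lambda>s. (A s, B s)) S = J"
  proof -
    have "map_pmf (\<lambda>s. (A s, B s)) S = map_pmf fst (map_pmf (\<lambda>s. ((A s, B s), C s)) S)"
      by (simp add: pmf.map_comp o_def)
    also have "\<dots> = J"
      unfolding law by (simp add: map_bind_pmf pmf.map_comp o_def bind_return_pmf')
    finally show ?thesis .
  qed
  have BC: "map_pmf (\<lambda>s. (B s, C s)) S = bind_pmf (map_pmf B S) (\<lambda>b. map_pmf (\<lambda>c. (b, c)) (k b))"
  proof -
    have "map_pmf (\<lambda>s. (B s, C s)) S = map_pmf (\<lambda>(ab, c). (snd ab, c)) (map_pmf (\<lambda>s. ((A s, B s), C s)) S)"
      by (simp add: pmf.map_comp o_def)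
    also have "\<dots> = bind_pmf (map_pmf snd J) (\<lambda>b. map_pmf (\<lambda>c. (b, c)) (k b))"
      unfolding law by (simp add: map_bind_pmf bind_map_pmf pmf.map_comp o_def)
    also have "map_pmf snd J = map_pmf B S" unfolding J[symmetric] by (simp add: pmf.map_comp o_def)
    finally show ?thesis .
  qed
  have abc: "measure_pmf.prob S {s. A s = a \<and> C s = c \<and> B s = b} = measure_pmf.prob S {s. A s = a \<and> B s = b} * pmf (k b) c" for a b c
  proof -
    have "measure_pmf.prob S {s. A s = a \<and> C s = c \<and> B s = b} = pmf (map_pmf (\<lambda>s. ((A s, B s), C s)) S) ((a, b), c)"
      by (auto simp: pmf_map vimage_def intro!: arg_cong[where f = "measure_pmf.prob S"])
    also have "\<dots> = pmf J (a, b) * pmf (k b) c" unfolding law by (simp add: pmf_bind_Pair)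
    finally show ?thesis unfolding J[symmetric] by (simp add: pmf_map vimage_def)
  qed
  have bc: "measure_pmf.prob S {s. C s = c \<and> B s = b} = measure_pmf.prob S {s. B s = b} * pmf (k b) c" for b c
  proof -
    have "measure_pmf.prob S {s. C s = c \<and> B s = b} = pmf (map_pmf (\<lambda>s. (B s, C s)) S) (b, c)"
      by (auto simp: pmf_map vimage_def intro!: arg_cong[where f = "measure_pmf.prob S"])
    also have "\<dots> = pmf (map_pmf B S) b * pmf (k b) c" unfolding BC by (simp add: pmf_bind_Pair)
    finally show ?thesis by (simp add: pmf_map vimage_def)
  qed
  show ?thesis unfolding markov_chain_def cond_prob_def
    by (simp add: abc bc)
qed

text \<open>By linearity only the law of each single guess enters, so the guesses at other times
  integrate out and the adversary faces \<open>n\<close> separate problems with growing side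
  information.\<close>

lemma expected_payoff_eq:
  fixes PW :: "'x \<Rightarrow> 'y2 \<Rightarrow> 'y3 \<Rightarrow> 'w::finite pmf" and adv :: "('w, 'z::finite) adversary"
  assumes fin: "finite (set_pmf S)"
  shows "expected_payoff n PW \<pi> S adv = (\<Sum>t<n. pexp S (\<lambda>s.
     pexp (Pi_pmf {..<n} undefined (\<lambda>t. PW (source s ! t) (act2 s ! t) (act3 s ! t))) (\<lambda>w.
     pexp (adv t (msg1 s) (msg2 s) (map w [0..<t])) (\<pi> (source s ! t) (act2 s ! t) (act3 s ! t))))) / real n"
proof -
  let ?W = "\<lambda>s. indep_list_pmf (map (\<lambda>t. PW (source s ! t) (act2 s ! t) (act3 s ! t)) [0..<n])"
  let ?V = "\<lambda>s. Pi_pmf {..<n} undefined (\<lambda>t. PW (source s ! t) (act2 s ! t) (act3 s ! t))"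
  let ?Z = "\<lambda>s w. indep_list_pmf (map (\<lambda>t. adv t (msg1 s) (msg2 s) (take t w)) [0..<n])"
  have finW: "finite (set_pmf (?W s))" and finZ: "finite (set_pmf (?Z s w))" and finV: "finite (set_pmf (?V s))" for s w
    by (auto intro!: finite_indep_list_pmf finite_set_Pi_pmf)
  have Z: "pexp (?Z s w) (\<lambda>z. \<pi> x y y' (z ! t)) = pexp (adv t (msg1 s) (msg2 s) (take t w)) (\<pi> x y y')"
    if "t < n" for s w t x y y'
  proof -
    have "pexp (?Z s w) (\<lambda>z. \<pi> x y y' (z ! t)) = pexp (map_pmf (\<lambda>z. z ! t) (?Z s w)) (\<pi> x y y')" by simp
    then show ?thesis by (simp only: map_nth_indep_list_pmf[OF that])
  qed
  have "expected_payoff n PW \<pi> S adv = pexp S (\<lambda>s. pexp (?W s) (\<lambda>w. pexp (?Z s w) (\<lambda>z.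
      (1 / real n) * (\<Sum>t<n. \<pi> (source s ! t) (act2 s ! t) (act3 s ! t) (z ! t)))))"
    unfolding expected_payoff_def attacked_system_def
    by (simp add: pexp_bind fin finW finZ)
  also have "\<dots> = pexp S (\<lambda>s. pexp (?W s) (\<lambda>w. (1 / real n) *
      (\<Sum>t<n. pexp (adv t (msg1 s) (msg2 s) (take t w)) (\<pi> (source s ! t) (act2 s ! t) (act3 s ! t)))))"
    by (simp add: pexp_sum[OF finZ] Z)
  also have "\<dots> = pexp S (\<lambda>s. pexp (?V s) (\<lambda>w. (1 / real n) *
      (\<Sum>t<n. pexp (adv t (msg1 s) (msg2 s) (map w [0..<t])) (\<pi> (source s ! t) (act2 s ! t) (act3 s ! t)))))"
    by (simp add: indep_list_pmf_upt[where d = undefined] take_map take_upt cong: sum.cong_simp)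
  also have "\<dots> = (\<Sum>t<n. pexp S (\<lambda>s. pexp (?V s) (\<lambda>w.
     pexp (adv t (msg1 s) (msg2 s) (map w [0..<t])) (\<pi> (source s ! t) (act2 s ! t) (act3 s ! t))))) / real n"
    by (simp add: pexp_sum[OF fin] pexp_sum[OF finV])
  finally show ?thesis .
qed

lemma pexp_pmf_of_set: "finite A \<Longrightarrow> A \<noteq> {} \<Longrightarrow> pexp (pmf_of_set A) f = (\<Sum>x\<in>A. f x) / card A"
  by (simp add: integral_pmf_of_set)

text \<open>One letter of the reversed experiment: the codeword letters come first, and the source
  letter is produced from \<open>v\<^sub>1\<close> like an output. Source and actions use separate
  randomness, as the Markov chains for \<open>Y\<^sub>2\<close> and \<open>Y\<^sub>3\<close>
  prescribe.\<close>

definition letter_out ::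
  "('d \<Rightarrow> 'x pmf) \<Rightarrow> ('d \<Rightarrow> 'y2 pmf) \<Rightarrow> ('b \<Rightarrow> 'y3 pmf) \<Rightarrow> ('x \<Rightarrow> 'y2 \<Rightarrow> 'y3 \<Rightarrow> 'w pmf)
    \<Rightarrow> 'b \<times> 'd \<Rightarrow> ('x \<times> 'y2 \<times> 'y3 \<times> 'w) pmf" where
  "letter_out chX chY2 chY3 PW = (\<lambda>(b, d). do {
     x \<leftarrow> chX d; y2 \<leftarrow> chY2 d; y3 \<leftarrow> chY3 b; w \<leftarrow> PW x y2 y3; return_pmf (x, y2, y3, w)})"

text \<open>Both views have the same type, with \<open>None\<close> hiding the letters, so that a
  product of channels can switch from one to the other at a single time.\<close>

definition see_side :: "'x \<times> 'y2 \<times> 'y3 \<times> 'w \<Rightarrow> 'w \<times> ('x \<times> 'y2 \<times> 'y3) option" where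
  "see_side = (\<lambda>(x, y2, y3, w). (w, None))"
definition see_all :: "'x \<times> 'y2 \<times> 'y3 \<times> 'w \<Rightarrow> 'w \<times> ('x \<times> 'y2 \<times> 'y3) option" where
  "see_all = (\<lambda>(x, y2, y3, w). (w, Some (x, y2, y3)))"

text \<open>Everything here concerns one fixed codebook \<open>\<omega>\<close>. The map
  \<open>e\<close> numbers the pairs \<open>(i, j)\<close> within the message set of node 1, and
  \<open>kBD\<close> is the law of the letters that depend on the key, given those that the
  adversary knows.\<close>

locale cascade_code =
  fixes n :: nat and I J K :: "nat set" and e :: "nat \<times> nat \<Rightarrow> nat"
    and PX :: "'x::finite pmf"
    and chX :: "'d::finite \<Rightarrow> 'x pmf" and chY2 :: "'d \<Rightarrow> 'y2::finite pmf" and chY3 :: "'b::finite \<Rightarrow> 'y3::finite pmf"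
    and PW :: "'x \<Rightarrow> 'y2 \<Rightarrow> 'y3 \<Rightarrow> 'w::finite pmf"
    and kBD :: "'a::finite \<times> 'c::finite \<Rightarrow> ('b \<times> 'd) pmf"
    and \<pi> :: "'x \<Rightarrow> 'y2 \<Rightarrow> 'y3 \<Rightarrow> 'z::finite \<Rightarrow> real" and \<beta> :: real
    and \<omega> :: "nat \<Rightarrow> ('a, 'b, 'c, 'd) letter_code"
  assumes fin: "finite I" "finite J" "finite K" and ne: "I \<noteq> {}" "J \<noteq> {}" "K \<noteq> {}"
    and inj_e: "inj_on e (I \<times> J)"
    and \<beta>: "\<bar>\<pi> x y2 y3 z\<bar> \<le> \<beta>"
begin

abbreviation "word p \<equiv> Pi_pmf {..<n} undefined p"
abbreviation "words \<equiv> PiE_dflt {..<n} undefined (\<lambda>_. UNIV)"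

definition dist_X :: "nat \<Rightarrow> nat \<times> nat \<Rightarrow> (nat \<Rightarrow> 'x) pmf" where
  "dist_X k m = word (\<lambda>t. chX (let_d (fst m) (snd m) k (\<omega> t)))"
definition dist_Y2 :: "nat \<Rightarrow> nat \<times> nat \<Rightarrow> (nat \<Rightarrow> 'y2) pmf" where
  "dist_Y2 k m = word (\<lambda>t. chY2 (let_d (fst m) (snd m) k (\<omega> t)))"
definition dist_Y3 :: "nat \<Rightarrow> nat \<Rightarrow> (nat \<Rightarrow> 'y3) pmf" where
  "dist_Y3 k i = word (\<lambda>t. chY3 (let_b i k (\<omega> t)))"

definition ideal :: "nat \<Rightarrow> ((nat \<times> nat) \<times> (nat \<Rightarrow> 'x)) pmf" where
  "ideal k = do {m \<leftarrow> pmf_of_set (I \<times> J); x \<leftarrow> dist_X k m; return_pmf (m, x)}"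

definition enc :: "nat \<Rightarrow> (nat \<Rightarrow> 'x) \<Rightarrow> (nat \<times> nat) pmf" where
  "enc k = reg_cond (ideal k) fst snd"

definition system :: "('x, 'y2, 'y3) comm_outcome pmf" where
  "system = do {
     k \<leftarrow> pmf_of_set K;
     x \<leftarrow> word (\<lambda>_. PX);
     m \<leftarrow> enc k x;
     y2 \<leftarrow> dist_Y2 k m;
     y3 \<leftarrow> dist_Y3 k (fst m);
     return_pmf \<lparr>source = map x [0..<n], key = k, msg1 = e m, msg2 = fst m,
       act2 = map y2 [0..<n], act3 = map y3 [0..<n]\<rparr>}"

lemma finIJ: "finite (I \<times> J)" "I \<times> J \<noteq> {}"
  using fin ne by auto

lemma finite_word:
  fixes p :: "nat \<Rightarrow> 'q::finite pmf"
  shows "finite (set_pmf (word p))"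
  by (auto intro!: finite_set_Pi_pmf)

lemma finite_dists:
  "finite (set_pmf (dist_X k m))" "finite (set_pmf (dist_Y2 k m))" "finite (set_pmf (dist_Y3 k i))"
  unfolding dist_X_def dist_Y2_def dist_Y3_def by (rule finite_word)+

lemma set_enc: "set_pmf (enc k x) \<subseteq> I \<times> J"
proof -
  have "set_pmf (enc k x) \<subseteq> fst ` set_pmf (ideal k)" unfolding enc_def by (rule set_reg_cond)
  also have "\<dots> \<subseteq> I \<times> J" unfolding ideal_def using finIJ by auto
  finally show ?thesis .
qed

lemma finite_enc: "finite (set_pmf (enc k x))"
  using finite_subset[OF set_enc finIJ(1)] .

lemma finite_system: "finite (set_pmf system)"
  unfolding system_def using fin ne
  by (auto intro!: finite_UN_I finite_word finite_enc finite_dists)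

lemma valid_system:
  assumes K: "K = message_set n R0" and e: "e ` (I \<times> J) \<subseteq> message_set n R1" and I: "I \<subseteq> message_set n R2"
  shows "valid_system n R0 R1 R2 PX system"
  unfolding valid_system_def
proof (intro conjI ballI)
  show "message_set n R0 \<noteq> {}" using K ne by simp
  have "map_pmf (\<lambda>s. (source s, key s)) system = do {
     k \<leftarrow> pmf_of_set K; x \<leftarrow> word (\<lambda>_. PX); return_pmf (map x [0..<n], k)}"
    unfolding system_def by (simp add: map_bind_pmf)
  also have "\<dots> = do {x \<leftarrow> word (\<lambda>_. PX); k \<leftarrow> pmf_of_set K; return_pmf (map x [0..<n], k)}"
    by (rule bind_commute_pmf)
  finally show "map_pmf (\<lambda>s. (source s, key s)) system =
      pair_pmf (replicate_pmf n PX) (pmf_of_set (message_set n R0))"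
    by (simp add: pair_pmf_def replicate_pmf_eq_Pi_pmf[where d = undefined] bind_map_pmf K)
next
  fix s assume s: "s \<in> set_pmf system"
  then obtain m where m: "m \<in> I \<times> J" "msg1 s = e m" "msg2 s = fst m" "length (act2 s) = n" "length (act3 s) = n"
    unfolding system_def using set_enc by fastforce
  show "msg1 s \<in> message_set n R1" "msg2 s \<in> message_set n R2" "length (act2 s) = n" "length (act3 s) = n"
    using m e I by auto
next
  \<comment> \<open>Node 2 sees only the number \<open>e m\<close>. Since \<open>e\<close> is
    injective on \<open>I \<times> J\<close>, where the encoder's output lies, \<open>(i, j)\<close>
    can be recovered, and the kernel reads nothing but message and key.\<close>
  define dec where "dec = inv_into (I \<times> J) e"
  have dec: "dec (e m) = m" if "m \<in> set_pmf (enc k x)" for m k x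
    unfolding dec_def using inj_e set_enc that by (intro inv_into_f_f) auto
  let ?J = "do {k \<leftarrow> pmf_of_set K; x \<leftarrow> word (\<lambda>_. PX); m \<leftarrow> enc k x; return_pmf (map x [0..<n], (e m, k))}"
  let ?k = "\<lambda>(m1, k). do {y2 \<leftarrow> dist_Y2 k (dec m1); return_pmf (fst (dec m1), map y2 [0..<n])}"
  have "map_pmf (\<lambda>s. ((source s, (msg1 s, key s)), (msg2 s, act2 s))) system = do {
     k \<leftarrow> pmf_of_set K; x \<leftarrow> word (\<lambda>_. PX); m \<leftarrow> enc k x; y2 \<leftarrow> dist_Y2 k m;
     return_pmf ((map x [0..<n], (e m, k)), (fst m, map y2 [0..<n]))}"
    unfolding system_def by (simp add: map_bind_pmf)
  also have "\<dots> = bind_pmf ?J (\<lambda>ab. map_pmf (\<lambda>c. (ab, c)) (?k (snd ab)))"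
    by (simp add: bind_assoc_pmf bind_return_pmf map_bind_pmf dec cong: bind_pmf_cong_simp)
  finally show "markov_chain system source (\<lambda>s. (msg1 s, key s)) (\<lambda>s. (msg2 s, act2 s))"
    by (rule markov_chainI)
  let ?J = "do {k \<leftarrow> pmf_of_set K; x \<leftarrow> word (\<lambda>_. PX); m \<leftarrow> enc k x; y2 \<leftarrow> dist_Y2 k m;
     return_pmf ((map x [0..<n], e m, map y2 [0..<n]), (fst m, k))}"
  let ?k = "\<lambda>(m2, k). do {y3 \<leftarrow> dist_Y3 k m2; return_pmf (map y3 [0..<n])}"
  have "map_pmf (\<lambda>s. (((source s, msg1 s, act2 s), (msg2 s, key s)), act3 s)) system
      = bind_pmf ?J (\<lambda>ab. map_pmf (\<lambda>c. (ab, c)) (?k (snd ab)))"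
    unfolding system_def by (simp add: bind_assoc_pmf bind_return_pmf map_bind_pmf)
  then show "markov_chain system (\<lambda>s. (source s, msg1 s, act2 s)) (\<lambda>s. (msg2 s, key s)) act3"
    by (rule markov_chainI)
qed

section \<open>Payoff of a fixed codebook against an arbitrary adversary\<close>

definition out :: "'b \<times> 'd \<Rightarrow> ('x \<times> 'y2 \<times> 'y3 \<times> 'w) pmf" where
  "out = letter_out chX chY2 chY3 PW"

definition obs :: "nat \<Rightarrow> nat \<Rightarrow> 'b \<times> 'd \<Rightarrow> ('w \<times> ('x \<times> 'y2 \<times> 'y3) option) pmf" where
  "obs t0 t = (if t = t0 then (\<lambda>c. map_pmf see_all (out c)) else (\<lambda>c. map_pmf see_side (out c)))"

definition guess :: "'a \<times> 'c \<Rightarrow> real" where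
  "guess s = (MIN z. pexp (bind_pmf (kBD s) out) (\<lambda>(x, y2, y3, w). \<pi> x y2 y3 z))"

definition dist_obs :: "nat \<Rightarrow> nat \<Rightarrow> nat \<times> nat \<Rightarrow> (nat \<Rightarrow> 'w \<times> ('x \<times> 'y2 \<times> 'y3) option) pmf" where
  "dist_obs t0 k m = word (\<lambda>t. obs t0 t (let_b (fst m) k (\<omega> t), let_d (fst m) (snd m) k (\<omega> t)))"
definition target_obs :: "nat \<Rightarrow> nat \<times> nat \<Rightarrow> (nat \<Rightarrow> 'w \<times> ('x \<times> 'y2 \<times> 'y3) option) pmf" where
  "target_obs t0 m = word (\<lambda>t. bind_pmf (kBD (let_a (fst m) (\<omega> t), let_c (fst m) (snd m) (\<omega> t))) (obs t0 t))"

text \<open>Measures what the observations reveal beyond the public words of \<open>m\<close>: the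
  distance between their law under a uniform key and the memoryless law in which every letter has
  its own fresh \<open>(v\<^sub>2, v\<^sub>1)\<close> given the public letters.\<close>

definition leak :: "nat \<Rightarrow> nat \<times> nat \<Rightarrow> real" where
  "leak t0 m = cover_err n undefined K
     (\<lambda>k t. obs t0 t (let_b (fst m) k (\<omega> t), let_d (fst m) (snd m) k (\<omega> t)))
     (\<lambda>t. bind_pmf (kBD (let_a (fst m) (\<omega> t), let_c (fst m) (snd m) (\<omega> t))) (obs t0 t))"
definition source_err :: "nat \<Rightarrow> real" where
  "source_err k = (\<Sum>x\<in>words. \<bar>pmf (word (\<lambda>_. PX)) x - (\<Sum>m\<in>I \<times> J. pmf (dist_X k m) x) / card (I \<times> J)\<bar>)"

lemma \<beta>_nonneg: "0 \<le> \<beta>"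
  using \<beta>[of undefined undefined undefined undefined] by linarith

lemma finite_words: "finite (words :: (nat \<Rightarrow> 'q::finite) set)"
  by auto

lemma set_word: "set_pmf (word p) \<subseteq> words"
  by (rule set_Pi_pmf_subset_UNIV) simp

text \<open>If the source had the output law of \<open>ideal k\<close>, the posterior encoder would
  restore the joint law, with a uniform message pair and a source drawn from its codeword.\<close>

lemma pexp_ideal_source:
  "pexp (map_pmf snd (ideal k)) (\<lambda>x. pexp (enc k x) (F x)) = pexp (pmf_of_set (I \<times> J)) (\<lambda>m. pexp (dist_X k m) (\<lambda>x. F x m))"
proof -
  have fin_ideal: "finite (set_pmf (ideal k))"
    unfolding ideal_def using finIJ by (auto intro!: finite_UN_I finite_dists)
  have "pexp (map_pmf snd (ideal k)) (\<lambda>x. pexp (enc k x) (F x))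
    = pexp (bind_pmf (map_pmf snd (ideal k)) (\<lambda>x. map_pmf (\<lambda>m. (x, m)) (enc k x))) (\<lambda>(x, m). F x m)"
    using fin_ideal finite_enc by (subst pexp_bind) auto
  also have "\<dots> = pexp (ideal k) (\<lambda>(m, x). F x m)"
    unfolding enc_def bind_reg_cond by (simp add: case_prod_unfold)
  also have "\<dots> = pexp (pmf_of_set (I \<times> J)) (\<lambda>m. pexp (dist_X k m) (\<lambda>x. F x m))"
    unfolding ideal_def using finIJ by (simp add: pexp_bind finite_dists)
  finally show ?thesis .
qed

lemma ideal_source: "map_pmf snd (ideal k) = bind_pmf (pmf_of_set (I \<times> J)) (dist_X k)"
  unfolding ideal_def by (simp add: map_bind_pmf bind_return_pmf')

lemma pmf_ideal_source: "pmf (map_pmf snd (ideal k)) x = (\<Sum>m\<in>I \<times> J. pmf (dist_X k m) x) / card (I \<times> J)"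
  unfolding ideal_source pmf_bind by (rule pexp_pmf_of_set[OF finIJ])

lemma set_ideal_source: "set_pmf (map_pmf snd (ideal k)) \<subseteq> words"
proof -
  have "set_pmf (dist_X k m) \<subseteq> words" for m unfolding dist_X_def by (rule set_word)
  then show ?thesis unfolding ideal_source set_bind_pmf by (intro UN_least)
qed

text \<open>Under the target the letters are independent, so past side information says nothing
  about time \<open>t0\<close>. Once it is fixed, a randomized guess is an average over
  \<open>z\<close> and cannot push the payoff below the minimum. The \<open>None\<close> branch
  never occurs, as \<open>obs\<close> shows everything at \<open>t0\<close>.\<close>

lemma pexp_target_ge:
  fixes f :: "'w list \<Rightarrow> 'z pmf"
  assumes t0: "t0 < n"
  shows "pexp (target_obs t0 m) (\<lambda>q. case snd (q t0) of None \<Rightarrow> 0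
      | Some (x, y2, y3) \<Rightarrow> pexp (f (map (fst \<circ> q) [0..<t0])) (\<pi> x y2 y3))
    \<ge> guess (let_a (fst m) (\<omega> t0), let_c (fst m) (snd m) (\<omega> t0))"
proof -
  let ?s = "(let_a (fst m) (\<omega> t0), let_c (fst m) (snd m) (\<omega> t0))"
  let ?p = "\<lambda>t. bind_pmf (kBD (let_a (fst m) (\<omega> t), let_c (fst m) (snd m) (\<omega> t))) (obs t0 t)"
  let ?R = "Pi_pmf ({..<n} - {t0}) undefined ?p"
  let ?\<Phi> = "\<lambda>q :: nat \<Rightarrow> 'w \<times> ('x \<times> 'y2 \<times> 'y3) option. case snd (q t0) of None \<Rightarrow> 0
      | Some (x, y2, y3) \<Rightarrow> pexp (f (map (fst \<circ> q) [0..<t0])) (\<pi> x y2 y3)"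
  have ins: "{..<n} = insert t0 ({..<n} - {t0})" using t0 by auto
  have finR: "finite (set_pmf ?R)" by (auto intro!: finite_set_Pi_pmf)
  have "target_obs t0 m = do {y \<leftarrow> ?p t0; q \<leftarrow> ?R; return_pmf (q(t0 := y))}"
    unfolding target_obs_def by (subst ins, subst Pi_pmf_insert') auto
  then have "pexp (target_obs t0 m) ?\<Phi> = pexp (?p t0) (\<lambda>y. pexp ?R (\<lambda>q. ?\<Phi> (q(t0 := y))))"
    by (simp add: pexp_bind finR)
  \<comment> \<open>The other letters are moved to the outer expectation, so that the adversary's
    law of guesses is constant in the inner one.\<close>
  also have "\<dots> = pexp ?R (\<lambda>q. pexp (?p t0) (\<lambda>y. ?\<Phi> (q(t0 := y))))"
    by (intro pexp_commute finR) simp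
  also have "\<dots> \<ge> guess ?s"
  proof (rule pexp_ge_const[OF finR])
    fix q :: "nat \<Rightarrow> 'w \<times> ('x \<times> 'y2 \<times> 'y3) option"
    define wl where "wl = map (fst \<circ> q) [0..<t0]"
    have "map (fst \<circ> q(t0 := y)) [0..<t0] = wl" for y by (auto simp: wl_def)
    then have "pexp (?p t0) (\<lambda>y. ?\<Phi> (q(t0 := y))) = pexp (?p t0) (\<lambda>y. case snd y of None \<Rightarrow> 0
      | Some (x, y2, y3) \<Rightarrow> pexp (f wl) (\<pi> x y2 y3))" by (simp cong: option.case_cong)
    also have p_t0: "?p t0 = map_pmf see_all (bind_pmf (kBD ?s) out)"
      by (simp add: obs_def map_bind_pmf)
    also have "pexp \<dots> (\<lambda>y. case snd y of None \<Rightarrow> 0 | Some (x, y2, y3) \<Rightarrow> pexp (f wl) (\<pi> x y2 y3))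
      = pexp (bind_pmf (kBD ?s) out) (\<lambda>y. pexp (f wl) (\<lambda>z. case y of (x, y2, y3, w) \<Rightarrow> \<pi> x y2 y3 z))"
      by (simp add: see_all_def case_prod_beta)
    also have "\<dots> = pexp (f wl) (\<lambda>z. pexp (bind_pmf (kBD ?s) out) (\<lambda>(x, y2, y3, w). \<pi> x y2 y3 z))"
      by (intro pexp_commute) auto
    also have "\<dots> \<ge> guess ?s"
      unfolding guess_def by (rule pexp_ge_const) (auto intro!: Min_le)
    finally show "guess ?s \<le> pexp (?p t0) (\<lambda>y. ?\<Phi> (q(t0 := y)))" by (simp only: p_t0)
  qed
  finally show ?thesis .
qed

text \<open>The payoff at \<open>t0\<close> reads the letters at \<open>t0\<close> and the side
  information before it, and \<open>obs\<close> keeps both. Hence, for given key and messages, the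
  observations can stand in for the words \<open>x\<close>, \<open>y2\<close>, \<open>y3\<close> and
  \<open>w\<close>.\<close>

lemma pexp_dist_obs:
  assumes t0: "t0 < n"
  shows "pexp (dist_obs t0 k m) (\<lambda>q. case snd (q t0) of None \<Rightarrow> 0 | Some (x, y2, y3) \<Rightarrow> F x y2 y3 (map (fst \<circ> q) [0..<t0]))
    = pexp (dist_X k m) (\<lambda>x. pexp (dist_Y2 k m) (\<lambda>y2. pexp (dist_Y3 k (fst m)) (\<lambda>y3.
        pexp (word (\<lambda>t. PW (x t) (y2 t) (y3 t))) (\<lambda>w. F (x t0) (y2 t0) (y3 t0) (map w [0..<t0])))))"
proof -
  let ?b = "\<lambda>t. let_b (fst m) k (\<omega> t)" and ?d = "\<lambda>t. let_d (fst m) (snd m) k (\<omega> t)"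
  let ?g = "\<lambda>t. if t = t0 then see_all else see_side"
  define G :: "(nat \<Rightarrow> 'x) \<Rightarrow> (nat \<Rightarrow> 'y2) \<Rightarrow> (nat \<Rightarrow> 'y3) \<Rightarrow> (nat \<Rightarrow> 'w) \<Rightarrow> nat \<Rightarrow> 'w \<times> ('x \<times> 'y2 \<times> 'y3) option"
    where "G x y2 y3 w = (\<lambda>t. if t < n then ?g t (x t, y2 t, y3 t, w t) else undefined)" for x y2 y3 w
  have G: "snd (G x y2 y3 w t0) = Some (x t0, y2 t0, y3 t0)" "map (fst \<circ> G x y2 y3 w) [0..<t0] = map w [0..<t0]" for x y2 y3 w
    using t0 by (auto simp: G_def see_all_def see_side_def)
  have "obs t0 t (b, d) = do {x \<leftarrow> chX d; y2 \<leftarrow> chY2 d; y3 \<leftarrow> chY3 b; w \<leftarrow> PW x y2 y3; return_pmf (?g t (x, y2, y3, w))}" for t b d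
    by (simp add: obs_def out_def letter_out_def map_bind_pmf)
  then have "dist_obs t0 k m = word (\<lambda>t. do {x \<leftarrow> chX (?d t); y2 \<leftarrow> chY2 (?d t); y3 \<leftarrow> chY3 (?b t); w \<leftarrow> PW x y2 y3; return_pmf (?g t (x, y2, y3, w))})"
    unfolding dist_obs_def by simp
  also have "\<dots> = do {x \<leftarrow> dist_X k m; y2 \<leftarrow> dist_Y2 k m; y3 \<leftarrow> dist_Y3 k (fst m); w \<leftarrow> word (\<lambda>t. PW (x t) (y2 t) (y3 t));
      return_pmf (G x y2 y3 w)}"
    unfolding G_def dist_X_def dist_Y2_def dist_Y3_def
    by (subst Pi_pmf_bind[where d' = undefined], simp, subst Pi_pmf_bind[where d' = undefined], simp,
        subst Pi_pmf_bind[where d' = undefined], simp, subst Pi_pmf_bind[where d' = undefined], simp) simp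
  finally show ?thesis
    by (simp add: pexp_bind finite_dists finite_word G)
qed

text \<open>Two changes of law, both bounded uniformly in the adversary: the source is exchanged for
  the output of \<open>ideal k\<close>, then the observations for the memoryless target. Each costs
  \<open>\<beta>\<close> times an L1 distance.\<close>

lemma performance_ge:
  assumes n: "n \<ge> 1"
  shows "performance n PW \<pi> system \<ge>
    (\<Sum>t<n. pexp (pmf_of_set (I \<times> J)) (\<lambda>m. guess (let_a (fst m) (\<omega> t), let_c (fst m) (snd m) (\<omega> t)) - \<beta> * leak t m)) / real n
      - \<beta> * pexp (pmf_of_set K) source_err"
  unfolding performance_def
proof (rule cINF_greatest)
  fix adv :: "('w, 'z) adversary"
  define h where "h t m x y2 y3 w = pexp (adv t (e m) (fst m) w) (\<pi> x y2 y3)" for t m x y2 y3 w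
  define F where "F t k x m = pexp (dist_Y2 k m) (\<lambda>y2. pexp (dist_Y3 k (fst m)) (\<lambda>y3.
        pexp (word (\<lambda>t. PW (x t) (y2 t) (y3 t))) (\<lambda>w. h t m (x t) (y2 t) (y3 t) (map w [0..<t]))))" for t k x m
  have h: "\<bar>h t m x y2 y3 w\<bar> \<le> \<beta>" for t m x y2 y3 w
    unfolding h_def by (intro abs_pexp_le \<beta>) auto
  have F: "\<bar>F t k x m\<bar> \<le> \<beta>" for t k x m
    unfolding F_def by (intro abs_pexp_le h finite_dists finite_word)
  have sys: "pexp system G = pexp (pmf_of_set K) (\<lambda>k. pexp (word (\<lambda>_. PX)) (\<lambda>x. pexp (enc k x) (\<lambda>m.
     pexp (dist_Y2 k m) (\<lambda>y2. pexp (dist_Y3 k (fst m)) (\<lambda>y3. G \<lparr>source = map x [0..<n], key = k, msg1 = e m, msg2 = fst m,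
       act2 = map y2 [0..<n], act3 = map y3 [0..<n]\<rparr>)))))" for G
    unfolding system_def using fin ne
    by (simp add: pexp_bind finite_word finite_enc finite_dists)
  have step: "pexp system (\<lambda>s.
     pexp (word (\<lambda>t. PW (source s ! t) (act2 s ! t) (act3 s ! t))) (\<lambda>w.
     pexp (adv t (msg1 s) (msg2 s) (map w [0..<t])) (\<pi> (source s ! t) (act2 s ! t) (act3 s ! t))))
    \<ge> pexp (pmf_of_set (I \<times> J)) (\<lambda>m. guess (let_a (fst m) (\<omega> t), let_c (fst m) (snd m) (\<omega> t)) - \<beta> * leak t m)
      - \<beta> * pexp (pmf_of_set K) source_err" if t: "t < n" for t
  proof -
    have W: "word (\<lambda>s. PW (map x [0..<n] ! s) (map y2 [0..<n] ! s) (map y3 [0..<n] ! s)) = word (\<lambda>s. PW (x s) (y2 s) (y3 s))" for x y2 y3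
      by (intro Pi_pmf_cong) auto
    have "pexp system (\<lambda>s.
     pexp (word (\<lambda>t. PW (source s ! t) (act2 s ! t) (act3 s ! t))) (\<lambda>w.
     pexp (adv t (msg1 s) (msg2 s) (map w [0..<t])) (\<pi> (source s ! t) (act2 s ! t) (act3 s ! t))))
     = pexp (pmf_of_set K) (\<lambda>k. pexp (word (\<lambda>_. PX)) (\<lambda>x. pexp (enc k x) (F t k x)))"
      unfolding sys F_def[abs_def] h_def using t by (simp add: W)
    also have "\<dots> \<ge> pexp (pmf_of_set K) (\<lambda>k. pexp (pmf_of_set (I \<times> J)) (\<lambda>m. pexp (dist_X k m) (\<lambda>x. F t k x m)) - \<beta> * source_err k)"
    proof (intro pexp_mono)
      fix k
      have "pexp (map_pmf snd (ideal k)) (\<lambda>x. pexp (enc k x) (F t k x)) - \<beta> * source_err k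
        \<le> pexp (word (\<lambda>_. PX)) (\<lambda>x. pexp (enc k x) (F t k x))"
        unfolding source_err_def pmf_ideal_source[symmetric]
        by (intro pexp_diff_le_L1 finite_words set_word set_ideal_source abs_pexp_le finite_enc F)
      then show "pexp (pmf_of_set (I \<times> J)) (\<lambda>m. pexp (dist_X k m) (\<lambda>x. F t k x m)) - \<beta> * source_err k
        \<le> pexp (word (\<lambda>_. PX)) (\<lambda>x. pexp (enc k x) (F t k x))"
        unfolding pexp_ideal_source .
    qed (use fin ne in simp)
    \<comment> \<open>After the first change the message pair is uniform for every key. So the
      average over the key can be moved inside: given the messages the key is still uniform, as
      covering over \<open>k\<close> requires.\<close>
    also have "pexp (pmf_of_set K) (\<lambda>k. pexp (pmf_of_set (I \<times> J)) (\<lambda>m. pexp (dist_X k m) (\<lambda>x. F t k x m)) - \<beta> * source_err k)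
      = pexp (pmf_of_set (I \<times> J)) (\<lambda>m. pexp (pmf_of_set K) (\<lambda>k. pexp (dist_X k m) (\<lambda>x. F t k x m))) - \<beta> * pexp (pmf_of_set K) source_err"
      using fin ne finIJ by (simp add: pexp_diff) (rule pexp_commute; simp)
    finally have 1: "pexp (pmf_of_set (I \<times> J)) (\<lambda>m. pexp (pmf_of_set K) (\<lambda>k. pexp (dist_X k m) (\<lambda>x. F t k x m))) - \<beta> * pexp (pmf_of_set K) source_err
      \<le> pexp system (\<lambda>s.
     pexp (word (\<lambda>t. PW (source s ! t) (act2 s ! t) (act3 s ! t))) (\<lambda>w.
     pexp (adv t (msg1 s) (msg2 s) (map w [0..<t])) (\<pi> (source s ! t) (act2 s ! t) (act3 s ! t))))" .
    have 2: "pexp (pmf_of_set (I \<times> J)) (\<lambda>m. pexp (pmf_of_set K) (\<lambda>k. pexp (dist_X k m) (\<lambda>x. F t k x m)))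
      \<ge> pexp (pmf_of_set (I \<times> J)) (\<lambda>m. guess (let_a (fst m) (\<omega> t), let_c (fst m) (snd m) (\<omega> t)) - \<beta> * leak t m)"
    proof (intro pexp_mono)
      fix m
      define \<Phi> where "\<Phi> = (\<lambda>q :: nat \<Rightarrow> 'w \<times> ('x \<times> 'y2 \<times> 'y3) option. case snd (q t) of None \<Rightarrow> 0
         | Some (x, y2, y3) \<Rightarrow> h t m x y2 y3 (map (fst \<circ> q) [0..<t]))"
      have \<Phi>: "\<bar>\<Phi> q\<bar> \<le> \<beta>" for q
        using h \<beta>_nonneg by (auto simp: \<Phi>_def split: option.split)
      have "pexp (pmf_of_set K) (\<lambda>k. pexp (dist_X k m) (\<lambda>x. F t k x m)) = pexp (pmf_of_set K) (\<lambda>k. pexp (dist_obs t k m) \<Phi>)"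
        unfolding \<Phi>_def pexp_dist_obs[OF t] F_def ..
      also have "\<dots> = pexp (bind_pmf (pmf_of_set K) (\<lambda>k. dist_obs t k m)) \<Phi>"
        using fin ne unfolding dist_obs_def by (intro pexp_bind[symmetric]) (simp_all add: finite_word)
      also have "\<dots> \<ge> pexp (target_obs t m) \<Phi> - \<beta> * leak t m"
      proof -
        have "leak t m = (\<Sum>x\<in>words. \<bar>pmf (bind_pmf (pmf_of_set K) (\<lambda>k. dist_obs t k m)) x - pmf (target_obs t m) x\<bar>)"
          unfolding leak_def cover_err_def dist_obs_def target_obs_def pmf_bind
          using fin ne by (simp add: pexp_pmf_of_set)
        moreover have "set_pmf (bind_pmf (pmf_of_set K) (\<lambda>k. dist_obs t k m)) \<subseteq> words"
          unfolding set_bind_pmf dist_obs_def by (intro UN_least set_word)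
        ultimately show ?thesis
          unfolding target_obs_def by (simp only:) (intro pexp_diff_le_L1 finite_words set_word \<Phi>; assumption)
      qed
      finally have "pexp (target_obs t m) \<Phi> - \<beta> * leak t m
         \<le> pexp (pmf_of_set K) (\<lambda>k. pexp (dist_X k m) (\<lambda>x. F t k x m))" .
      moreover have "pexp (target_obs t m) \<Phi> \<ge> guess (let_a (fst m) (\<omega> t), let_c (fst m) (snd m) (\<omega> t))"
        unfolding \<Phi>_def h_def by (rule pexp_target_ge[OF t])
      ultimately show "guess (let_a (fst m) (\<omega> t), let_c (fst m) (snd m) (\<omega> t)) - \<beta> * leak t m
         \<le> pexp (pmf_of_set K) (\<lambda>k. pexp (dist_X k m) (\<lambda>x. F t k x m))" by simp
    qed (use finIJ in simp)
    show ?thesis using 1 2 by linarith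
  qed
  have "(\<Sum>t<n. pexp (pmf_of_set (I \<times> J)) (\<lambda>m. guess (let_a (fst m) (\<omega> t), let_c (fst m) (snd m) (\<omega> t)) - \<beta> * leak t m)) / real n
      - \<beta> * pexp (pmf_of_set K) source_err
    = (\<Sum>t<n. pexp (pmf_of_set (I \<times> J)) (\<lambda>m. guess (let_a (fst m) (\<omega> t), let_c (fst m) (snd m) (\<omega> t)) - \<beta> * leak t m)
      - \<beta> * pexp (pmf_of_set K) source_err) / real n"
    using n by (simp add: sum_subtractf diff_divide_distrib)
  also have "\<dots> \<le> expected_payoff n PW \<pi> system adv"
    unfolding expected_payoff_eq[OF finite_system] by (intro divide_right_mono sum_mono step) auto
  finally show "(\<Sum>t<n. pexp (pmf_of_set (I \<times> J)) (\<lambda>m. guess (let_a (fst m) (\<omega> t), let_c (fst m) (snd m) (\<omega> t)) - \<beta> * leak t m)) / real n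
      - \<beta> * pexp (pmf_of_set K) source_err \<le> expected_payoff n PW \<pi> system adv" .
qed simp

end

section \<open>Random coding\<close>

text \<open>The alternative with rate 0 has to be kept, because the later perturbation cannot create
  slack when the information is 0.\<close>

lemma soft_covering_rate:
  fixes pS :: "'s::finite pmf" and k :: "'s \<Rightarrow> 'c::finite pmf" and ch :: "'c \<Rightarrow> 'o::finite pmf"
  assumes R: "ratio_info pS k ch < R \<or> ratio_info pS k ch = 0 \<and> R = 0"
  obtains e where "e \<longlonglongrightarrow> 0"
    "\<forall>n (Q :: 'l pmf) S (C :: 'i \<Rightarrow> 'l \<Rightarrow> 'c) I dL dC dO.
      0 < n \<longrightarrow> cond_codewords Q S C I pS k \<longrightarrow> (\<forall>i\<in>I. C i dL = dC) \<longrightarrow> 2 powr (real n * R) / 2 \<le> card I \<longrightarrow>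
      pexp (Pi_pmf {..<n} dL (\<lambda>_. Q)) (\<lambda>\<omega>. cover_err n dO I
        (\<lambda>i t. ch (C i (\<omega> t))) (\<lambda>t. bind_pmf (k (S (\<omega> t))) ch)) \<le> e n"
  using R
proof
  assume "ratio_info pS k ch < R"
  then obtain e where "e \<longlonglongrightarrow> 0" and e: "\<forall>n t0 (Q :: 'l pmf) S (C :: 'i \<Rightarrow> 'l \<Rightarrow> 'c) I dL dC dO.
      t0 < n \<longrightarrow> cond_codewords Q S C I pS k \<longrightarrow> (\<forall>i\<in>I. C i dL = dC) \<longrightarrow> 2 powr (real n * R) / 2 \<le> card I \<longrightarrow>
      pexp (Pi_pmf {..<n} dL (\<lambda>_. Q)) (\<lambda>\<omega>. cover_err n dO I
        (\<lambda>i t. (if t = t0 then ch else ch) (C i (\<omega> t)))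
        (\<lambda>t. bind_pmf (k (S (\<omega> t))) (if t = t0 then ch else ch))) \<le> e n"
    by (rule soft_covering_vanishing[where ch' = ch])
  show ?thesis
  proof (rule that[OF \<open>e \<longlonglongrightarrow> 0\<close>], intro allI impI)
    fix n and Q :: "'l pmf" and S and C :: "'i \<Rightarrow> 'l \<Rightarrow> 'c" and I dL dC dO
    assume "0 < n" "cond_codewords Q S C I pS k" "\<forall>i\<in>I. C i dL = dC" "2 powr (real n * R) / 2 \<le> card I"
    with e[unfolded if_cancel, THEN spec, THEN spec[of _ 0]]
    show "pexp (Pi_pmf {..<n} dL (\<lambda>_. Q)) (\<lambda>\<omega>. cover_err n dO I
        (\<lambda>i t. ch (C i (\<omega> t))) (\<lambda>t. bind_pmf (k (S (\<omega> t))) ch)) \<le> e n" by blast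
  qed
next
  assume "ratio_info pS k ch = 0 \<and> R = 0"
  then have 0: "ratio_info pS k ch = 0" ..
  show ?thesis
  proof (rule that[OF tendsto_const], intro allI impI)
    fix n and Q :: "'l pmf" and S and C :: "'i \<Rightarrow> 'l \<Rightarrow> 'c" and I dL dO
    assume "cond_codewords Q S C I pS k"
    from soft_covering_words_zero[OF this 0]
    show "pexp (Pi_pmf {..<n} dL (\<lambda>_. Q)) (\<lambda>\<omega>. cover_err n dO I
        (\<lambda>i t. ch (C i (\<omega> t))) (\<lambda>t. bind_pmf (k (S (\<omega> t))) ch)) \<le> 0" by simp
  qed
qed

section \<open>Sizes of the message sets\<close>

lemma card_message_set: "card (message_set n R) = nat \<lfloor>2 powr (real n * R)\<rfloor>"
  by (simp add: message_set_def)

text \<open>Rounding down costs at most a factor 2, because the power is at least 1 for a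
  nonnegative rate.\<close>

lemma card_message_set_ge:
  assumes "0 \<le> R"
  shows "2 powr (real n * R) / 2 \<le> card (message_set n R)"
proof -
  have x: "1 \<le> 2 powr (real n * R)" using assms by (intro ge_one_powr_ge_zero) auto
  then have "1 \<le> \<lfloor>2 powr (real n * R)\<rfloor>" by simp
  then have "real (nat \<lfloor>2 powr (real n * R)\<rfloor>) = of_int \<lfloor>2 powr (real n * R)\<rfloor>" "1 \<le> (of_int \<lfloor>2 powr (real n * R)\<rfloor> :: real)"
    by simp_all
  then show ?thesis unfolding card_message_set using x by linarith
qed

lemma message_set_mono:
  assumes "R \<le> R'" shows "message_set n R \<subseteq> message_set n R'"
proof -
  have "2 powr (real n * R) \<le> 2 powr (real n * R')"
    using assms by (intro powr_mono mult_left_mono) auto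
  then show ?thesis unfolding message_set_def by (auto intro: order_trans[OF _ nat_mono[OF floor_mono]])
qed

text \<open>The product of the rounded sizes is an integer not above the real power, hence not above
  its floor. This is what lets the pairs \<open>(i, j)\<close> be numbered within the message set of
  node 1.\<close>

lemma card_message_set_mult_le:
  assumes "r + r' \<le> R"
  shows "card (message_set n r) * card (message_set n r') \<le> card (message_set n R)"
proof -
  let ?f = "\<lambda>r. 2 powr (real n * r)"
  have "real (card (message_set n r) * card (message_set n r')) \<le> ?f r * ?f r'"
    unfolding card_message_set of_nat_mult by (intro mult_mono) auto
  also have "\<dots> = ?f (r + r')" by (simp add: powr_add algebra_simps)
  also have "\<dots> \<le> ?f R" using assms by (intro powr_mono mult_left_mono) auto
  finally show ?thesis unfolding card_message_set by (simp add: le_nat_floor)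
qed

text \<open>The split \<open>r1 + r2 \<le> R1\<close> pays node 1 for the pair
  \<open>(i, j)\<close>, while node 2 pays for \<open>i\<close> alone. The average over codebooks is
  taken of the adversary-free bound \<open>L\<close>, so the codebook selected by it serves against
  all adversaries.\<close>

theorem superposition_coding:
  fixes pA :: "'a::finite pmf" and kB :: "'a \<Rightarrow> 'b::finite pmf" and kC :: "'a \<Rightarrow> 'c::finite pmf"
    and kD :: "'a \<Rightarrow> 'b \<Rightarrow> 'c \<Rightarrow> 'd::finite pmf"
    and chX :: "'d \<Rightarrow> 'x::finite pmf" and chY2 :: "'d \<Rightarrow> 'y2::finite pmf" and chY3 :: "'b \<Rightarrow> 'y3::finite pmf"
    and PW :: "'x \<Rightarrow> 'y2 \<Rightarrow> 'y3 \<Rightarrow> 'w::finite pmf" and \<pi> :: "'x \<Rightarrow> 'y2 \<Rightarrow> 'y3 \<Rightarrow> 'z::finite \<Rightarrow> real"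
  defines "qX \<equiv> \<lambda>s. bind_pmf (kAB_D kC kD s) chX"
    and "T \<equiv> letter_out chX chY2 chY3 PW"
  assumes PX: "bind_pmf (pAB pA kB) qX = PX"
    and info1: "ratio_info (pAB pA kB) (kAB_D kC kD) chX < r1 \<or> ratio_info (pAB pA kB) (kAB_D kC kD) chX = 0 \<and> r1 = 0"
    and info2: "ratio_info (return_pmf ()) (\<lambda>_. pAB pA kB) qX < r2 \<or> ratio_info (return_pmf ()) (\<lambda>_. pAB pA kB) qX = 0 \<and> r2 = 0"
    and info3: "ratio_info (pAB pA kC) (kAC_BD kB kD) (\<lambda>c. map_pmf see_side (T c)) < R0"
    and rates: "r1 + r2 \<le> R1" "r2 \<le> R2"
    and payoff: "payoff < pexp (pAB pA kC) (\<lambda>s. MIN z. pexp (bind_pmf (kAC_BD kB kD s) T) (\<lambda>(x, y2, y3, w). \<pi> x y2 y3 z))"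
  shows "(R0, R1, R2, payoff) \<in> achievable_region PX PW \<pi>"
proof -
  have R0: "0 \<le> R0" using info3 ratio_info_nonneg[of "pAB pA kC" "kAC_BD kB kD" "\<lambda>c. map_pmf see_side (T c)"] by linarith
  have r1: "0 \<le> r1" using info1 ratio_info_nonneg[of "pAB pA kB" "kAB_D kC kD" chX] by linarith
  have r2: "0 \<le> r2" using info2 ratio_info_nonneg[of "return_pmf ()" "\<lambda>_. pAB pA kB" qX] by linarith
  define G where "G = pexp (pAB pA kC) (\<lambda>s. MIN z. pexp (bind_pmf (kAC_BD kB kD s) T) (\<lambda>(x, y2, y3, w). \<pi> x y2 y3 z))"
  define \<beta> where "\<beta> = Max (range (\<lambda>(x, y2, y3, z). \<bar>\<pi> x y2 y3 z\<bar>))"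
  have \<beta>: "\<bar>\<pi> x y2 y3 z\<bar> \<le> \<beta>" for x y2 y3 z
    unfolding \<beta>_def by (intro Max_ge) (auto intro: image_eqI[of _ _ "(x, y2, y3, z)"])
  obtain e1 where e1: "e1 \<longlonglongrightarrow> 0" and b1: "\<forall>n (Q :: ('a, 'b, 'c, 'd) letter_code pmf) S (C :: nat \<Rightarrow> _) I dL dC dO.
      0 < n \<longrightarrow> cond_codewords Q S C I (pAB pA kB) (kAB_D kC kD) \<longrightarrow> (\<forall>i\<in>I. C i dL = dC) \<longrightarrow> 2 powr (real n * r1) / 2 \<le> card I \<longrightarrow>
      pexp (Pi_pmf {..<n} dL (\<lambda>_. Q)) (\<lambda>\<omega>. cover_err n dO I
        (\<lambda>i t. chX (C i (\<omega> t))) (\<lambda>t. bind_pmf (kAB_D kC kD (S (\<omega> t))) chX)) \<le> e1 n"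
    by (rule soft_covering_rate[OF info1])
  obtain e2 where e2: "e2 \<longlonglongrightarrow> 0" and b2: "\<forall>n (Q :: ('a, 'b, 'c, 'd) letter_code pmf) S (C :: nat \<Rightarrow> _) I dL dC dO.
      0 < n \<longrightarrow> cond_codewords Q S C I (return_pmf ()) (\<lambda>_. pAB pA kB) \<longrightarrow> (\<forall>i\<in>I. C i dL = dC) \<longrightarrow> 2 powr (real n * r2) / 2 \<le> card I \<longrightarrow>
      pexp (Pi_pmf {..<n} dL (\<lambda>_. Q)) (\<lambda>\<omega>. cover_err n dO I
        (\<lambda>i t. qX (C i (\<omega> t))) (\<lambda>t. bind_pmf (pAB pA kB) qX)) \<le> e2 n"
    by (rule soft_covering_rate[OF info2])
  let ?obs = "\<lambda>t t0. if t = t0 then (\<lambda>c. map_pmf see_all (T c)) else (\<lambda>c. map_pmf see_side (T c))"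
  obtain e3 where e3: "e3 \<longlonglongrightarrow> 0" and b3: "\<forall>n t0 (Q :: ('a, 'b, 'c, 'd) letter_code pmf) S (C :: nat \<Rightarrow> _) I dL dC dO.
      t0 < n \<longrightarrow> cond_codewords Q S C I (pAB pA kC) (kAC_BD kB kD) \<longrightarrow> (\<forall>i\<in>I. C i dL = dC) \<longrightarrow> 2 powr (real n * R0) / 2 \<le> card I \<longrightarrow>
      pexp (Pi_pmf {..<n} dL (\<lambda>_. Q)) (\<lambda>\<omega>. cover_err n dO I
        (\<lambda>i t. ?obs t t0 (C i (\<omega> t))) (\<lambda>t. bind_pmf (kAC_BD kB kD (S (\<omega> t))) (?obs t t0))) \<le> e3 n"
    by (rule soft_covering_vanishing[OF info3])
  have "(\<lambda>n. G - \<beta> * e3 n - \<beta> * (e1 n + e2 n)) \<longlonglongrightarrow> G - \<beta> * 0 - \<beta> * (0 + 0)"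
    by (intro tendsto_intros e1 e2 e3)
  then have "eventually (\<lambda>n. payoff < G - \<beta> * e3 n - \<beta> * (e1 n + e2 n)) sequentially"
    using payoff unfolding G_def[symmetric] by (intro order_tendstoD(1)) auto
  with eventually_ge_at_top[of 1] have "eventually (\<lambda>n. 1 \<le> n \<and> payoff < G - \<beta> * e3 n - \<beta> * (e1 n + e2 n)) sequentially"
    by eventually_elim simp
  then obtain n where n: "1 \<le> n" and pay: "payoff < G - \<beta> * e3 n - \<beta> * (e1 n + e2 n)"
    by (auto simp: eventually_sequentially)
  define I where "I = message_set n r2"
  define J where "J = message_set n r1"
  define K where "K = message_set n R0"
  have fin: "finite I" "finite J" "finite K" by (auto simp: I_def J_def K_def message_set_def)
  have card: "2 powr (real n * r2) / 2 \<le> card I" "2 powr (real n * r1) / 2 \<le> card J" "2 powr (real n * R0) / 2 \<le> card K"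
    unfolding I_def J_def K_def by (intro card_message_set_ge r1 r2 R0)+
  have ne: "I \<noteq> {}" "J \<noteq> {}" "K \<noteq> {}" using card by auto
  have "card (I \<times> J) \<le> card (message_set n R1)"
    unfolding card_cartesian_product I_def J_def using rates by (intro card_message_set_mult_le) auto
  moreover have "finite (message_set n R1)" by (simp add: message_set_def)
  ultimately obtain e where e: "e ` (I \<times> J) \<subseteq> message_set n R1" "inj_on e (I \<times> J)"
    using card_le_inj[of "I \<times> J" "message_set n R1"] fin by auto
  interpret C: cascade_code n I J K e PX chX chY2 chY3 PW "kAC_BD kB kD" \<pi> \<beta> \<omega> for \<omega> :: "nat \<Rightarrow> ('a, 'b, 'c, 'd) letter_code"
    using fin ne e \<beta> by unfold_locales auto
  define Q where "Q = letter_code_pmf I J K pA kB kC kD"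
  \<comment> \<open>The letter of the codebook outside \<open>{..<n}\<close>: all entries are
    \<open>undefined\<close>, so the words read from it have the same default for all indices, as
    the covering bounds demand.\<close>
  define dL :: "('a, 'b, 'c, 'd) letter_code" where "dL = (\<lambda>_. undefined, \<lambda>_. undefined, \<lambda>_. undefined, \<lambda>_. undefined)"
  define \<Omega> where "\<Omega> = Pi_pmf {..<n} dL (\<lambda>_. Q)"
  have finQ: "finite (set_pmf Q)" unfolding Q_def by (intro finite_letter_code_pmf fin ne)
  have fin\<Omega>: "finite (set_pmf \<Omega>)" unfolding \<Omega>_def using finQ by (intro finite_set_Pi_pmf) auto
  have C_out: "C.out = T" unfolding C.out_def T_def ..
  have guess: "pexp \<Omega> (\<lambda>\<omega>. C.guess (let_a i (\<omega> t), let_c i j (\<omega> t))) = G" if "i \<in> I" "j \<in> J" "t < n" for i j t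
  proof -
    obtain k where k: "k \<in> K" using ne by blast
    have "map_pmf (\<lambda>l. ((let_a i l, let_c i j l), let_b i k l, let_d i j k l)) Q = do {s \<leftarrow> pAB pA kC; c \<leftarrow> kAC_BD kB kD s; return_pmf (s, c)}"
      using cond_codewords_adversary[OF fin ne that(1,2), of pA kB kC kD] k unfolding cond_codewords_def Q_def by blast
    moreover have "map_pmf (\<lambda>l. (let_a i l, let_c i j l)) Q = map_pmf fst (map_pmf (\<lambda>l. ((let_a i l, let_c i j l), let_b i k l, let_d i j k l)) Q)"
      by (simp add: pmf.map_comp o_def)
    ultimately have "map_pmf (\<lambda>l. (let_a i l, let_c i j l)) Q = map_pmf fst (do {s \<leftarrow> pAB pA kC; c \<leftarrow> kAC_BD kB kD s; return_pmf (s, c)})"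
      by (simp only:)
    also have "\<dots> = pAB pA kC" by (simp add: map_bind_pmf bind_return_pmf')
    finally have law: "map_pmf (\<lambda>l. (let_a i l, let_c i j l)) Q = pAB pA kC" .
    have "pexp \<Omega> (\<lambda>\<omega>. C.guess (let_a i (\<omega> t), let_c i j (\<omega> t)))
      = pexp (map_pmf (\<lambda>l. (let_a i l, let_c i j l)) (map_pmf (\<lambda>\<omega>. \<omega> t) \<Omega>)) C.guess" by simp
    also have "map_pmf (\<lambda>\<omega>. \<omega> t) \<Omega> = Q" unfolding \<Omega>_def using that by (simp add: Pi_pmf_component)
    finally show ?thesis unfolding law by (simp add: C.guess_def[abs_def] C_out G_def)
  qed
  have leak: "pexp \<Omega> (\<lambda>\<omega>. C.leak \<omega> t m) \<le> e3 n" if "m \<in> I \<times> J" "t < n" for m t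
  proof -
    have "fst m \<in> I" "snd m \<in> J" using that by auto
    from b3[rule_format, OF that(2) cond_codewords_adversary[OF fin ne this] _ card(3), where dL = dL and dC = "(undefined, undefined)"]
    show ?thesis unfolding C.leak_def C.obs_def C_out \<Omega>_def Q_def by (simp add: dL_def let_defs)
  qed
  have source: "pexp \<Omega> (\<lambda>\<omega>. C.source_err \<omega> k) \<le> e1 n + e2 n" if k: "k \<in> K" for k
  proof -
    let ?W = "\<lambda>p. Pi_pmf {..<n} undefined p"
    let ?B = "PiE_dflt {..<n} undefined (\<lambda>_. UNIV) :: (nat \<Rightarrow> 'x) set"
    define v where "v \<omega> i x = pmf (?W (\<lambda>t. qX (let_a i (\<omega> t), let_b i k (\<omega> t)))) x" for \<omega> :: "nat \<Rightarrow> ('a, 'b, 'c, 'd) letter_code" and i x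
    define A where "A \<omega> i = cover_err n undefined J (\<lambda>j t. chX (let_d i j k (\<omega> t))) (\<lambda>t. qX (let_a i (\<omega> t), let_b i k (\<omega> t)))" for \<omega> :: "nat \<Rightarrow> ('a, 'b, 'c, 'd) letter_code" and i
    define D where "D \<omega> = cover_err n undefined I (\<lambda>i t. qX (let_a i (\<omega> t), let_b i k (\<omega> t))) (\<lambda>_. PX)" for \<omega> :: "nat \<Rightarrow> ('a, 'b, 'c, 'd) letter_code"
    have A_alt: "A \<omega> i = (\<Sum>x\<in>?B. \<bar>(\<Sum>j\<in>J. pmf (C.dist_X \<omega> k (i, j)) x) / card J - v \<omega> i x\<bar>)" for \<omega> i
      unfolding A_def cover_err_def C.dist_X_def v_def by simp
    have D_alt: "D \<omega> = (\<Sum>x\<in>?B. \<bar>(\<Sum>i\<in>I. v \<omega> i x) / card I - pmf (?W (\<lambda>_. PX)) x\<bar>)" for \<omega>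
      unfolding D_def cover_err_def v_def ..
    have A: "pexp \<Omega> (\<lambda>\<omega>. A \<omega> i) \<le> e1 n" if "i \<in> I" for i
      unfolding A_def \<Omega>_def Q_def qX_def
      by (rule b1[rule_format, OF _ cond_codewords_node1[OF fin ne that k] _ card(2), where dC = undefined])
        (use n in \<open>simp_all add: dL_def let_defs\<close>)
    have D: "pexp \<Omega> D \<le> e2 n"
      using b2[rule_format, OF _ cond_codewords_node2[OF fin ne k] _ card(1), where dL = dL and dC = "(undefined, undefined)"] n
      unfolding D_def[abs_def] PX \<Omega>_def Q_def by (simp add: dL_def let_defs)
    \<comment> \<open>Triangle inequality through \<open>v\<close>: the average over
      \<open>j\<close> is compared with its target given \<open>(u\<^sub>2, v\<^sub>2)\<close>, and
      the average of these targets over \<open>i\<close> with the source law.\<close>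
    have "C.source_err \<omega> k \<le> (\<Sum>i\<in>I. A \<omega> i) / card I + D \<omega>" for \<omega>
    proof -
      have cI: "real (card I) > 0" and cJ: "real (card J) > 0" using fin ne by (auto simp: card_gt_0_iff)
      have "\<bar>pmf (?W (\<lambda>_. PX)) x - (\<Sum>m\<in>I \<times> J. pmf (C.dist_X \<omega> k m) x) / card (I \<times> J)\<bar>
         \<le> (\<Sum>i\<in>I. \<bar>(\<Sum>j\<in>J. pmf (C.dist_X \<omega> k (i, j)) x) / card J - v \<omega> i x\<bar>) / card I
           + \<bar>(\<Sum>i\<in>I. v \<omega> i x) / card I - pmf (?W (\<lambda>_. PX)) x\<bar>" for x
      proof -
        have "(\<Sum>m\<in>I \<times> J. pmf (C.dist_X \<omega> k m) x) / card (I \<times> J) = (\<Sum>i\<in>I. (\<Sum>j\<in>J. pmf (C.dist_X \<omega> k (i, j)) x) / card J) / card I"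
          by (simp add: sum.cartesian_product case_prod_unfold card_cartesian_product sum_divide_distrib mult.commute)
        also have "\<dots> = (\<Sum>i\<in>I. (\<Sum>j\<in>J. pmf (C.dist_X \<omega> k (i, j)) x) / card J - v \<omega> i x) / card I + (\<Sum>i\<in>I. v \<omega> i x) / card I"
          by (simp add: sum_subtractf add_divide_distrib[symmetric])
        finally have eq: "(\<Sum>m\<in>I \<times> J. pmf (C.dist_X \<omega> k m) x) / card (I \<times> J) = \<dots>" .
        have "\<bar>(\<Sum>i\<in>I. (\<Sum>j\<in>J. pmf (C.dist_X \<omega> k (i, j)) x) / card J - v \<omega> i x) / card I\<bar>
          \<le> (\<Sum>i\<in>I. \<bar>(\<Sum>j\<in>J. pmf (C.dist_X \<omega> k (i, j)) x) / card J - v \<omega> i x\<bar>) / card I"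
          using cI by (simp add: abs_divide divide_right_mono sum_abs)
        then show ?thesis unfolding eq by linarith
      qed
      then have "C.source_err \<omega> k \<le> (\<Sum>x\<in>?B. (\<Sum>i\<in>I. \<bar>(\<Sum>j\<in>J. pmf (C.dist_X \<omega> k (i, j)) x) / card J - v \<omega> i x\<bar>) / card I
           + \<bar>(\<Sum>i\<in>I. v \<omega> i x) / card I - pmf (?W (\<lambda>_. PX)) x\<bar>)"
        unfolding C.source_err_def by (intro sum_mono)
      also have "\<dots> = (\<Sum>i\<in>I. A \<omega> i) / card I + D \<omega>"
        unfolding A_alt D_alt by (simp add: sum.distrib sum_divide_distrib[symmetric] sum.swap[of _ I])
      finally show ?thesis .
    qed
    then have "pexp \<Omega> (\<lambda>\<omega>. C.source_err \<omega> k) \<le> pexp \<Omega> (\<lambda>\<omega>. (\<Sum>i\<in>I. A \<omega> i) / card I + D \<omega>)"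
      by (intro pexp_mono fin\<Omega>)
    also have "\<dots> = (\<Sum>i\<in>I. pexp \<Omega> (\<lambda>\<omega>. A \<omega> i)) / card I + pexp \<Omega> D"
      by (simp add: pexp_add[OF fin\<Omega>] pexp_sum[OF fin\<Omega>])
    also have "\<dots> \<le> (\<Sum>i\<in>I. e1 n) / card I + e2 n"
      by (intro add_mono divide_right_mono sum_mono A D) auto
    also have "\<dots> = e1 n + e2 n" using fin ne by simp
    finally show ?thesis .
  qed
  define L where "L \<omega> = (\<Sum>t<n. pexp (pmf_of_set (I \<times> J)) (\<lambda>m. C.guess (let_a (fst m) (\<omega> t), let_c (fst m) (snd m) (\<omega> t)) - \<beta> * C.leak \<omega> t m)) / real n
      - \<beta> * pexp (pmf_of_set K) (C.source_err \<omega>)" for \<omega>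
  have \<beta>0: "0 \<le> \<beta>" by (rule C.\<beta>_nonneg)
  have "G - \<beta> * e3 n - \<beta> * (e1 n + e2 n) \<le> pexp \<Omega> L"
  proof -
    have 1: "pexp \<Omega> (\<lambda>\<omega>. pexp (pmf_of_set (I \<times> J)) (\<lambda>m. C.guess (let_a (fst m) (\<omega> t), let_c (fst m) (snd m) (\<omega> t)) - \<beta> * C.leak \<omega> t m))
       \<ge> G - \<beta> * e3 n" if t: "t < n" for t
    proof -
      have "G - \<beta> * e3 n \<le> pexp (pmf_of_set (I \<times> J)) (\<lambda>m. pexp \<Omega> (\<lambda>\<omega>. C.guess (let_a (fst m) (\<omega> t), let_c (fst m) (snd m) (\<omega> t)) - \<beta> * C.leak \<omega> t m))"
      proof (rule pexp_ge_const)
        fix m assume "m \<in> set_pmf (pmf_of_set (I \<times> J))"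
        then have m: "m \<in> I \<times> J" using C.finIJ by simp
        then have "fst m \<in> I" "snd m \<in> J" by auto
        then show "G - \<beta> * e3 n \<le> pexp \<Omega> (\<lambda>\<omega>. C.guess (let_a (fst m) (\<omega> t), let_c (fst m) (snd m) (\<omega> t)) - \<beta> * C.leak \<omega> t m)"
          using mult_left_mono[OF leak[OF m t] \<beta>0] by (simp add: pexp_diff[OF fin\<Omega>] guess t)
      qed (use C.finIJ in simp)
      also have "\<dots> = pexp \<Omega> (\<lambda>\<omega>. pexp (pmf_of_set (I \<times> J)) (\<lambda>m. C.guess (let_a (fst m) (\<omega> t), let_c (fst m) (snd m) (\<omega> t)) - \<beta> * C.leak \<omega> t m))"
        using C.finIJ by (intro pexp_commute fin\<Omega>) simp
      finally show ?thesis .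
    qed
    have "pexp \<Omega> (\<lambda>\<omega>. pexp (pmf_of_set K) (C.source_err \<omega>)) = pexp (pmf_of_set K) (\<lambda>k. pexp \<Omega> (\<lambda>\<omega>. C.source_err \<omega> k))"
      using fin ne by (intro pexp_commute fin\<Omega>) simp
    also have "\<dots> \<le> e1 n + e2 n"
      by (rule pexp_le_const) (use fin ne source in simp_all)
    finally have 2: "\<beta> * pexp \<Omega> (\<lambda>\<omega>. pexp (pmf_of_set K) (C.source_err \<omega>)) \<le> \<beta> * (e1 n + e2 n)"
      using \<beta>0 by (rule mult_left_mono)
    have "G - \<beta> * e3 n = (\<Sum>t<n. G - \<beta> * e3 n) / real n" using n by simp
    also have "\<dots> \<le> (\<Sum>t<n. pexp \<Omega> (\<lambda>\<omega>. pexp (pmf_of_set (I \<times> J)) (\<lambda>m. C.guess (let_a (fst m) (\<omega> t), let_c (fst m) (snd m) (\<omega> t)) - \<beta> * C.leak \<omega> t m))) / real n"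
      by (intro divide_right_mono sum_mono 1) auto
    finally show ?thesis using 2 unfolding L_def[abs_def] pexp_diff[OF fin\<Omega>] by (simp add: pexp_sum[OF fin\<Omega>])
  qed
  with pay have "payoff \<le> pexp \<Omega> L" by linarith
  from ex_ge_pexp[OF fin\<Omega> this] obtain \<omega> where "payoff \<le> L \<omega>" by blast
  also have "\<dots> \<le> performance n PW \<pi> (C.system \<omega>)"
    unfolding L_def by (rule C.performance_ge[OF n])
  finally have "payoff \<le> performance n PW \<pi> (C.system \<omega>)" .
  moreover have "valid_system n R0 R1 R2 PX (C.system \<omega>)"
    using e(1) rates unfolding K_def I_def by (intro C.valid_system[unfolded K_def I_def] refl message_set_mono)
  ultimately show ?thesis using n unfolding achievable_region_def by blast
qed

section \<open>Rates on the boundary\<close>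

text \<open>With probability \<open>\<epsilon>\<close> all auxiliary letters are erased.  The likelihood ratio at an erased letter
  is 1, so all informations shrink by the factor \<open>1 - \<epsilon>\<close>, and strict inequality of the rates follows
  unless the information is 0.\<close>

definition erase :: "real \<Rightarrow> 'q \<Rightarrow> 'q pmf \<Rightarrow> 'q pmf" where
  "erase \<epsilon> q0 p = do {h \<leftarrow> bernoulli_pmf (1 - \<epsilon>); if h then p else return_pmf q0}"

lemma bind_erase: "bind_pmf (erase \<epsilon> q0 p) f = do {h \<leftarrow> bernoulli_pmf (1 - \<epsilon>); if h then bind_pmf p f else f q0}"
  unfolding erase_def by (auto simp: bind_assoc_pmf bind_return_pmf intro!: bind_pmf_cong)

lemma pexp_erase:
  assumes "0 \<le> \<epsilon>" "\<epsilon> \<le> 1" "finite (set_pmf p)"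
  shows "pexp (erase \<epsilon> q0 p) f = (1 - \<epsilon>) * pexp p f + \<epsilon> * f q0"
  unfolding erase_def using assms by (subst pexp_bind) (auto split: if_splits)

text \<open>An erased centre has a single codeword, so the mixture is that codeword's own channel
  law and the ratio is 1. The quotient is never \<open>0 / 0\<close> because the output lies in the
  support.\<close>

lemma ratio_law_erase:
  assumes "\<And>s. k' (f s) = map_pmf g (k s)" "\<And>c. ch' (g c) = ch c" "k' s0 = return_pmf c0"
  shows "ratio_law (erase \<epsilon> s0 (map_pmf f pS)) k' ch' = erase \<epsilon> 1 (ratio_law pS k ch)"
proof -
  have 1: "do {x \<leftarrow> ch' c0; return_pmf (pmf (ch' c0) x / pmf (ch' c0) x)} = return_pmf 1"
  proof -
    have "do {x \<leftarrow> ch' c0; return_pmf (pmf (ch' c0) x / pmf (ch' c0) x)} = do {x \<leftarrow> ch' c0; return_pmf 1}"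
      by (intro bind_pmf_cong refl) (auto simp: set_pmf_eq)
    then show ?thesis by simp
  qed
  show ?thesis unfolding ratio_law_def bind_erase
    by (auto simp: erase_def assms bind_map_pmf bind_return_pmf 1[simplified] intro!: bind_pmf_cong)
qed

text \<open>Here the codeword is erased, under a trivial centre. Its channel has to emit the mixture
  itself, so that the mixture does not change and the ratio at the erased codeword is 1.\<close>

lemma ratio_law_erase_codeword:
  assumes "\<And>c. ch' (g c) = ch c" "ch' c0 = bind_pmf p ch"
  shows "ratio_law (return_pmf ()) (\<lambda>_. erase \<epsilon> c0 (map_pmf g p)) ch' = erase \<epsilon> 1 (ratio_law (return_pmf ()) (\<lambda>_. p) ch)"
proof -
  let ?q = "bind_pmf p ch"
  have q: "bind_pmf (erase \<epsilon> c0 (map_pmf g p)) ch' = ?q"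
    unfolding bind_erase by (simp add: assms bind_map_pmf cong: if_cong)
  have 1: "do {x \<leftarrow> ?q; return_pmf (pmf ?q x / pmf ?q x)} = return_pmf 1"
  proof -
    have "do {x \<leftarrow> ?q; return_pmf (pmf ?q x / pmf ?q x)} = do {x \<leftarrow> ?q; return_pmf 1}"
      by (rule bind_pmf_cong[OF refl]) (simp add: set_pmf_eq)
    then show ?thesis by simp
  qed
  have "ratio_law (return_pmf ()) (\<lambda>_. erase \<epsilon> c0 (map_pmf g p)) ch'
    = bind_pmf (erase \<epsilon> c0 (map_pmf g p)) (\<lambda>c. do {x \<leftarrow> ch' c; return_pmf (pmf (ch' c) x / pmf ?q x)})"
    unfolding ratio_law_def bind_return_pmf q ..
  also have "\<dots> = do {h \<leftarrow> bernoulli_pmf (1 - \<epsilon>);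
      if h then do {c \<leftarrow> p; x \<leftarrow> ch c; return_pmf (pmf (ch c) x / pmf ?q x)} else return_pmf 1}"
    unfolding bind_erase bind_map_pmf assms 1 ..
  also have "\<dots> = erase \<epsilon> 1 (ratio_law (return_pmf ()) (\<lambda>_. p) ch)"
    unfolding erase_def ratio_law_def bind_return_pmf ..
  finally show ?thesis .
qed

fun lift_opt :: "('q \<Rightarrow> 'r pmf) \<Rightarrow> 'r pmf \<Rightarrow> 'q option \<Rightarrow> 'r pmf" where
  "lift_opt f r None = r"
| "lift_opt f r (Some q) = f q"

text \<open>The value at mixed arguments is arbitrary: the letters of one time are erased together,
  so mixed arguments have probability 0.\<close>

fun lift_opt3 :: "('a \<Rightarrow> 'b \<Rightarrow> 'c \<Rightarrow> 'r pmf) \<Rightarrow> 'a option \<Rightarrow> 'b option \<Rightarrow> 'c option \<Rightarrow> 'r option pmf" where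
  "lift_opt3 f (Some a) (Some b) (Some c) = map_pmf Some (f a b c)"
| "lift_opt3 f _ _ _ = return_pmf None"

text \<open>The code is built for the erased law at rates equal to the informations of the original
  law. Each positive information leaves slack after erasure, and the loss of payoff is at most a
  constant times \<open>\<epsilon>\<close>.\<close>

theorem superposition_coding_boundary:
  fixes pA :: "'a::finite pmf" and kB :: "'a \<Rightarrow> 'b::finite pmf" and kC :: "'a \<Rightarrow> 'c::finite pmf"
    and kD :: "'a \<Rightarrow> 'b \<Rightarrow> 'c \<Rightarrow> 'd::finite pmf"
    and chX :: "'d \<Rightarrow> 'x::finite pmf" and chY2 :: "'d \<Rightarrow> 'y2::finite pmf" and chY3 :: "'b \<Rightarrow> 'y3::finite pmf"
    and PW :: "'x \<Rightarrow> 'y2 \<Rightarrow> 'y3 \<Rightarrow> 'w::finite pmf" and \<pi> :: "'x \<Rightarrow> 'y2 \<Rightarrow> 'y3 \<Rightarrow> 'z::finite \<Rightarrow> real"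
  defines "qX \<equiv> \<lambda>s. bind_pmf (kAB_D kC kD s) chX"
    and "T \<equiv> letter_out chX chY2 chY3 PW"
  assumes PX: "bind_pmf (pAB pA kB) qX = PX"
    and info3: "ratio_info (pAB pA kC) (kAC_BD kB kD) (\<lambda>c. map_pmf see_side (T c)) < R0"
    and R1: "ratio_info (pAB pA kB) (kAB_D kC kD) chX + ratio_info (return_pmf ()) (\<lambda>_. pAB pA kB) qX \<le> R1"
    and R2: "ratio_info (return_pmf ()) (\<lambda>_. pAB pA kB) qX \<le> R2"
    and payoff: "payoff < pexp (pAB pA kC) (\<lambda>s. MIN z. pexp (bind_pmf (kAC_BD kB kD s) T) (\<lambda>(x, y2, y3, w). \<pi> x y2 y3 z))"
  shows "(R0, R1, R2, payoff) \<in> achievable_region PX PW \<pi>"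
proof -
  define kB' where "kB' = lift_opt (\<lambda>a. map_pmf Some (kB a)) (return_pmf None)"
  define kC' where "kC' = lift_opt (\<lambda>a. map_pmf Some (kC a)) (return_pmf None)"
  define kD' where "kD' = lift_opt3 kD"
  \<comment> \<open>An erased letter emits the source law. This keeps \<open>X\<close> distributed
    as \<open>PX\<close>, and it is the mixture that an erased codeword has to emit.\<close>
  define chX' where "chX' = lift_opt chX PX"
  define chY2' where "chY2' = lift_opt chY2 (return_pmf undefined)"
  define chY3' where "chY3' = lift_opt chY3 (return_pmf undefined)"
  define qX' where "qX' = (\<lambda>s. bind_pmf (kAB_D kC' kD' s) chX')"
  define T' where "T' = letter_out chX' chY2' chY3' PW"
  define g where "g = (\<lambda>s. MIN z. pexp (bind_pmf (kAC_BD kB kD s) T) (\<lambda>(x, y2, y3, w). \<pi> x y2 y3 z))"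
  define g' where "g' = (\<lambda>s. MIN z. pexp (bind_pmf (kAC_BD kB' kD' s) T') (\<lambda>(x, y2, y3, w). \<pi> x y2 y3 z))"
  define i1 where "i1 = ratio_info (pAB pA kB) (kAB_D kC kD) chX"
  define i2 where "i2 = ratio_info (return_pmf ()) (\<lambda>_. pAB pA kB) qX"
  define i3 where "i3 = ratio_info (pAB pA kC) (kAC_BD kB kD) (\<lambda>c. map_pmf see_side (T c))"
  define G where "G = pexp (pAB pA kC) g"
  define G0 where "G0 = g' (None, None)"
  note defs = kB'_def kC'_def kD'_def chX'_def chY2'_def chY3'_def
  let ?SS = "\<lambda>(u, v). (Some u, Some v)"
  have kAB: "kAB_D kC' kD' (?SS s) = map_pmf Some (kAB_D kC kD s)" "kAB_D kC' kD' (None, None) = return_pmf None" for s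
    by (auto simp: kAB_D_def defs bind_map_pmf map_bind_pmf bind_return_pmf split: prod.split)
  have kAC: "kAC_BD kB' kD' (?SS s) = map_pmf ?SS (kAC_BD kB kD s)" "kAC_BD kB' kD' (None, None) = return_pmf (None, None)" for s
    by (auto simp: kAC_BD_def defs bind_map_pmf map_bind_pmf bind_return_pmf split: prod.split)
  have qX': "qX' (?SS s) = qX s" "qX' (None, None) = PX" for s
    unfolding qX'_def qX_def kAB by (simp_all add: bind_map_pmf bind_return_pmf chX'_def)
  have T': "T' (?SS c) = T c" for c
    by (auto simp: T'_def T_def letter_out_def defs split: prod.split)
  have g'_Some: "g' (?SS s) = g s" for s
    unfolding g'_def g_def kAC bind_map_pmf T' ..

  \<comment> \<open>The summand 1 keeps \<open>D\<close> positive; \<open>\<epsilon>\<close> is then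
    chosen so that the loss of payoff is at most half the gap \<open>G - payoff\<close>.\<close>
  define D where "D = \<bar>G - G0\<bar> + 1"
  have D: "D > 0" "G - G0 \<le> D" by (auto simp: D_def)
  define \<epsilon> where "\<epsilon> = min (1 / 2) ((G - payoff) / (2 * D))"
  have pos: "payoff < G" using payoff by (simp add: G_def g_def)
  then have \<epsilon>: "0 < \<epsilon>" "\<epsilon> \<le> 1" using D by (auto simp: \<epsilon>_def)
  have "\<epsilon> * (G - G0) \<le> \<epsilon> * D" using \<epsilon> D by (intro mult_left_mono) auto
  also have "\<dots> \<le> (G - payoff) / (2 * D) * D"
    using D by (intro mult_right_mono) (auto simp: \<epsilon>_def)
  also have "\<dots> = (G - payoff) / 2" using D by simp
  also have "\<dots> < G - payoff" using pos by simp
  finally have small: "payoff < (1 - \<epsilon>) * G + \<epsilon> * G0" by (simp add: algebra_simps)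

  define pA' where "pA' = erase \<epsilon> None (map_pmf Some pA)"
  have pAB': "pAB pA' kB' = erase \<epsilon> (None, None) (map_pmf ?SS (pAB pA kB))"
    unfolding pAB_def pA'_def bind_erase unfolding erase_def
    by (intro bind_pmf_cong refl) (simp add: defs bind_map_pmf map_bind_pmf bind_return_pmf)
  have pAC': "pAB pA' kC' = erase \<epsilon> (None, None) (map_pmf ?SS (pAB pA kC))"
    unfolding pAB_def pA'_def bind_erase unfolding erase_def
    by (intro bind_pmf_cong refl) (simp add: defs bind_map_pmf map_bind_pmf bind_return_pmf)
  have info: "ratio_info pS' k' ch' = (1 - \<epsilon>) * ratio_info pS k ch"
    if "ratio_law pS' k' ch' = erase \<epsilon> 1 (ratio_law pS k ch)"
    for pS' :: "'s1::finite pmf" and k' :: "_ \<Rightarrow> 'c1::finite pmf" and ch' :: "_ \<Rightarrow> 'o1::finite pmf"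
      and pS :: "'s::finite pmf" and k :: "_ \<Rightarrow> 'e::finite pmf" and ch :: "_ \<Rightarrow> 'o::finite pmf"
    unfolding ratio_info_def that using \<epsilon> by (simp add: pexp_erase)
  have 1: "ratio_info (pAB pA' kB') (kAB_D kC' kD') chX' = (1 - \<epsilon>) * i1"
    unfolding i1_def pAB' by (rule info, rule ratio_law_erase[where g = Some]) (rule kAB(1), simp add: chX'_def, rule kAB(2))
  have 2: "ratio_info (return_pmf ()) (\<lambda>_. pAB pA' kB') qX' = (1 - \<epsilon>) * i2"
    unfolding i2_def pAB' by (intro info ratio_law_erase_codeword) (simp_all add: qX' PX)
  have 3: "ratio_info (pAB pA' kC') (kAC_BD kB' kD') (\<lambda>c. map_pmf see_side (T' c)) = (1 - \<epsilon>) * i3"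
    unfolding i3_def pAC' by (rule info, rule ratio_law_erase[where g = ?SS]) (rule kAC(1), simp only: T', rule kAC(2))
  have nonneg: "0 \<le> i1" "0 \<le> i2" "0 \<le> i3" unfolding i1_def i2_def i3_def by (rule ratio_info_nonneg)+
  have strict: "(1 - \<epsilon>) * i < i \<or> (1 - \<epsilon>) * i = 0 \<and> i = 0" if "0 \<le> i" for i
    using that \<epsilon> by (cases "i = 0") (auto simp: algebra_simps)
  show ?thesis
  proof (rule superposition_coding[of pA' kB' kC' kD' chX' PX i1 i2 chY2' chY3' PW])
    show "bind_pmf (pAB pA' kB') (\<lambda>s. bind_pmf (kAB_D kC' kD' s) chX') = PX"
      unfolding qX'_def[symmetric] pAB' bind_erase by (simp add: bind_map_pmf qX' PX cong: if_cong)
    show "ratio_info (pAB pA' kB') (kAB_D kC' kD') chX' < i1 \<or> ratio_info (pAB pA' kB') (kAB_D kC' kD') chX' = 0 \<and> i1 = 0"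
      unfolding 1 by (rule strict) fact
    show "ratio_info (return_pmf ()) (\<lambda>_. pAB pA' kB') (\<lambda>s. bind_pmf (kAB_D kC' kD' s) chX') < i2 \<or>
      ratio_info (return_pmf ()) (\<lambda>_. pAB pA' kB') (\<lambda>s. bind_pmf (kAB_D kC' kD' s) chX') = 0 \<and> i2 = 0"
      unfolding qX'_def[symmetric] 2 by (rule strict) fact
    show "ratio_info (pAB pA' kC') (kAC_BD kB' kD') (\<lambda>c. map_pmf see_side (letter_out chX' chY2' chY3' PW c)) < R0"
      unfolding T'_def[symmetric] 3 using info3 strict[OF nonneg(3)] unfolding i3_def[symmetric] by linarith
    show "i1 + i2 \<le> R1" "i2 \<le> R2" using R1 R2 by (simp_all add: i1_def i2_def)
    have "pexp (pAB pA' kC') g' = (1 - \<epsilon>) * G + \<epsilon> * G0"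
      unfolding pAC' using \<epsilon> by (subst pexp_erase) (simp_all add: g'_Some G_def G0_def)
    then show "payoff < pexp (pAB pA' kC') (\<lambda>s. MIN z. pexp (bind_pmf (kAC_BD kB' kD' s) (letter_out chX' chY2' chY3' PW))
        (\<lambda>(x, y2, y3, w). \<pi> x y2 y3 z))"
      using small by (simp add: g'_def T'_def)
  qed
qed

section \<open>Information measures of a finite joint distribution\<close>

text \<open>The probability of the observed value, itself a random variable. Informations become
  expectations of logarithms of such terms, so identities between them can be checked outcome by
  outcome.\<close>

definition self_prob :: "'o pmf \<Rightarrow> ('o \<Rightarrow> 'a) \<Rightarrow> 'o \<Rightarrow> real" where
  "self_prob P F s = pmf (map_pmf F P) (F s)"

lemma self_prob_pos: "s \<in> set_pmf P \<Longrightarrow> 0 < self_prob P F s"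
  unfolding self_prob_def by (intro pmf_positive) auto

text \<open>Only the partition that \<open>F\<close> induces on the support matters. This allows a
  variable that others determine to be added to a tuple or dropped from it.\<close>

lemma self_prob_cong:
  assumes "\<And>s'. s' \<in> set_pmf P \<Longrightarrow> F s' = F s \<longleftrightarrow> G s' = G s"
  shows "self_prob P F s = self_prob P G s"
proof -
  have "measure_pmf.prob P (F -` {F s}) = measure_pmf.prob P (F -` {F s} \<inter> set_pmf P)"
    by (simp add: measure_Int_set_pmf)
  also have "F -` {F s} \<inter> set_pmf P = G -` {G s} \<inter> set_pmf P" using assms by auto
  also have "measure_pmf.prob P \<dots> = measure_pmf.prob P (G -` {G s})"
    by (simp add: measure_Int_set_pmf)
  finally show ?thesis by (simp add: self_prob_def pmf_map)
qed

lemma distributed_map_pmf: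
  "distributed (measure_pmf P) (count_space UNIV) X (\<lambda>x. ennreal (pmf (map_pmf X P) x))"
  unfolding distributed_def map_pmf_rep_eq[symmetric] by (auto intro: measure_pmf_eq_density)

lemma count_space_pair_UNIV:
  "count_space (UNIV :: 'a::finite set) \<Otimes>\<^sub>M count_space (UNIV :: 'b::finite set) = count_space UNIV"
  by (simp add: pair_measure_count_space)

lemma mutual_info_eq:
  fixes A :: "'o \<Rightarrow> 'a::finite" and B :: "'o \<Rightarrow> 'b::finite"
  shows "mutual_info P A B =
    pexp P (\<lambda>s. log 2 (self_prob P (\<lambda>s. (A s, B s)) s / (self_prob P A s * self_prob P B s)))"
proof -
  interpret information_space "measure_pmf P" 2 by unfold_locales simp
  let ?pAB = "pmf (map_pmf (\<lambda>s. (A s, B s)) P)"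
  let ?f = "\<lambda>x. ?pAB x * log 2 (?pAB x / (pmf (map_pmf A P) (fst x) * pmf (map_pmf B P) (snd x)))"
  have "mutual_info P A B = integral\<^sup>L (count_space UNIV \<Otimes>\<^sub>M count_space UNIV) ?f"
    unfolding mutual_info_def
    by (intro mutual_information_distr distributed_map_pmf)
      (simp_all add: sigma_finite_measure_count_space_finite count_space_pair_UNIV distributed_map_pmf)
  also have "\<dots> = (\<Sum>x\<in>UNIV. ?f x)"
    unfolding count_space_pair_UNIV by (simp add: lebesgue_integral_count_space_finite)
  also have "\<dots> = pexp (map_pmf (\<lambda>s. (A s, B s)) P)
      (\<lambda>x. log 2 (?pAB x / (pmf (map_pmf A P) (fst x) * pmf (map_pmf B P) (snd x))))"
    by (rule pexp_eq_sum[symmetric]) auto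
  finally show ?thesis by (simp add: self_prob_def)
qed

lemma cond_mutual_info_eq:
  fixes A :: "'o \<Rightarrow> 'a::finite" and B :: "'o \<Rightarrow> 'b::finite" and C :: "'o \<Rightarrow> 'c::finite"
  shows "cond_mutual_info P A B C = mutual_info P A (\<lambda>s. (B s, C s)) - mutual_info P A C"
proof -
  interpret information_space "measure_pmf P" 2 by unfold_locales simp
  show ?thesis
    unfolding cond_mutual_info_def mutual_info_def prob_space.conditional_mutual_information_def[OF prob_space_measure_pmf] count_space_pair_UNIV ..
qed

text \<open>All summands of the entropy are nonnegative, so each vanishes, and \<open>(a, b)\<close>
  has probability 0 or that of \<open>b\<close>. Two values of \<open>A\<close> on the same
  \<open>b\<close> would together exceed the probability of \<open>b\<close>.\<close>

lemma cond_entropy_zeroD: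
  fixes A :: "'o \<Rightarrow> 'a::finite" and B :: "'o \<Rightarrow> 'b::finite"
  assumes zero: "cond_entropy P A B = 0"
  shows "\<exists>f. \<forall>s\<in>set_pmf P. A s = f (B s)"
proof -
  interpret information_space "measure_pmf P" 2 by unfold_locales simp
  let ?pAB = "pmf (map_pmf (\<lambda>s. (A s, B s)) P)" and ?pB = "pmf (map_pmf B P)"
  have le: "measure_pmf.prob P {s. A s = a \<and> B s = b} \<le> measure_pmf.prob P {s. B s = b}" for a b
    by (intro measure_pmf.finite_measure_mono) auto
  have pAB: "?pAB (a, b) = measure_pmf.prob P {s. A s = a \<and> B s = b}" and pB: "?pB b = measure_pmf.prob P {s. B s = b}" for a b
    by (simp_all add: pmf_map vimage_def)
  have "cond_entropy P A B = - (\<integral>(a, b). ?pAB (a, b) * log 2 (?pAB (a, b) / ?pB b) \<partial>(count_space UNIV \<Otimes>\<^sub>M count_space UNIV))"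
    unfolding cond_entropy_def
    by (intro conditional_entropy_generic_eq distributed_map_pmf)
      (simp_all add: sigma_finite_measure_count_space_finite count_space_pair_UNIV distributed_map_pmf)
  also have "\<dots> = (\<Sum>(a, b)\<in>UNIV. - (?pAB (a, b) * log 2 (?pAB (a, b) / ?pB b)))"
    unfolding count_space_pair_UNIV by (simp add: lebesgue_integral_count_space_finite sum_negf case_prod_unfold)
  finally have sum0: "(\<Sum>(a, b)\<in>UNIV. - (?pAB (a, b) * log 2 (?pAB (a, b) / ?pB b))) = 0" using zero by simp
  have nn: "0 \<le> - (?pAB (a, b) * log 2 (?pAB (a, b) / ?pB b))" for a b
  proof (cases "?pAB (a, b) = 0")
    case False
    then have "0 < ?pAB (a, b)" by (simp add: less_le)
    moreover from this have "0 < ?pB b" using le[of a b] by (simp add: pAB pB)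
    ultimately have "log 2 (?pAB (a, b) / ?pB b) \<le> 0" using le[of a b] by (simp add: pAB pB)
    then show ?thesis by (simp add: mult_nonneg_nonpos)
  qed simp
  have "\<forall>x\<in>UNIV. (case x of (a, b) \<Rightarrow> - (?pAB (a, b) * log 2 (?pAB (a, b) / ?pB b))) = 0"
    using sum0 nn by (subst (asm) sum_nonneg_eq_0_iff) auto
  then have term0: "?pAB (a, b) = 0 \<or> log 2 (?pAB (a, b) / ?pB b) = 0" for a b by fastforce
  have eq: "A s = A s'" if s: "s \<in> set_pmf P" "s' \<in> set_pmf P" "B s = B s'" for s s'
  proof (rule ccontr)
    assume ne: "A s \<noteq> A s'"
    have full: "?pAB (A s, B s) = ?pB (B s)"
    proof -
      have "0 < ?pAB (A s, B s)" "0 < ?pB (B s)" using s(1) by (auto intro!: pmf_positive)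
      with term0[of "A s" "B s"] show ?thesis by (simp add: log_eq_one field_simps log_def)
    qed
    have "0 < ?pAB (A s', B s)" unfolding s(3) using s by (auto intro!: pmf_positive)
    have "?pAB (A s, B s) + ?pAB (A s', B s) = measure_pmf.prob P ({t. A t = A s \<and> B t = B s} \<union> {t. A t = A s' \<and> B t = B s})"
      unfolding pAB using ne by (intro measure_pmf.finite_measure_Union[symmetric]) auto
    also have "\<dots> \<le> ?pB (B s)" unfolding pB by (intro measure_pmf.finite_measure_mono) auto
    finally show False using full \<open>0 < ?pAB (A s', B s)\<close> by linarith
  qed
  define f where "f b = A (SOME s. s \<in> set_pmf P \<and> B s = b)" for b
  have "A s = f (B s)" if "s \<in> set_pmf P" for s
  proof -
    have "(SOME s'. s' \<in> set_pmf P \<and> B s' = B s) \<in> set_pmf P \<and> B (SOME s'. s' \<in> set_pmf P \<and> B s' = B s) = B s"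
      by (rule someI[of _ s]) (use that in simp)
    then show ?thesis unfolding f_def using that by (intro eq) auto
  qed
  then show ?thesis by (intro exI[of _ f] ballI)
qed

section \<open>Conditional distributions as kernels\<close>

text \<open>\<open>k\<close> is a version of the conditional law of \<open>C\<close> given
  \<open>G\<close>. Its values off the range of \<open>G\<close> are free, which leaves room for
  versions that read only part of \<open>G\<close>.\<close>

definition kernel_law :: "'o pmf \<Rightarrow> ('o \<Rightarrow> 'g) \<Rightarrow> ('o \<Rightarrow> 'c) \<Rightarrow> ('g \<Rightarrow> 'c pmf) \<Rightarrow> bool" where
  "kernel_law P G C k \<longleftrightarrow>
     map_pmf (\<lambda>s. (G s, C s)) P = bind_pmf (map_pmf G P) (\<lambda>g. map_pmf (\<lambda>c. (g, c)) (k g))"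

lemma kernel_law_reg_cond: "kernel_law P B A (reg_cond P A B)"
  unfolding kernel_law_def by (rule bind_reg_cond[symmetric])

lemma kernel_law_pmf: "kernel_law P G C k \<Longrightarrow> pmf (map_pmf (\<lambda>s. (G s, C s)) P) (g, c) = pmf (map_pmf G P) g * pmf (k g) c"
  unfolding kernel_law_def by (simp add: pmf_bind_Pair)

lemma kernel_lawI:
  fixes G :: "'o \<Rightarrow> 'g" and C :: "'o \<Rightarrow> 'c"
  assumes "\<And>g c. pmf (map_pmf G P) g > 0 \<Longrightarrow>
    pmf (map_pmf (\<lambda>s. (G s, C s)) P) (g, c) = pmf (map_pmf G P) g * pmf (k g) c"
  shows "kernel_law P G C k"
  unfolding kernel_law_def
proof (rule pmf_eqI)
  fix gc :: "'g \<times> 'c"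
  obtain g c where gc: "gc = (g, c)" by force
  show "pmf (map_pmf (\<lambda>s. (G s, C s)) P) gc = pmf (bind_pmf (map_pmf G P) (\<lambda>g. map_pmf (\<lambda>c. (g, c)) (k g))) gc"
  proof (cases "pmf (map_pmf G P) g > 0")
    case True
    then show ?thesis unfolding gc by (simp add: pmf_bind_Pair assms)
  next
    case False
    then have g: "pmf (map_pmf G P) g = 0" using pmf_nonneg[of "map_pmf G P" g] by linarith
    then have "g \<notin> set_pmf (map_pmf G P)" by (simp only: pmf_eq_0_set_pmf not_False_eq_True)
    then have "pmf (map_pmf (\<lambda>s. (G s, C s)) P) (g, c) = 0"
      unfolding pmf_eq_0_set_pmf by auto
    then show ?thesis unfolding gc pmf_bind_Pair g by simp
  qed
qed

lemma kernel_law_markov: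
  assumes "markov_chain P A B C"
  shows "kernel_law P (\<lambda>s. (A s, B s)) C (\<lambda>ab. reg_cond P C B (snd ab))"
proof (rule kernel_lawI)
  fix ab c assume pos: "0 < pmf (map_pmf (\<lambda>s. (A s, B s)) P) ab"
  obtain a b where ab: "ab = (a, b)" by force
  have aux: "x / y = z / y * (y * w / y) \<Longrightarrow> 0 < y \<Longrightarrow> x = z * w" for x y z w :: real
    by simp
  have le: "measure_pmf.prob P {s. A s = a \<and> B s = b} \<le> measure_pmf.prob P {s. B s = b}"
    by (intro measure_pmf.finite_measure_mono) auto
  with pos have posB: "0 < measure_pmf.prob P {s. B s = b}" by (simp add: ab pmf_map vimage_def)
  have "measure_pmf.prob P {s. C s = c \<and> B s = b} = pmf (map_pmf (\<lambda>s. (B s, C s)) P) (b, c)"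
    by (auto simp: pmf_map vimage_def intro!: arg_cong[where f = "measure_pmf.prob P"])
  also have "\<dots> = pmf (map_pmf B P) b * pmf (reg_cond P C B b) c"
    by (rule kernel_law_pmf[OF kernel_law_reg_cond])
  finally have BC: "measure_pmf.prob P {s. C s = c \<and> B s = b} = measure_pmf.prob P {s. B s = b} * pmf (reg_cond P C B b) c"
    by (simp add: pmf_map vimage_def)
  have "measure_pmf.prob P {s. (A s = a \<and> C s = c) \<and> B s = b} / measure_pmf.prob P {s. B s = b}
    = measure_pmf.prob P {s. A s = a \<and> B s = b} / measure_pmf.prob P {s. B s = b}
      * (measure_pmf.prob P {s. C s = c \<and> B s = b} / measure_pmf.prob P {s. B s = b})"
    using assms[unfolded markov_chain_def cond_prob_def, rule_format, of b a c] posB by simp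
  then have "measure_pmf.prob P {s. (A s = a \<and> C s = c) \<and> B s = b}
    = measure_pmf.prob P {s. A s = a \<and> B s = b} * pmf (reg_cond P C B b) c"
    using posB unfolding BC by (rule aux)
  moreover have "{s. (A s = a \<and> C s = c) \<and> B s = b} = (\<lambda>s. ((A s, B s), C s)) -` {((a, b), c)}" by auto
  moreover have "{s. A s = a \<and> B s = b} = (\<lambda>s. (A s, B s)) -` {(a, b)}" by auto
  ultimately show "pmf (map_pmf (\<lambda>s. ((A s, B s), C s)) P) (ab, c)
    = pmf (map_pmf (\<lambda>s. (A s, B s)) P) ab * pmf (reg_cond P C B (snd ab)) c"
    unfolding ab pmf_map snd_conv by (simp only:)
qed

text \<open>Conditioning on \<open>G'\<close> is conditioning on \<open>G\<close> when each
  determines the other on the support. So the conditioning can extend to all letters drawn so far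
  while the kernel still reads only those that matter.\<close>

lemma kernel_law_equiv:
  assumes law: "kernel_law P G C k"
    and h: "\<And>s. s \<in> set_pmf P \<Longrightarrow> G s = h (G' s)" and h': "\<And>s. s \<in> set_pmf P \<Longrightarrow> G' s = h' (G s)"
  shows "kernel_law P G' C (\<lambda>g. k (h g))"
proof -
  have "map_pmf (\<lambda>s. (G' s, C s)) P = map_pmf (\<lambda>(g, c). (h' g, c)) (map_pmf (\<lambda>s. (G s, C s)) P)"
    unfolding pmf.map_comp o_def by (rule map_pmf_cong[OF refl]) (simp add: h')
  also have "\<dots> = bind_pmf (map_pmf G P) (\<lambda>g. map_pmf (\<lambda>c. (h' g, c)) (k g))"
    unfolding law[unfolded kernel_law_def] by (simp add: map_bind_pmf pmf.map_comp o_def)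
  also have "\<dots> = bind_pmf (map_pmf G P) (\<lambda>g. map_pmf (\<lambda>c. (h' g, c)) (k (h (h' g))))"
  proof (rule bind_pmf_cong[OF refl])
    fix g assume "g \<in> set_pmf (map_pmf G P)"
    then obtain s where s: "s \<in> set_pmf P" and g: "g = G s" by auto
    have "h (h' g) = h (G' s)" unfolding g h'[OF s] ..
    also have "\<dots> = g" unfolding g by (rule h[OF s, symmetric])
    finally have "h (h' g) = g" .
    then show "map_pmf (\<lambda>c. (h' g, c)) (k g) = map_pmf (\<lambda>c. (h' g, c)) (k (h (h' g)))" by simp
  qed
  also have "\<dots> = bind_pmf (map_pmf h' (map_pmf G P)) (\<lambda>g. map_pmf (\<lambda>c. (g, c)) (k (h g)))"
    by (simp add: bind_map_pmf)
  also have "map_pmf h' (map_pmf G P) = map_pmf G' P"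
    unfolding pmf.map_comp o_def by (rule map_pmf_cong[OF refl]) (simp add: h')
  finally show ?thesis unfolding kernel_law_def .
qed

text \<open>The law in the hypothesis makes \<open>S - C - X\<close> a Markov chain, so the two
  likelihoods are \<open>P(x|c)\<close> and \<open>P(x|s)\<close>, each a quotient of probabilities
  of observed values.\<close>

lemma ratio_info_eq:
  fixes pS :: "'s::finite pmf" and k :: "'s \<Rightarrow> 'c::finite pmf" and ch :: "'c \<Rightarrow> 'o::finite pmf"
  assumes law: "do {s \<leftarrow> pS; c \<leftarrow> k s; x \<leftarrow> ch c; return_pmf (s, c, x)} = map_pmf (\<lambda>\<omega>. (S \<omega>, C \<omega>, X \<omega>)) P"
  shows "ratio_info pS k ch = pexp P (\<lambda>\<omega>. log 2
    ((self_prob P (\<lambda>\<omega>. (C \<omega>, X \<omega>)) \<omega> / self_prob P C \<omega>) / (self_prob P (\<lambda>\<omega>. (S \<omega>, X \<omega>)) \<omega> / self_prob P S \<omega>)))"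
proof -
  let ?q = "\<lambda>s. bind_pmf (k s) ch"
  have S: "pS = map_pmf S P"
  proof -
    have "pS = map_pmf fst (do {s \<leftarrow> pS; c \<leftarrow> k s; x \<leftarrow> ch c; return_pmf (s, c, x)})"
      by (simp add: map_bind_pmf bind_return_pmf')
    then show ?thesis unfolding law by (simp add: pmf.map_comp o_def)
  qed
  have C: "bind_pmf pS k = map_pmf C P"
  proof -
    have "bind_pmf pS k = map_pmf (\<lambda>(s, c, x). c) (do {s \<leftarrow> pS; c \<leftarrow> k s; x \<leftarrow> ch c; return_pmf (s, c, x)})"
      by (simp add: map_bind_pmf bind_return_pmf')
    then show ?thesis unfolding law by (simp add: pmf.map_comp o_def)
  qed
  have lawS: "kernel_law P S X ?q"
  proof -
    have "map_pmf (\<lambda>(s, c, x). (s, x)) (do {s \<leftarrow> pS; c \<leftarrow> k s; x \<leftarrow> ch c; return_pmf (s, c, x)})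
      = bind_pmf pS (\<lambda>s. map_pmf (\<lambda>x. (s, x)) (?q s))"
      by (simp add: map_bind_pmf map_pmf_def bind_assoc_pmf bind_return_pmf)
    then show ?thesis unfolding law kernel_law_def S[symmetric] by (simp add: pmf.map_comp o_def)
  qed
  have lawC: "kernel_law P C X ch"
  proof -
    have "map_pmf (\<lambda>(s, c, x). (c, x)) (do {s \<leftarrow> pS; c \<leftarrow> k s; x \<leftarrow> ch c; return_pmf (s, c, x)})
      = bind_pmf (bind_pmf pS k) (\<lambda>c. map_pmf (\<lambda>x. (c, x)) (ch c))"
      by (simp add: map_bind_pmf map_pmf_def bind_assoc_pmf bind_return_pmf)
    then show ?thesis unfolding law kernel_law_def C[symmetric] by (simp add: pmf.map_comp o_def)
  qed
  have "ratio_info pS k ch = pexp (do {s \<leftarrow> pS; c \<leftarrow> k s; x \<leftarrow> ch c; return_pmf (s, c, x)})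
     (\<lambda>(s, c, x). log 2 (pmf (ch c) x / pmf (?q s) x))"
    unfolding ratio_info_def pexp_ratio_law by (simp add: pexp_bind)
  also have "\<dots> = pexp P (\<lambda>\<omega>. log 2 (pmf (ch (C \<omega>)) (X \<omega>) / pmf (?q (S \<omega>)) (X \<omega>)))"
    unfolding law by simp
  also have "\<dots> = pexp P (\<lambda>\<omega>. log 2
    ((self_prob P (\<lambda>\<omega>. (C \<omega>, X \<omega>)) \<omega> / self_prob P C \<omega>) / (self_prob P (\<lambda>\<omega>. (S \<omega>, X \<omega>)) \<omega> / self_prob P S \<omega>)))"
  proof (rule pexp_cong)
    fix \<omega> assume \<omega>: "\<omega> \<in> set_pmf P"
    note pos = self_prob_pos[OF \<omega>, of C] self_prob_pos[OF \<omega>, of S]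
    have "pmf (ch (C \<omega>)) (X \<omega>) = self_prob P (\<lambda>\<omega>. (C \<omega>, X \<omega>)) \<omega> / self_prob P C \<omega>"
      using pos unfolding self_prob_def kernel_law_pmf[OF lawC] by simp
    moreover have "pmf (?q (S \<omega>)) (X \<omega>) = self_prob P (\<lambda>\<omega>. (S \<omega>, X \<omega>)) \<omega> / self_prob P S \<omega>"
      using pos unfolding self_prob_def kernel_law_pmf[OF lawS] by simp
    ultimately show "log 2 (pmf (ch (C \<omega>)) (X \<omega>) / pmf (?q (S \<omega>)) (X \<omega>)) = log 2
    ((self_prob P (\<lambda>\<omega>. (C \<omega>, X \<omega>)) \<omega> / self_prob P C \<omega>) / (self_prob P (\<lambda>\<omega>. (S \<omega>, X \<omega>)) \<omega> / self_prob P S \<omega>))" by simp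
  qed
  finally show ?thesis .
qed

section \<open>From the single-letter distribution to the code\<close>

lemma markov_chain_sym: "markov_chain P A B C \<Longrightarrow> markov_chain P C B A"
  unfolding markov_chain_def by (simp add: conj_commute mult.commute)

lemma finite_set_single_letter:
  fixes P :: "('x::finite, 'y2::finite, 'y3::finite, 'u1::finite, 'u2::finite, 'v1::finite, 'v2::finite, 'w::finite) single_letter pmf"
  shows "finite (set_pmf P)"
proof -
  let ?f = "\<lambda>s :: ('x, 'y2, 'y3, 'u1, 'u2, 'v1, 'v2, 'w) single_letter.
    (rvX s, rvY2 s, rvY3 s, rvU1 s, rvU2 s, rvV1 s, rvV2 s, rvW s)"
  have "inj ?f" by (intro injI single_letter.equality) auto
  moreover have "finite (?f ` UNIV)" by (rule finite_subset[OF subset_UNIV]) simp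
  ultimately have "finite (UNIV :: ('x, 'y2, 'y3, 'u1, 'u2, 'v1, 'v2, 'w) single_letter set)"
    by (rule finite_imageD[rotated])
  then show ?thesis by (rule finite_subset[OF subset_UNIV])
qed

text \<open>The conditions amount to a sampling order \<open>U\<^sub>2, V\<^sub>2, U\<^sub>1,
  V\<^sub>1, X, Y\<^sub>2, Y\<^sub>3, W\<close> in which each kernel reads only what the code
  supplies. The vanishing entropies then identify the covering informations with the given
  ones.\<close>

theorem achievable_of_single_letter:
  fixes PX :: "'x::finite pmf" and PW :: "'x \<Rightarrow> 'y2::finite \<Rightarrow> 'y3::finite \<Rightarrow> 'w::finite pmf"
    and \<pi> :: "'x \<Rightarrow> 'y2 \<Rightarrow> 'y3 \<Rightarrow> 'z::finite \<Rightarrow> real"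
    and P :: "('x, 'y2, 'y3, 'u1::finite, 'u2::finite, 'v1::finite, 'v2::finite, 'w) single_letter pmf"
  assumes PX: "map_pmf rvX P = PX"
    and side: "\<And>x y2 y3 u1 u2 v1 v2 w.
       \<P>(s in P. rvX s = x \<and> rvY2 s = y2 \<and> rvY3 s = y3 \<and>
                 rvU1 s = u1 \<and> rvU2 s = u2 \<and> rvV1 s = v1 \<and> rvV2 s = v2) > 0 \<Longrightarrow>
       \<P>(s in P. rvW s = w \<bar> rvX s = x \<and> rvY2 s = y2 \<and> rvY3 s = y3 \<and>
                 rvU1 s = u1 \<and> rvU2 s = u2 \<and> rvV1 s = v1 \<and> rvV2 s = v2) = pmf (PW x y2 y3) w"
    and mc1: "markov_chain P rvX rvV1 rvY2"
    and mc2: "markov_chain P (\<lambda>s. (rvX s, rvV1 s, rvY2 s)) rvV2 rvY3"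
    and ent1: "cond_entropy P (\<lambda>s. (rvV2 s, rvU1 s)) rvV1 = 0"
    and ent2: "cond_entropy P rvU2 rvU1 = 0"
    and ent3: "cond_entropy P rvU2 rvV2 = 0"
    and mc3: "markov_chain P rvU1 rvU2 rvV2"
    and R0: "R0 > cond_mutual_info P rvW rvV1 rvU1"
    and R1: "R1 \<ge> mutual_info P rvX rvV1"
    and R2: "R2 \<ge> mutual_info P rvX rvV2"
    and payoff: "payoff < (MIN z :: 'u1 \<Rightarrow> 'z. pexp P (\<lambda>s. \<pi> (rvX s) (rvY2 s) (rvY3 s) (z (rvU1 s))))"
  shows "(R0, R1, R2, payoff) \<in> achievable_region PX PW \<pi>"
proof -
  have fin: "finite (set_pmf P)" by (rule finite_set_single_letter)
  obtain f where f: "\<And>s. s \<in> set_pmf P \<Longrightarrow> (rvV2 s, rvU1 s) = f (rvV1 s)"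
    using cond_entropy_zeroD[OF ent1] by blast
  define fV2 where "fV2 v = fst (f v)" for v
  define fU1 where "fU1 v = snd (f v)" for v
  have fV2: "rvV2 s = fV2 (rvV1 s)" and fU1: "rvU1 s = fU1 (rvV1 s)" if "s \<in> set_pmf P" for s
    using f[OF that] by (simp_all add: fV2_def fU1_def prod_eq_iff)
  obtain \<psi> where \<psi>: "\<And>s. s \<in> set_pmf P \<Longrightarrow> rvU2 s = \<psi> (rvU1 s)"
    using cond_entropy_zeroD[OF ent2] by blast
  obtain \<phi> where \<phi>: "\<And>s. s \<in> set_pmf P \<Longrightarrow> rvU2 s = \<phi> (rvV2 s)"
    using cond_entropy_zeroD[OF ent3] by blast

  have dep: "\<psi> (rvU1 s) = rvU2 s" "fV2 (rvV1 s) = rvV2 s" "fU1 (rvV1 s) = rvU1 s" if "s \<in> set_pmf P" for s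
    using that by (simp_all add: \<psi> fU1 fV2)

  define pA where "pA = map_pmf rvU2 P"
  define kB where "kB = reg_cond P rvV2 rvU2"
  define kC where "kC = reg_cond P rvU1 rvU2"
  define kD where "kD u2 v2 u1 = reg_cond P rvV1 (\<lambda>s. ((rvU2 s, rvV2 s), rvU1 s)) ((u2, v2), u1)" for u2 v2 u1
  define chX where "chX = reg_cond P rvX rvV1"
  define chY2 where "chY2 = reg_cond P rvY2 rvV1"
  define chY3 where "chY3 = reg_cond P rvY3 rvV2"
  define qX where "qX = (\<lambda>s. bind_pmf (kAB_D kC kD s) chX)"
  define T where "T = letter_out chX chY2 chY3 PW"

  let ?G1 = "\<lambda>s. (rvU2 s, rvV2 s)"
  let ?G2 = "\<lambda>s. ((rvU2 s, rvV2 s), rvU1 s)"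
  let ?G3 = "\<lambda>s. (((rvU2 s, rvV2 s), rvU1 s), rvV1 s)"
  let ?G4 = "\<lambda>s. ((((rvU2 s, rvV2 s), rvU1 s), rvV1 s), rvX s)"
  let ?G5 = "\<lambda>s. (((((rvU2 s, rvV2 s), rvU1 s), rvV1 s), rvX s), rvY2 s)"
  let ?G6 = "\<lambda>s. ((((((rvU2 s, rvV2 s), rvU1 s), rvV1 s), rvX s), rvY2 s), rvY3 s)"
  have kl1: "kernel_law P rvU2 rvV2 kB"
    unfolding kB_def by (rule kernel_law_reg_cond)
  \<comment> \<open>The chain \<open>U\<^sub>1 - U\<^sub>2 - V\<^sub>2\<close> lets the kernel of
    \<open>u\<^sub>1\<close> ignore \<open>v\<^sub>2\<close>; the swap restores the order of the
    pair.\<close>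
  have kl2: "kernel_law P ?G1 rvU1 (\<lambda>(u2, v2). kC u2)"
  proof -
    have "kernel_law P ?G1 rvU1 (\<lambda>g. reg_cond P rvU1 rvU2 (snd (prod.swap g)))"
      by (rule kernel_law_equiv[OF kernel_law_markov[OF markov_chain_sym[OF mc3]], where h' = prod.swap]) simp_all
    then show ?thesis unfolding kC_def case_prod_unfold snd_swap .
  qed
  have kl3: "kernel_law P ?G2 rvV1 (\<lambda>((u2, v2), u1). kD u2 v2 u1)"
    using kernel_law_reg_cond[of P ?G2 rvV1] by (simp add: kD_def case_prod_unfold)
  \<comment> \<open>On the support \<open>v\<^sub>1\<close> determines \<open>u\<^sub>2\<close>,
    \<open>v\<^sub>2\<close> and \<open>u\<^sub>1\<close>, so conditioning on all four is
    conditioning on \<open>v\<^sub>1\<close>. The two kernels that follow are extended in the same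
    way.\<close>
  have kl4: "kernel_law P ?G3 rvX (\<lambda>(((u2, v2), u1), v1). chX v1)"
  proof -
    have "kernel_law P ?G3 rvX (\<lambda>g. chX (snd g))"
      unfolding chX_def
      by (rule kernel_law_equiv[OF kernel_law_reg_cond, where h' = "\<lambda>v. (((\<psi> (fU1 v), fV2 v), fU1 v), v)"])
        (simp_all only: dep snd_conv)
    then show ?thesis by (simp only: case_prod_unfold)
  qed
  have kl5: "kernel_law P ?G4 rvY2 (\<lambda>((((u2, v2), u1), v1), x). chY2 v1)"
  proof -
    have "kernel_law P ?G4 rvY2 (\<lambda>g. reg_cond P rvY2 rvV1 (snd (snd g, snd (fst g))))"
      by (rule kernel_law_equiv[OF kernel_law_markov[OF mc1], where h = "\<lambda>g. (snd g, snd (fst g))"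
            and h' = "\<lambda>xv. ((((\<psi> (fU1 (snd xv)), fV2 (snd xv)), fU1 (snd xv)), snd xv), fst xv)"])
        (simp_all only: dep fst_conv snd_conv)
    then show ?thesis by (simp only: chY2_def case_prod_unfold snd_conv)
  qed
  have kl6: "kernel_law P ?G5 rvY3 (\<lambda>(((((u2, v2), u1), v1), x), y2). chY3 v2)"
  proof -
    let ?v = "\<lambda>g :: ('x \<times> 'v1 \<times> 'y2) \<times> 'v2. fst (snd (fst g))"
    let ?h = "\<lambda>g :: ((((('u2 \<times> 'v2) \<times> 'u1) \<times> 'v1) \<times> 'x) \<times> 'y2).
      ((snd (fst g), snd (fst (fst g)), snd g), snd (fst (fst (fst (fst g)))))"
    have "kernel_law P ?G5 rvY3 (\<lambda>g. reg_cond P rvY3 rvV2 (snd (?h g)))"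
      by (rule kernel_law_equiv[OF kernel_law_markov[OF mc2], where h = ?h
            and h' = "\<lambda>g. (((((\<psi> (fU1 (?v g)), fV2 (?v g)), fU1 (?v g)), ?v g), fst (fst g)), snd (snd (fst g)))"])
        (simp_all only: dep fst_conv snd_conv)
    then show ?thesis by (simp only: chY3_def case_prod_unfold snd_conv)
  qed
  have kl7: "kernel_law P ?G6 rvW (\<lambda>((((((u2, v2), u1), v1), x), y2), y3). PW x y2 y3)"
  proof (rule kernel_lawI)
    fix g w assume pos: "0 < pmf (map_pmf ?G6 P) g"
    obtain u2 v2 u1 v1 x y2 y3 where g: "g = ((((((u2, v2), u1), v1), x), y2), y3)"
      by (metis surj_pair)
    let ?E = "{s :: ('x, 'y2, 'y3, 'u1, 'u2, 'v1, 'v2, 'w) single_letter. rvX s = x \<and> rvY2 s = y2 \<and> rvY3 s = y3 \<and> rvU1 s = u1 \<and> rvU2 s = u2 \<and> rvV1 s = v1 \<and> rvV2 s = v2}"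
    let ?F = "{s :: ('x, 'y2, 'y3, 'u1, 'u2, 'v1, 'v2, 'w) single_letter. rvW s = w \<and> rvX s = x \<and> rvY2 s = y2 \<and> rvY3 s = y3 \<and> rvU1 s = u1 \<and> rvU2 s = u2 \<and> rvV1 s = v1 \<and> rvV2 s = v2}"
    have "?G6 -` {g} = ?E" by (auto simp: g)
    then have E: "pmf (map_pmf ?G6 P) g = measure_pmf.prob P ?E" by (simp only: pmf_map)
    have "(\<lambda>s. (?G6 s, rvW s)) -` {(g, w)} = ?F" by (auto simp: g)
    then have F: "pmf (map_pmf (\<lambda>s. (?G6 s, rvW s)) P) (g, w) = measure_pmf.prob P ?F" by (simp only: pmf_map)
    have "measure_pmf.prob P ?F / measure_pmf.prob P ?E = pmf (PW x y2 y3) w"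
      using side[of x y2 y3 u1 u2 v1 v2 w] pos unfolding E cond_prob_def by simp
    then show "pmf (map_pmf (\<lambda>s. (?G6 s, rvW s)) P) (g, w) = pmf (map_pmf ?G6 P) g *
        pmf ((\<lambda>((((((u2, v2), u1), v1), x), y2), y3). PW x y2 y3) g) w"
      using pos unfolding E F by (simp add: g field_simps)
  qed
  have full: "map_pmf (\<lambda>s. (?G6 s, rvW s)) P = do {
      u2 \<leftarrow> pA; v2 \<leftarrow> kB u2; u1 \<leftarrow> kC u2; v1 \<leftarrow> kD u2 v2 u1; x \<leftarrow> chX v1; y2 \<leftarrow> chY2 v1; y3 \<leftarrow> chY3 v2; w \<leftarrow> PW x y2 y3;
      return_pmf (((((((u2, v2), u1), v1), x), y2), y3), w)}"
    unfolding kl7[unfolded kernel_law_def] kl6[unfolded kernel_law_def] kl5[unfolded kernel_law_def]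
      kl4[unfolded kernel_law_def] kl3[unfolded kernel_law_def] kl2[unfolded kernel_law_def] kl1[unfolded kernel_law_def]
    unfolding pA_def map_pmf_def by (simp add: bind_assoc_pmf bind_return_pmf)

  have J1: "do {s \<leftarrow> pAB pA kB; d \<leftarrow> kAB_D kC kD s; x \<leftarrow> chX d; return_pmf (s, d, x)}
     = map_pmf (\<lambda>s. ((rvU2 s, rvV2 s), rvV1 s, rvX s)) P"
  proof -
    have "map_pmf (\<lambda>s. ((rvU2 s, rvV2 s), rvV1 s, rvX s)) P
      = map_pmf (\<lambda>(((((((u2, v2), u1), v1), x), y2), y3), w). ((u2, v2), v1, x)) (map_pmf (\<lambda>s. (?G6 s, rvW s)) P)"
      by (simp add: pmf.map_comp o_def)
    also have "\<dots> = do {s \<leftarrow> pAB pA kB; d \<leftarrow> kAB_D kC kD s; x \<leftarrow> chX d; return_pmf (s, d, x)}"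
      unfolding full by (simp add: map_bind_pmf pAB_def kAB_D_def bind_assoc_pmf bind_return_pmf)
    finally show ?thesis ..
  qed
  have J2: "do {s \<leftarrow> return_pmf (); c \<leftarrow> pAB pA kB; x \<leftarrow> qX c; return_pmf (s, c, x)}
     = map_pmf (\<lambda>s. ((), (rvU2 s, rvV2 s), rvX s)) P"
  proof -
    have "do {s \<leftarrow> return_pmf (); c \<leftarrow> pAB pA kB; x \<leftarrow> qX c; return_pmf (s, c, x)}
      = map_pmf (\<lambda>(s, d, x). ((), s, x)) (do {s \<leftarrow> pAB pA kB; d \<leftarrow> kAB_D kC kD s; x \<leftarrow> chX d; return_pmf (s, d, x)})"
      by (simp add: map_bind_pmf qX_def bind_assoc_pmf bind_return_pmf)
    then show ?thesis unfolding J1 by (simp add: pmf.map_comp o_def)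
  qed
  have J3: "do {s \<leftarrow> pAB pA kC; c \<leftarrow> kAC_BD kB kD s; x \<leftarrow> T c; return_pmf (s, c, x)}
     = map_pmf (\<lambda>s. ((rvU2 s, rvU1 s), (rvV2 s, rvV1 s), (rvX s, rvY2 s, rvY3 s, rvW s))) P"
  proof -
    have "map_pmf (\<lambda>s. ((rvU2 s, rvU1 s), (rvV2 s, rvV1 s), (rvX s, rvY2 s, rvY3 s, rvW s))) P
      = map_pmf (\<lambda>(((((((u2, v2), u1), v1), x), y2), y3), w). ((u2, u1), (v2, v1), (x, y2, y3, w))) (map_pmf (\<lambda>s. (?G6 s, rvW s)) P)"
      by (simp add: pmf.map_comp o_def)
    also have "\<dots> = do {
      u2 \<leftarrow> pA; v2 \<leftarrow> kB u2; u1 \<leftarrow> kC u2; v1 \<leftarrow> kD u2 v2 u1; x \<leftarrow> chX v1; y2 \<leftarrow> chY2 v1; y3 \<leftarrow> chY3 v2; w \<leftarrow> PW x y2 y3;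
      return_pmf ((u2, u1), (v2, v1), (x, y2, y3, w))}"
      unfolding full by (simp add: map_bind_pmf)
    \<comment> \<open>Both \<open>v\<^sub>2\<close> and \<open>u\<^sub>1\<close> are drawn from
      \<open>u\<^sub>2\<close> alone; exchanging them gives the order seen by the adversary.\<close>
    also have "\<dots> = do {
      u2 \<leftarrow> pA; u1 \<leftarrow> kC u2; v2 \<leftarrow> kB u2; v1 \<leftarrow> kD u2 v2 u1; x \<leftarrow> chX v1; y2 \<leftarrow> chY2 v1; y3 \<leftarrow> chY3 v2; w \<leftarrow> PW x y2 y3;
      return_pmf ((u2, u1), (v2, v1), (x, y2, y3, w))}"
      by (intro bind_pmf_cong refl bind_commute_pmf)
    also have "\<dots> = do {s \<leftarrow> pAB pA kC; c \<leftarrow> kAC_BD kB kD s; x \<leftarrow> T c; return_pmf (s, c, x)}"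
      by (simp add: pAB_def kAC_BD_def T_def letter_out_def bind_assoc_pmf bind_return_pmf)
    finally show ?thesis ..
  qed
  have J3': "do {s \<leftarrow> pAB pA kC; c \<leftarrow> kAC_BD kB kD s; x \<leftarrow> map_pmf see_side (T c); return_pmf (s, c, x)}
     = map_pmf (\<lambda>s. ((rvU2 s, rvU1 s), (rvV2 s, rvV1 s), (rvW s, None :: ('x \<times> 'y2 \<times> 'y3) option))) P"
  proof -
    have "do {s \<leftarrow> pAB pA kC; c \<leftarrow> kAC_BD kB kD s; x \<leftarrow> map_pmf see_side (T c); return_pmf (s, c, x)}
      = map_pmf (\<lambda>(s, c, x). (s, c, see_side x)) (do {s \<leftarrow> pAB pA kC; c \<leftarrow> kAC_BD kB kD s; x \<leftarrow> T c; return_pmf (s, c, x)})"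
      by (simp add: map_bind_pmf bind_map_pmf)
    then show ?thesis unfolding J3 by (simp add: pmf.map_comp o_def see_side_def)
  qed

  have qX_PX: "bind_pmf (pAB pA kB) qX = PX"
  proof -
    have "bind_pmf (pAB pA kB) qX = map_pmf (\<lambda>(s, c, x). x) (do {s \<leftarrow> return_pmf (); c \<leftarrow> pAB pA kB; x \<leftarrow> qX c; return_pmf (s, c, x)})"
      by (simp add: map_bind_pmf bind_return_pmf bind_return_pmf')
    then show ?thesis unfolding J2 by (simp add: pmf.map_comp o_def PX)
  qed

  let ?p = "self_prob P"
  note pos = self_prob_pos
  have i2: "ratio_info (return_pmf ()) (\<lambda>_. pAB pA kB) qX = mutual_info P rvX rvV2"
    unfolding ratio_info_eq[OF J2] mutual_info_eq
  proof (rule pexp_cong)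
    fix s assume s: "s \<in> set_pmf P"
    have "?p (\<lambda>s. ((rvU2 s, rvV2 s), rvX s)) s = ?p (\<lambda>s. (rvX s, rvV2 s)) s" "?p (\<lambda>s. (rvU2 s, rvV2 s)) s = ?p rvV2 s"
      "?p (\<lambda>s. ((), rvX s)) s = ?p rvX s"
      by (rule self_prob_cong; use s in \<open>auto simp: \<phi>\<close>)+
    moreover have "?p (\<lambda>_. ()) s = 1" by (simp add: self_prob_def)
    ultimately show "log 2 (?p (\<lambda>s. ((rvU2 s, rvV2 s), rvX s)) s / ?p (\<lambda>s. (rvU2 s, rvV2 s)) s / (?p (\<lambda>s. ((), rvX s)) s / ?p (\<lambda>s. ()) s))
      = log 2 (?p (\<lambda>s. (rvX s, rvV2 s)) s / (?p rvX s * ?p rvV2 s))"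
      by (simp add: mult.commute)
  qed
  \<comment> \<open>The chain rule, outcome by outcome: the terms of
    \<open>(u\<^sub>2, v\<^sub>2)\<close> cancel between the two logarithms.\<close>
  have i12: "ratio_info (pAB pA kB) (kAB_D kC kD) chX + ratio_info (return_pmf ()) (\<lambda>_. pAB pA kB) qX = mutual_info P rvX rvV1"
    unfolding ratio_info_eq[OF J1] ratio_info_eq[OF J2] mutual_info_eq pexp_add[OF fin, symmetric]
  proof (rule pexp_cong)
    fix s assume s: "s \<in> set_pmf P"
    have "?p (\<lambda>s. (rvV1 s, rvX s)) s = ?p (\<lambda>s. (rvX s, rvV1 s)) s" "?p (\<lambda>s. ((), rvX s)) s = ?p rvX s"
      by (rule self_prob_cong; auto)+
    moreover have "?p (\<lambda>_. ()) s = 1" by (simp add: self_prob_def)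
    ultimately show "log 2 (?p (\<lambda>s. (rvV1 s, rvX s)) s / ?p rvV1 s / (?p (\<lambda>s. ((rvU2 s, rvV2 s), rvX s)) s / ?p (\<lambda>s. (rvU2 s, rvV2 s)) s))
      + log 2 (?p (\<lambda>s. ((rvU2 s, rvV2 s), rvX s)) s / ?p (\<lambda>s. (rvU2 s, rvV2 s)) s / (?p (\<lambda>s. ((), rvX s)) s / ?p (\<lambda>s. ()) s))
      = log 2 (?p (\<lambda>s. (rvX s, rvV1 s)) s / (?p rvX s * ?p rvV1 s))"
      using pos[OF s, of "\<lambda>s. (rvX s, rvV1 s)"] pos[OF s, of rvV1] pos[OF s, of rvX]
        pos[OF s, of "\<lambda>s. ((rvU2 s, rvV2 s), rvX s)"] pos[OF s, of "\<lambda>s. (rvU2 s, rvV2 s)"]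
      by (simp add: log_divide log_mult)
  qed
  \<comment> \<open>\<open>v\<^sub>2\<close> and \<open>u\<^sub>1\<close> are functions of
    \<open>v\<^sub>1\<close>, and \<open>u\<^sub>2\<close> is one of \<open>u\<^sub>1\<close>, so
    tuples with and without them have the same probabilities. The marginal of \<open>W\<close>
    cancels in the difference.\<close>
  have i3: "ratio_info (pAB pA kC) (kAC_BD kB kD) (\<lambda>c. map_pmf see_side (T c)) = cond_mutual_info P rvW rvV1 rvU1"
    unfolding ratio_info_eq[OF J3'] cond_mutual_info_eq mutual_info_eq pexp_diff[OF fin, symmetric]
  proof (rule pexp_cong)
    fix s assume s: "s \<in> set_pmf P"
    let ?W = "\<lambda>s. (rvW s, None :: ('x \<times> 'y2 \<times> 'y3) option)"
    have "?p (\<lambda>s. ((rvV2 s, rvV1 s), ?W s)) s = ?p (\<lambda>s. (rvW s, rvV1 s, rvU1 s)) s"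
      "?p (\<lambda>s. (rvV2 s, rvV1 s)) s = ?p (\<lambda>s. (rvV1 s, rvU1 s)) s"
      "?p (\<lambda>s. ((rvU2 s, rvU1 s), ?W s)) s = ?p (\<lambda>s. (rvW s, rvU1 s)) s"
      "?p (\<lambda>s. (rvU2 s, rvU1 s)) s = ?p rvU1 s"
      by (rule self_prob_cong; use s in \<open>auto simp: \<psi> fV2 fU1\<close>)+
    then show "log 2 (?p (\<lambda>s. ((rvV2 s, rvV1 s), ?W s)) s / ?p (\<lambda>s. (rvV2 s, rvV1 s)) s /
        (?p (\<lambda>s. ((rvU2 s, rvU1 s), ?W s)) s / ?p (\<lambda>s. (rvU2 s, rvU1 s)) s))
      = log 2 (?p (\<lambda>s. (rvW s, rvV1 s, rvU1 s)) s / (?p rvW s * ?p (\<lambda>s. (rvV1 s, rvU1 s)) s))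
       - log 2 (?p (\<lambda>s. (rvW s, rvU1 s)) s / (?p rvW s * ?p rvU1 s))"
      using pos[OF s, of rvW] pos[OF s, of "\<lambda>s. (rvW s, rvV1 s, rvU1 s)"] pos[OF s, of "\<lambda>s. (rvV1 s, rvU1 s)"]
        pos[OF s, of "\<lambda>s. (rvW s, rvU1 s)"] pos[OF s, of rvU1]
      by (simp add: log_divide log_mult)
  qed

  define m where "m s z = pexp (bind_pmf (kAC_BD kB kD s) T) (\<lambda>(x, y2, y3, w). \<pi> x y2 y3 z)" for s z
  \<comment> \<open>The best guess for each \<open>(u\<^sub>2, u\<^sub>1)\<close> is in effect a
    function of \<open>u\<^sub>1\<close>, because \<open>u\<^sub>2\<close> is one. So the minimum
    over functions \<open>z\<close> is at most the average of the letterwise minima.\<close>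
  define best where "best s = (SOME z. m s z = (MIN z. m s z))" for s
  have best: "m s (best s) = (MIN z. m s z)" for s
  proof -
    have "(MIN z. m s z) \<in> range (m s)" by (intro Min_in) auto
    then show ?thesis unfolding best_def by (metis (mono_tags, lifting) imageE someI_ex)
  qed
  have "(MIN z :: 'u1 \<Rightarrow> 'z. pexp P (\<lambda>s. \<pi> (rvX s) (rvY2 s) (rvY3 s) (z (rvU1 s))))
    \<le> pexp P (\<lambda>s. \<pi> (rvX s) (rvY2 s) (rvY3 s) (best (\<psi> (rvU1 s), rvU1 s)))"
    by (rule Min_le) (auto intro: image_eqI[of _ _ "\<lambda>u. best (\<psi> u, u)"])
  also have "\<dots> = pexp P (\<lambda>s. \<pi> (rvX s) (rvY2 s) (rvY3 s) (best (rvU2 s, rvU1 s)))"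
    by (rule pexp_cong) (simp add: \<psi>)
  also have "\<dots> = pexp (do {s \<leftarrow> pAB pA kC; c \<leftarrow> kAC_BD kB kD s; x \<leftarrow> T c; return_pmf (s, c, x)})
     (\<lambda>(s, c, x, y2, y3, w). \<pi> x y2 y3 (best s))"
    unfolding J3 by simp
  also have "\<dots> = pexp (pAB pA kC) (\<lambda>s. m s (best s))"
    unfolding m_def by (simp add: pexp_bind)
  also have "\<dots> = pexp (pAB pA kC) (\<lambda>s. MIN z. m s z)" unfolding best ..
  finally have pay: "payoff < pexp (pAB pA kC) (\<lambda>s. MIN z. m s z)"
    by (rule less_le_trans[OF payoff])

  show ?thesis
    by (rule superposition_coding_boundary[of pA kB kC kD chX PX chY2 chY3 PW])
      (use qX_PX i2 i12 i3 R0 R1 R2 pay in \<open>simp_all add: qX_def T_def m_def\<close>)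
qed

theorem mainTheorem2:
  fixes PX :: "'x::finite pmf"
    and PW1 :: "'x \<Rightarrow> 'w1::finite pmf"
    and PW2 :: "'y2::finite \<Rightarrow> 'w2::finite pmf"
    and PW3 :: "'y3::finite \<Rightarrow> 'w3::finite pmf"
    and \<pi> :: "'x \<Rightarrow> 'y2 \<Rightarrow> 'y3 \<Rightarrow> 'z::finite \<Rightarrow> real"
  shows
    "{(R0, R1, R2, payoff).
        \<exists>P :: ('x, 'y2, 'y3, 'u1::finite, 'u2::finite, 'v1::finite, 'v2::finite, 'w1 \<times> 'w2 \<times> 'w3)
               single_letter pmf.
          map_pmf rvX P = PX \<and>
          (\<forall>x y2 y3 u1 u2 v1 v2 w.
             \<P>(s in P. rvX s = x \<and> rvY2 s = y2 \<and> rvY3 s = y3 \<and>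
                       rvU1 s = u1 \<and> rvU2 s = u2 \<and> rvV1 s = v1 \<and> rvV2 s = v2) > 0 \<longrightarrow>
             \<P>(s in P. rvW s = w \<bar> rvX s = x \<and> rvY2 s = y2 \<and> rvY3 s = y3 \<and>
                       rvU1 s = u1 \<and> rvU2 s = u2 \<and> rvV1 s = v1 \<and> rvV2 s = v2)
               = pmf (side_info_channel PW1 PW2 PW3 x y2 y3) w) \<and>
          markov_chain P rvX rvV1 rvY2 \<and>
          markov_chain P (\<lambda>s. (rvX s, rvV1 s, rvY2 s)) rvV2 rvY3 \<and>
          cond_entropy P (\<lambda>s. (rvV2 s, rvU1 s)) rvV1 = 0 \<and>
          cond_entropy P rvU2 rvU1 = 0 \<and>
          cond_entropy P rvU2 rvV2 = 0 \<and>
          markov_chain P rvU1 rvU2 rvV2 \<and>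
          R0 > cond_mutual_info P rvW rvV1 rvU1 \<and>
          R1 \<ge> mutual_info P rvX rvV1 \<and>
          R2 \<ge> mutual_info P rvX rvV2 \<and>
          payoff < (MIN z :: 'u1 \<Rightarrow> 'z.
                 measure_pmf.expectation P (\<lambda>s. \<pi> (rvX s) (rvY2 s) (rvY3 s) (z (rvU1 s))))}
     \<subseteq> achievable_region PX (side_info_channel PW1 PW2 PW3) \<pi>"
  by (intro subsetI, clarify, rule achievable_of_single_letter) blast+

end
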